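(* Let $k\in\mathbb{N}$ and let $\Lambda=(\lambda_0,\lambda_1,\ldots,\lambda_k)$ with $\lambda_0<\infty$, $\lambda_0\ge\lambda_1\ge k$ and $\lambda_j=\lambda_1/j$ for $2\le j\le k$. Let $G_m:=W^{k,\Lambda}(\mu)$. Then: (i) for any $a\in G_m$, $\psi(a)\in G_m$, where $\psi(a)(x):=\psi(a(x))$; (ii) the nonlinear superposition (Nemytskii) operator $\Psi_m:G_m\to G_m$, defined by $\Psi_m(a)(x)=\psi(a(x))$, is continuous; (iii) the set $\Psi_m(G_m)$ is convex.
   Context: $\mathbb{N}=\{1,2,\ldots\}$. Reference measure: fix $t\in(0,2]$ and a strictly increasing function $\theta:[0,\infty)\to[0,\infty)$, twice continuously differentiable on $(0,\infty)$, with $\lim_{z\downarrow0}\theta'(z)<\infty$, $\theta(0)=0$, and $\theta(z)=c+z^t$ for all $z\ge z_t$ (with $z>0$), where $z_t\ge0$ and $c\in\mathbb{R}$ are constants; if $t\in(1,2]$, both $\theta$ and $-\sqrt{\theta}$ are also required to be convex. For $d\in\mathbb{N}$, $\mu$ is the probability measure on the Lebesgue measurable subsets of $\mathbb{R}^d$ given by $\mu(dx)=r(x)\,dx$, $r=\exp(l)$, $l(x)=\sum_{i=1}^d(C-\theta(|x_i|))$, where $C\in\mathbb{R}$ is such that $\int_{\mathbb{R}}\exp(C-\theta(|z|))\,dz=1$. Sobolev spaces: for $k\in\mathbb{N}$ and $\Lambda=(\lambda_0,\ldots,\lambda_k)$ with $1\le\lambda_k\le\lambda_{k-1}\le\cdots\le\lambda_0<\infty$,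 $W^{k,\Lambda}(\mu)$ is the space of real-valued functions $a\in L^{\lambda_0}(\mu)$ having weak partial derivatives $D^sa\in L^{\lambda_{|s|}}(\mu)$ for all multi-indices $s$ with $1\le|s|\le k$, with norm $\|a\|_{W^{k,\Lambda}(\mu)}=\big(\sum_{0\le|s|\le k}\|D^sa\|_{L^{\lambda_{|s|}}(\mu)}^{\lambda_0}\big)^{1/\lambda_0}$. Deformed exponential: $\psi:\mathbb{R}\to(0,\infty)$ is the inverse of the diffeomorphism $\log_d:(0,\infty)\to\mathbb{R}$, $\log_d y=y-1+\log y$. *)

theory Defs
  imports "HOL-Analysis.Analysis"
begin

section \<open>The deformed exponential\<close>

definition log_d :: "real \<Rightarrow> real" where
  "log_d y = y - 1 + ln y"

definition psi :: "real \<Rightarrow> real" where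
  "psi = inv_into {0<..} log_d"

lemma bij_betw_log_d: "bij_betw log_d {0<..} UNIV"
proof -
  have mono: "log_d x < log_d y" if "0 < x" "x < y" for x y
    using that by (simp add: log_d_def add_strict_mono)
  have inj: "inj_on log_d {0<..}"
  proof (rule inj_onI)
    fix x y assume "x \<in> {0<..}" "y \<in> {0<..}" "log_d x = log_d y"
    then show "x = y" using mono[of x y] mono[of y x] by (cases x y rule: linorder_cases) auto
  qed
  have "z \<in> log_d ` {0<..}" for z
  proof -
    define a where "a = exp (- \<bar>z\<bar>)"
    define b where "b = 1 + \<bar>z\<bar>"
    have a: "0 < a" "a \<le> 1" and b: "1 \<le> b" by (auto simp: a_def b_def)
    have "ln a = - \<bar>z\<bar>" by (simp add: a_def)
    then have "log_d a \<le> z" unfolding log_d_def using a(2) by linarith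
    moreover have "z \<le> log_d b"
      unfolding log_d_def using ln_ge_zero[OF b] b_def by linarith
    moreover have "continuous_on {a..b} log_d"
      unfolding log_d_def using a by (intro continuous_intros) auto
    ultimately obtain x where "a \<le> x" "log_d x = z"
      using IVT'[of log_d a z b] a b by auto
    then show ?thesis using a by (intro image_eqI[of _ _ x]) simp_all
  qed
  then have "log_d ` {0<..} = UNIV" by blast
  with inj show ?thesis by (simp add: bij_betw_def)
qed

section \<open>The reference measure\<close>

text \<open>Only the values of \<open>\<theta>\<close> on \<open>[0,\<infinity>)\<close> are constrained (and used below).\<close>

definition admissible_theta :: "real \<Rightarrow> (real \<Rightarrow> real) \<Rightarrow> bool" where
  "admissible_theta t \<theta> \<longleftrightarrow>
     0 < t \<and> t \<le> 2 \<and>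
     \<theta> ` {0..} \<subseteq> {0..} \<and> strict_mono_on {0..} \<theta> \<and> \<theta> 0 = 0 \<and>
     \<theta> differentiable_on {0<..} \<and> deriv \<theta> differentiable_on {0<..} \<and>
     continuous_on {0<..} (deriv (deriv \<theta>)) \<and>
     (\<exists>L. (deriv \<theta> \<longlongrightarrow> L) (at_right 0)) \<and>
     (\<exists>c z\<^sub>t. z\<^sub>t \<ge> 0 \<and> (\<forall>z. z \<ge> z\<^sub>t \<and> z > 0 \<longrightarrow> \<theta> z = c + z powr t)) \<and>
     (1 < t \<longrightarrow> convex_on {0..} \<theta> \<and> convex_on {0..} (\<lambda>z. - sqrt (\<theta> z)))"

definition ref_log_density :: "(real \<Rightarrow> real) \<Rightarrow> real \<Rightarrow> real^'n \<Rightarrow> real" where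
  "ref_log_density \<theta> C x = (\<Sum>i\<in>UNIV. C - \<theta> \<bar>x $ i\<bar>)"

definition ref_measure :: "(real \<Rightarrow> real) \<Rightarrow> real \<Rightarrow> (real^'n) measure" where
  "ref_measure \<theta> C = density lebesgue (\<lambda>x. ennreal (exp (ref_log_density \<theta> C x)))"

section \<open>Lebesgue spaces\<close>

text \<open>Elements are functions rather than classes modulo null sets, so \<open>Lp_norm\<close> is a seminorm.\<close>

definition Lp_space :: "real \<Rightarrow> 'a measure \<Rightarrow> ('a \<Rightarrow> real) set" where
  "Lp_space p M = {f \<in> borel_measurable M. integrable M (\<lambda>x. \<bar>f x\<bar> powr p)}"

definition Lp_norm :: "real \<Rightarrow> 'a measure \<Rightarrow> ('a \<Rightarrow> real) \<Rightarrow> real" where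
  "Lp_norm p M f = (\<integral>x. \<bar>f x\<bar> powr p \<partial>M) powr (1 / p)"

section \<open>Weak derivatives\<close>

text \<open>Multi-indices are functions \<open>s :: 'n \<Rightarrow> nat\<close> on the set of coordinates.\<close>

definition mi_order :: "('n::finite \<Rightarrow> nat) \<Rightarrow> nat" where
  "mi_order s = (\<Sum>i\<in>UNIV. s i)"

lemma finite_mi_order_le: "finite {s :: 'n::finite \<Rightarrow> nat. mi_order s \<le> k}"
proof (rule finite_subset)
  have "s i \<le> mi_order s" for s :: "'n \<Rightarrow> nat" and i
    unfolding mi_order_def by (rule member_le_sum) simp_all
  then show "{s :: 'n \<Rightarrow> nat. mi_order s \<le> k} \<subseteq> PiE UNIV (\<lambda>_. {..k})"
    by (auto intro: order_trans)
  show "finite (PiE (UNIV :: 'n set) (\<lambda>_. {..k}))"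
    by (rule finite_PiE) simp_all
qed

definition partial_deriv :: "'n \<Rightarrow> (real^'n::finite \<Rightarrow> real) \<Rightarrow> real^'n \<Rightarrow> real" where
  "partial_deriv i f x = frechet_derivative f (at x) (axis i 1)"

text \<open>The derivatives are applied along an arbitrary fixed enumeration of the coordinates; for the
  smooth functions to which this is applied, the order is immaterial.\<close>

definition multi_partial :: "('n \<Rightarrow> nat) \<Rightarrow> (real^'n::finite \<Rightarrow> real) \<Rightarrow> real^'n \<Rightarrow> real" where
  "multi_partial s f =
     foldr (\<lambda>i. partial_deriv i ^^ s i) (SOME xs. distinct xs \<and> set xs = UNIV) f"

definition smooth_fun :: "(real^'n::finite \<Rightarrow> real) \<Rightarrow> bool" where
  "smooth_fun f \<longleftrightarrow> (\<forall>xs x. foldr partial_deriv xs f differentiable (at x))"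

definition test_fun :: "(real^'n::finite \<Rightarrow> real) \<Rightarrow> bool" where
  "test_fun f \<longleftrightarrow> smooth_fun f \<and> compact (closure {x. f x \<noteq> 0})"

definition locally_integrable :: "(real^'n::finite \<Rightarrow> real) \<Rightarrow> bool" where
  "locally_integrable f \<longleftrightarrow> (\<forall>K. compact K \<longrightarrow> set_integrable lebesgue K f)"

definition is_weak_deriv ::
    "('n::finite \<Rightarrow> nat) \<Rightarrow> (real^'n \<Rightarrow> real) \<Rightarrow> (real^'n \<Rightarrow> real) \<Rightarrow> bool" where
  "is_weak_deriv s a v \<longleftrightarrow>
     locally_integrable a \<and> locally_integrable v \<and>
     (\<forall>\<phi>. test_fun \<phi> \<longrightarrow>
        (\<integral>x. a x * multi_partial s \<phi> x \<partial>lebesgue) =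
        (- 1) ^ mi_order s * (\<integral>x. v x * \<phi> x \<partial>lebesgue))"

text \<open>Weak derivatives are unique up to null sets, so the norm below does not depend on the choice.
  For \<open>s = 0\<close> this is \<open>a\<close> itself up to a null set.\<close>

definition weak_deriv :: "('n::finite \<Rightarrow> nat) \<Rightarrow> (real^'n \<Rightarrow> real) \<Rightarrow> real^'n \<Rightarrow> real" where
  "weak_deriv s a = (SOME v. is_weak_deriv s a v)"

section \<open>Mixed-norm Sobolev spaces\<close>

definition sobolev_space ::
    "nat \<Rightarrow> (nat \<Rightarrow> real) \<Rightarrow> (real^'n::finite) measure \<Rightarrow> (real^'n \<Rightarrow> real) set" where
  "sobolev_space k \<Lambda> \<mu> =
     {a \<in> Lp_space (\<Lambda> 0) \<mu>.
        \<forall>s. 1 \<le> mi_order s \<and> mi_order s \<le> k \<longrightarrow>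
          (\<exists>v \<in> Lp_space (\<Lambda> (mi_order s)) \<mu>. is_weak_deriv s a v)}"

definition sobolev_norm ::
    "nat \<Rightarrow> (nat \<Rightarrow> real) \<Rightarrow> (real^'n::finite) measure \<Rightarrow> (real^'n \<Rightarrow> real) \<Rightarrow> real" where
  "sobolev_norm k \<Lambda> \<mu> a =
     (\<Sum>s | mi_order s \<le> k. Lp_norm (\<Lambda> (mi_order s)) \<mu> (weak_deriv s a) powr \<Lambda> 0)
       powr (1 / \<Lambda> 0)"

text \<open>Continuity for the topology of the seminorm; it passes to classes modulo null sets.\<close>

definition sobolev_continuous ::
    "nat \<Rightarrow> (nat \<Rightarrow> real) \<Rightarrow> (real^'n::finite) measure \<Rightarrow>
     ((real^'n \<Rightarrow> real) \<Rightarrow> (real^'n \<Rightarrow> real)) \<Rightarrow> bool" where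
  "sobolev_continuous k \<Lambda> \<mu> F \<longleftrightarrow>
     (\<forall>a \<in> sobolev_space k \<Lambda> \<mu>. \<forall>\<epsilon>>0. \<exists>\<delta>>0. \<forall>b \<in> sobolev_space k \<Lambda> \<mu>.
        sobolev_norm k \<Lambda> \<mu> (\<lambda>x. b x - a x) < \<delta> \<longrightarrow>
        sobolev_norm k \<Lambda> \<mu> (\<lambda>x. F b x - F a x) < \<epsilon>)"

text \<open>The function type is not an instance of \<open>real_vector\<close>, so the library predicate
  \<open>convex\<close> does not apply.\<close>

definition convex_fun_set :: "('a \<Rightarrow> real) set \<Rightarrow> bool" where
  "convex_fun_set S \<longleftrightarrow>
     (\<forall>f \<in> S. \<forall>g \<in> S. \<forall>u\<ge>0. \<forall>v\<ge>0. u + v = 1 \<longrightarrow> (\<lambda>x. u * f x + v * g x) \<in> S)"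

definition Nemytskii_psi :: "('a \<Rightarrow> real) \<Rightarrow> 'a \<Rightarrow> real" where
  "Nemytskii_psi a = (\<lambda>x. psi (a x))"

end

theory Submission
  imports Defs
begin

text \<open>Superposition is studied for a smooth \<open>\<Phi>(a, b)\<close> whose partial derivatives of order at least one are
  all bounded. A weak derivative in a coordinate direction is characterised by the identity
  \<open>u(x + h e) - u(x) = \<integral>\<^sub>0\<^sup>h v(x + s e) ds\<close> for almost all \<open>x\<close>, so that product and chain rule follow from the
  one-dimensional chain rule for absolutely continuous functions on almost every line, without mollification.
  Derivatives of order \<open>j\<close> of \<open>\<Phi>(a, b)\<close> are then sums of bounded functions times products of derivatives of
  total order \<open>j\<close>, and these lie in \<open>L\<close> with exponent \<open>\<lambda>\<^sub>1 / j\<close>.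

  Part (i) is \<open>\<Phi>(a, b) = \<psi>(a)\<close>. Part (iii) is \<open>\<Phi>(a, b) = log\<^sub>d (u \<psi>(a) + v \<psi>(b))\<close>, whose derivatives are bounded
  although those of \<open>log\<^sub>d\<close> are not. For (ii), sequences converging fast enough converge almost everywhere and are
  dominated together with all their derivatives.\<close>

section \<open>Smooth functions and bump functions\<close>

text \<open>The obstacle is that products of derivatives must be locally integrable at every
  intermediate stage, because the product rule along lines presupposes it. Homogeneity settles this.
  For \<open>1 \<le> |s| \<le> k\<close> the functions |D^s a|^(1/|s|) all lie in L with exponent
  \<open>\<Lambda> 1\<close>; their sum g (\<open>fdb_gauge\<close>) bounds a term of order j by K
  g^j, and (g^j)^(\<Lambda> 1 / j) = g^(\<Lambda> 1). So one integrable function controls all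
  orders, \<open>\<Lambda> 1 \<ge> k\<close> keeps the exponents at least 1, and a lower bound of
  the density on balls turns integrability for \<open>\<mu>\<close> into local integrability. The
  terms are formulas fixed before any function is inserted (\<open>fdb_op\<close>), with K
  independent of the functions; hence in (ii) dominated convergence applies to one formula along the
  whole sequence. Order 0 is treated apart: \<Phi> may be unbounded and \<open>\<Lambda> 0\<close>
  is not a quotient of \<open>\<Lambda> 1\<close>, so linear growth, or the Lipschitz bound of
  \<open>psi\<close>, takes over there.\<close>

lemma partial_deriv_eqI:
  assumes "(f has_derivative f') (at x)" "f' (axis i 1) = y"
  shows "partial_deriv i f x = y"
  unfolding partial_deriv_def using frechet_derivative_at[OF assms(1)] assms(2) by simp

lemma partial_deriv_along_line:
  fixes f :: "real^'n::finite \<Rightarrow> real"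
  assumes "f differentiable (at (x + s *\<^sub>R axis i 1))"
  shows "((\<lambda>s. f (x + s *\<^sub>R axis i 1)) has_real_derivative partial_deriv i f (x + s *\<^sub>R axis i 1)) (at s)"
proof -
  let ?y = "x + s *\<^sub>R axis i 1"
  have d: "(f has_derivative frechet_derivative f (at ?y)) (at ?y)"
    using assms frechet_derivative_works by blast
  then have lin: "linear (frechet_derivative f (at ?y))"
    by (rule has_derivative_linear)
  have "((\<lambda>s. x + s *\<^sub>R axis i 1) has_derivative (\<lambda>s. s *\<^sub>R axis i 1)) (at s)"
    by (auto intro!: derivative_eq_intros)
  from has_derivative_compose[OF this d]
  show ?thesis
    by (simp add: has_field_derivative_def linear_scale[OF lin] partial_deriv_def mult.commute[of _ "frechet_derivative _ _ _"])
qed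

lemma smooth_fun_differentiable: "smooth_fun f \<Longrightarrow> f differentiable (at x)"
  unfolding smooth_fun_def by (metis foldr_Nil id_apply)

lemma smooth_fun_partial_deriv: "smooth_fun f \<Longrightarrow> smooth_fun (partial_deriv i f)"
  unfolding smooth_fun_def
proof (intro allI)
  fix xs x assume a: "\<forall>xs x. foldr partial_deriv xs f differentiable at x"
  have "foldr partial_deriv xs (partial_deriv i f) = foldr partial_deriv (xs @ [i]) f" by simp
  then show "foldr partial_deriv xs (partial_deriv i f) differentiable at x" using a by metis
qed

lemma smooth_fun_continuous: "smooth_fun f \<Longrightarrow> continuous_on A f"
  by (meson continuous_at_imp_continuous_on differentiable_imp_continuous_within smooth_fun_differentiable)

lemma partial_deriv_zero_outside:
  assumes "x \<notin> closure {x. f x \<noteq> 0}"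
  shows "partial_deriv i f x = 0"
proof -
  define S where "S = - closure {x. f x \<noteq> 0}"
  have "open S" unfolding S_def by (rule open_Compl[OF closed_closure])
  moreover have "x \<in> S" using assms by (simp add: S_def)
  moreover have "0 = f y" if "y \<in> S" for y
    using that closure_subset[of "{x. f x \<noteq> 0}"] by (auto simp: S_def)
  ultimately have "(f has_derivative (\<lambda>h. 0)) (at x)"
    by (rule has_derivative_transform_within_open[OF has_derivative_const])
  then show ?thesis by (rule partial_deriv_eqI) simp
qed

lemma test_fun_partial_deriv: "test_fun f \<Longrightarrow> test_fun (partial_deriv i f)"
  unfolding test_fun_def
proof (elim conjE, intro conjI smooth_fun_partial_deriv)
  assume "compact (closure {x. f x \<noteq> 0})"
  moreover have "closure {x. partial_deriv i f x \<noteq> 0} \<subseteq> closure {x. f x \<noteq> 0}"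
    using partial_deriv_zero_outside[of _ f i] by (intro closure_minimal) auto
  ultimately show "compact (closure {x. partial_deriv i f x \<noteq> 0})"
    by (metis closed_closure compact_Int_closed inf.absorb_iff2)
qed

lemma test_fun_foldr_partial_deriv: "test_fun f \<Longrightarrow> test_fun (foldr partial_deriv L f)"
  by (induction L) (auto simp: test_fun_partial_deriv)

lemma partial_deriv_translate:
  fixes f :: "real^'n::finite \<Rightarrow> real"
  shows "partial_deriv i (\<lambda>x. f (x + c)) = (\<lambda>x. partial_deriv i f (x + c))"
proof
  fix x
  \<comment> \<open>\<open>frechet_derivative\<close> is a choice. The two choices agree because the
    predicates chosen from coincide, and this covers points where no derivative exists.\<close>
  have "(\<lambda>D. ((\<lambda>x. f (x + c)) has_derivative D) (at x)) = (\<lambda>D. (f has_derivative D) (at (x + c)))"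
  proof (intro ext iffI)
    fix D assume "(f has_derivative D) (at (x + c))"
    moreover have "((\<lambda>x. x + c) has_derivative (\<lambda>h. h)) (at x)"
      by (auto intro!: derivative_eq_intros)
    ultimately show "((\<lambda>x. f (x + c)) has_derivative D) (at x)"
      using has_derivative_compose by fastforce
  next
    fix D assume a: "((\<lambda>x. f (x + c)) has_derivative D) (at x)"
    have "((\<lambda>x. x - c) has_derivative (\<lambda>h. h)) (at (x + c))"
      by (auto intro!: derivative_eq_intros)
    with a show "(f has_derivative D) (at (x + c))"
      using has_derivative_compose[of "\<lambda>x. x - c" "\<lambda>h. h" "x + c" UNIV "\<lambda>x. f (x + c)" D] by simp
  qed
  then show "partial_deriv i (\<lambda>x. f (x + c)) x = partial_deriv i f (x + c)"
    unfolding partial_deriv_def frechet_derivative_def by metis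
qed

lemma foldr_partial_deriv_translate:
  fixes f :: "real^'n::finite \<Rightarrow> real"
  shows "foldr partial_deriv L (\<lambda>x. f (x + c)) = (\<lambda>x. foldr partial_deriv L f (x + c))"
  by (induction L) (auto simp: partial_deriv_translate)

lemma test_fun_translate:
  fixes f :: "real^'n::finite \<Rightarrow> real"
  assumes "test_fun f"
  shows "test_fun (\<lambda>x. f (x + c))"
proof -
  have "smooth_fun (\<lambda>x. f (x + c))"
    unfolding smooth_fun_def foldr_partial_deriv_translate
  proof (intro allI)
    fix xs x
    have "foldr partial_deriv xs f differentiable at (x + c)"
      using assms by (simp add: test_fun_def smooth_fun_def)
    moreover have "(\<lambda>x. x + c) differentiable at x" by simp
    ultimately show "(\<lambda>x. foldr partial_deriv xs f (x + c)) differentiable at x"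
      using differentiable_chain_at[of "\<lambda>x. x + c" x "foldr partial_deriv xs f"] by (simp add: o_def)
  qed
  moreover have "closure {x. f (x + c) \<noteq> 0} = (\<lambda>x. x + (- c)) ` closure {x. f x \<noteq> 0}"
  proof -
    have "{x. f (x + c) \<noteq> 0} = (\<lambda>x. -c + x) ` {x. f x \<noteq> 0}"
    proof -
      have "x \<in> (\<lambda>x. -c + x) ` {x. f x \<noteq> 0}" if "f (x + c) \<noteq> 0" for x
        using that by (intro image_eqI[of _ _ "x + c"]) auto
      then show ?thesis by auto
    qed
    then show ?thesis using closure_translation[of "-c" "{x. f x \<noteq> 0}"] by simp
  qed
  ultimately show ?thesis
    using assms compact_translation[of "closure {x. f x \<noteq> 0}" "-c"]
    by (simp add: test_fun_def add.commute)
qed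

lemma test_fun_continuous: "test_fun f \<Longrightarrow> continuous_on A f"
  by (simp add: test_fun_def smooth_fun_continuous)

lemma test_fun_borel: "test_fun f \<Longrightarrow> f \<in> borel_measurable borel"
  by (simp add: borel_measurable_continuous_onI test_fun_continuous)

lemma test_fun_bounded:
  assumes "test_fun f"
  obtains B where "\<And>x. \<bar>f x\<bar> \<le> B"
proof -
  let ?K = "closure {x. f x \<noteq> 0}"
  have "compact (f ` ?K)"
    using assms by (intro compact_continuous_image test_fun_continuous) (auto simp: test_fun_def)
  then obtain B where B: "\<And>y. y \<in> f ` ?K \<Longrightarrow> \<bar>y\<bar> \<le> B"
    using compact_imp_bounded bounded_iff by (metis real_norm_def)
  have "\<bar>f x\<bar> \<le> max B 0" for x
  proof (cases "f x = 0")
    case False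
    then have "x \<in> ?K" using closure_subset[of "{x. f x \<noteq> 0}"] by auto
    then show ?thesis using B by force
  qed simp
  then show ?thesis using that by blast
qed

text \<open>The flat functions \<open>t \<mapsto> t\<^sup>-\<^sup>m exp (-1/t)\<close> are closed under differentiation up to linear combinations.\<close>

definition flat :: "nat \<Rightarrow> real \<Rightarrow> real" where
  "flat m t = (if t > 0 then inverse t ^ m * exp (- inverse t) else 0)"

lemma flat_nonneg: "0 \<le> flat m t"
  by (simp add: flat_def)

lemma flat_tendsto_0: "(flat m \<longlongrightarrow> 0) (at_right 0)"
proof -
  have "((\<lambda>x::real. x ^ m / exp x) \<longlongrightarrow> 0) at_top" by (rule tendsto_power_div_exp_0)
  from filterlim_compose[OF this filterlim_inverse_at_top_right]
  have "((\<lambda>t::real. inverse t ^ m / exp (inverse t)) \<longlongrightarrow> 0) (at_right 0)" .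
  then show ?thesis
    by (rule Lim_transform_eventually)
      (auto simp: eventually_at_filter flat_def exp_minus field_simps)
qed

lemma has_derivative_flat:
  "(flat m has_real_derivative (- real m * flat (m + 1) t + flat (m + 2) t)) (at t)"
proof (cases t "0::real" rule: linorder_cases)
  case less
  have "((\<lambda>_. 0) has_real_derivative 0) (at t)" by simp
  then have "(flat m has_real_derivative 0) (at t)"
    by (rule DERIV_cong_ev[THEN iffD1, OF refl _ refl, rotated])
      (use eventually_nhds_in_open[of "{..<0}" t] less in \<open>auto simp: flat_def elim!: eventually_mono\<close>)
  then show ?thesis using less by (simp add: flat_def)
next
  case greater
  have "((\<lambda>t. inverse t ^ m * exp (- inverse t)) has_real_derivative
     - real m * (inverse t ^ (m + 1) * exp (- inverse t)) + (inverse t ^ (m + 2) * exp (- inverse t))) (at t)"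
    using greater
    by (cases m) (auto intro!: derivative_eq_intros simp: field_simps power2_eq_square power_Suc[symmetric] simp del: power_Suc,
        simp_all add: field_simps power_eq_if)
  then have "((\<lambda>t. inverse t ^ m * exp (- inverse t)) has_real_derivative
     - real m * flat (m + 1) t + flat (m + 2) t) (at t)"
    using greater by (simp add: flat_def)
  then show ?thesis
    by (rule DERIV_cong_ev[THEN iffD1, OF refl _ refl, rotated])
      (use eventually_nhds_in_open[of "{0<..}" t] greater in \<open>auto simp: flat_def elim!: eventually_mono\<close>)
next
  case equal
  \<comment> \<open>For positive \<open>h\<close> the difference quotient is
    \<open>flat (m + 1) h\<close>, for negative \<open>h\<close> it is 0.\<close>
  have "((\<lambda>h. (flat m (0 + h) - flat m 0) / h) \<longlongrightarrow> 0) (at 0)"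
  proof (rule filterlim_split_at)
    show "((\<lambda>h. (flat m (0 + h) - flat m 0) / h) \<longlongrightarrow> 0) (at_left 0)"
      by (rule Lim_transform_eventually[OF tendsto_const])
        (auto simp: eventually_at_filter flat_def)
    show "((\<lambda>h. (flat m (0 + h) - flat m 0) / h) \<longlongrightarrow> 0) (at_right 0)"
      by (rule Lim_transform_eventually[OF flat_tendsto_0[of "m + 1"]])
        (auto simp: eventually_at_filter flat_def field_simps)
  qed
  then show ?thesis using equal by (simp add: DERIV_def flat_def)
qed

text \<open>A class closed under partial derivatives, so that smoothness becomes a matter of
  membership. The generators \<open>flat\<close> make functions vanish beyond a face of a box;
  closure under \<open>exp\<close> admits the functions \<open>1 - exp (- m Q)\<close> used
  below.\<close>

inductive bump_alg :: "(real^'n::finite \<Rightarrow> real) \<Rightarrow> bool" where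
  const: "bump_alg (\<lambda>x. c)"
| flat: "bump_alg (\<lambda>x. flat m (\<sigma> * x $ i + c))"
| add: "bump_alg f \<Longrightarrow> bump_alg g \<Longrightarrow> bump_alg (\<lambda>x. f x + g x)"
| mult: "bump_alg f \<Longrightarrow> bump_alg g \<Longrightarrow> bump_alg (\<lambda>x. f x * g x)"
| exp: "bump_alg f \<Longrightarrow> bump_alg (\<lambda>x. exp (f x))"

lemma bump_alg_has_derivative:
  "bump_alg f \<Longrightarrow> \<exists>G. (\<forall>i. bump_alg (G i)) \<and> (\<forall>x. (f has_derivative (\<lambda>h. \<Sum>i\<in>UNIV. h $ i * G i x)) (at x))"
proof (induction rule: bump_alg.induct)
  case (const c)
  show ?case by (rule exI[of _ "\<lambda>_ _. 0"]) (auto intro: bump_alg.const)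
next
  case (flat m \<sigma> i c)
  let ?g = "\<lambda>x. \<sigma> * (- real m * flat (m + 1) (\<sigma> * x $ i + c) + flat (m + 2) (\<sigma> * x $ i + c))"
  show ?case
  proof (intro exI[of _ "\<lambda>j. if j = i then ?g else (\<lambda>x. 0)"] conjI allI)
    show "bump_alg (if j = i then ?g else (\<lambda>x. 0))" for j
      by (cases "j = i", simp_all only: simp_thms if_True if_False) (intro bump_alg.intros)+
    fix x
    have "((\<lambda>x. \<sigma> * x $ i + c) has_derivative (\<lambda>h. \<sigma> * h $ i)) (at x)"
      by (auto intro!: derivative_eq_intros bounded_linear_imp_has_derivative bounded_linear_vec_nth)
    from has_derivative_compose[OF this has_derivative_flat[unfolded has_field_derivative_def]]
    have "((\<lambda>x. flat m (\<sigma> * x $ i + c)) has_derivative (\<lambda>h. h $ i * ?g x)) (at x)"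
      by (simp add: algebra_simps)
    moreover have "(\<lambda>h. \<Sum>j\<in>UNIV. h $ j * (if j = i then ?g else (\<lambda>x. 0)) x) = (\<lambda>h. h $ i * ?g x)"
      by (rule ext) (simp add: if_distrib[of "\<lambda>f. f x"] if_distrib[of "\<lambda>y. _ * y"] cong: if_cong)
    ultimately show "((\<lambda>x. flat m (\<sigma> * x $ i + c)) has_derivative
        (\<lambda>h. \<Sum>j\<in>UNIV. h $ j * (if j = i then ?g else (\<lambda>x. 0)) x)) (at x)" by simp
  qed
next
  case (add f g)
  then obtain F G where F: "\<And>i. bump_alg (F i)" "\<And>x. (f has_derivative (\<lambda>h. \<Sum>i\<in>UNIV. h $ i * F i x)) (at x)"
    and G: "\<And>i. bump_alg (G i)" "\<And>x. (g has_derivative (\<lambda>h. \<Sum>i\<in>UNIV. h $ i * G i x)) (at x)" by blast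
  show ?case
  proof (intro exI[of _ "\<lambda>i x. F i x + G i x"] conjI allI)
    show "bump_alg (\<lambda>x. F i x + G i x)" for i using F G by (intro bump_alg.intros)
    show "((\<lambda>x. f x + g x) has_derivative (\<lambda>h. \<Sum>i\<in>UNIV. h $ i * (F i x + G i x))) (at x)" for x
      using has_derivative_add[OF F(2)[of x] G(2)[of x]] by (simp add: ring_distribs sum.distrib)
  qed
next
  case (mult f g)
  then obtain F G where F: "\<And>i. bump_alg (F i)" "\<And>x. (f has_derivative (\<lambda>h. \<Sum>i\<in>UNIV. h $ i * F i x)) (at x)"
    and G: "\<And>i. bump_alg (G i)" "\<And>x. (g has_derivative (\<lambda>h. \<Sum>i\<in>UNIV. h $ i * G i x)) (at x)" by blast
  show ?case
  proof (intro exI[of _ "\<lambda>i x. f x * G i x + F i x * g x"] conjI allI)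
    show "bump_alg (\<lambda>x. f x * G i x + F i x * g x)" for i using F G mult by (intro bump_alg.intros)
    show "((\<lambda>x. f x * g x) has_derivative (\<lambda>h. \<Sum>i\<in>UNIV. h $ i * (f x * G i x + F i x * g x))) (at x)" for x
      using has_derivative_mult[OF F(2)[of x] G(2)[of x]]
      by (simp add: ring_distribs sum.distrib sum_distrib_left sum_distrib_right mult_ac)
  qed
next
  case (exp f)
  then obtain F where F: "\<And>i. bump_alg (F i)" "\<And>x. (f has_derivative (\<lambda>h. \<Sum>i\<in>UNIV. h $ i * F i x)) (at x)"
    by blast
  show ?case
  proof (intro exI[of _ "\<lambda>i x. exp (f x) * F i x"] conjI allI)
    show "bump_alg (\<lambda>x. exp (f x) * F i x)" for i using F exp by (intro bump_alg.intros)
    show "((\<lambda>x. exp (f x)) has_derivative (\<lambda>h. \<Sum>i\<in>UNIV. h $ i * (exp (f x) * F i x))) (at x)" for x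
      using has_derivative_exp[OF F(2)[of x]]
      by (simp add: sum_distrib_left sum_distrib_right mult_ac)
  qed
qed

lemma bump_alg_smooth:
  assumes "bump_alg f" shows "smooth_fun f"
proof -
  have step: "bump_alg (partial_deriv i g) \<and> (\<forall>x. g differentiable (at x))" if g: "bump_alg g" for g :: "real^'n \<Rightarrow> real" and i
  proof -
    obtain G where G: "\<And>i. bump_alg (G i)" "\<And>x. (g has_derivative (\<lambda>h. \<Sum>i\<in>UNIV. h $ i * G i x)) (at x)"
      using bump_alg_has_derivative[OF g] by blast
    have "partial_deriv i g x = G i x" for x
      by (rule partial_deriv_eqI[OF G(2)]) (simp add: axis_def if_distrib[of "\<lambda>y. y * _"] cong: if_cong)
    then have "partial_deriv i g = G i" by blast
    then show ?thesis using G unfolding differentiable_def by metis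
  qed
  have "bump_alg (foldr partial_deriv L f)" for L
    by (induction L) (auto simp: assms step)
  then show ?thesis unfolding smooth_fun_def using step by blast
qed

lemma bump_alg_prod:
  assumes "finite I" "\<And>i. i \<in> I \<Longrightarrow> bump_alg (f i)"
  shows "bump_alg (\<lambda>x. \<Prod>i\<in>I. f i x)"
  using assms by (induction I rule: finite_induct) (auto intro: bump_alg.intros)

text \<open>\<open>Q\<close> is positive exactly on the box and vanishes outside, so
  \<open>1 - exp (- m Q)\<close> takes values in [0,1], is supported in the closed box and increases
  to the indicator.\<close>

lemma test_fun_approx_box:
  fixes a b :: "real^'n::finite"
  obtains \<phi> where "\<And>m::nat. test_fun (\<phi> m)" "\<And>m x. 0 \<le> \<phi> m x" "\<And>m x. \<phi> m x \<le> 1"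
    "\<And>m x. x \<notin> box a b \<Longrightarrow> \<phi> m x = 0" "\<And>x. (\<lambda>m. \<phi> m x) \<longlonglongrightarrow> indicator (box a b) x"
proof -
  define Q where "Q x = (\<Prod>i\<in>UNIV. flat 0 (1 * x $ i + (- a $ i)) * flat 0 ((-1) * x $ i + b $ i))" for x :: "real^'n"
  define \<phi> where "\<phi> m x = 1 + (-1) * exp ((- real m) * Q x)" for m x
  have Qn: "0 \<le> Q x" for x
    unfolding Q_def by (intro prod_nonneg) (auto simp: flat_nonneg)
  have Q0: "Q x = 0" if x: "x \<notin> box a b" for x
  proof -
    obtain i where "\<not> (a $ i < x $ i \<and> x $ i < b $ i)"
      using x by (auto simp: mem_box_cart)
    then have "flat 0 (1 * x $ i + (- a $ i)) * flat 0 ((-1) * x $ i + b $ i) = 0"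
      by (auto simp: flat_def)
    then show ?thesis unfolding Q_def by (intro prod_zero) auto
  qed
  have Qp: "0 < Q x" if x: "x \<in> box a b" for x
    unfolding Q_def by (intro prod_pos) (use x in \<open>auto simp: flat_def mem_box_cart\<close>)
  have "bump_alg Q" unfolding Q_def[abs_def] by (intro bump_alg_prod bump_alg.intros) auto
  then have sm: "smooth_fun (\<phi> m)" for m unfolding \<phi>_def by (intro bump_alg_smooth bump_alg.intros)
  have z: "\<phi> m x = 0" if "x \<notin> box a b" for m x using Q0[OF that] by (simp add: \<phi>_def)
  have "closure {x. \<phi> m x \<noteq> 0} \<subseteq> cbox a b" for m
    using z box_subset_cbox[of a b] by (intro closure_minimal) (auto simp: closed_cbox)
  then have "test_fun (\<phi> m)" for m
    unfolding test_fun_def using sm compact_cbox closed_closure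
    by (metis compact_Int_closed inf.absorb_iff2)
  moreover have "0 \<le> \<phi> m x" "\<phi> m x \<le> 1" for m x using Qn[of x] by (auto simp: \<phi>_def)
  moreover have "(\<lambda>m. \<phi> m x) \<longlonglongrightarrow> indicator (box a b) x" for x
  proof (cases "x \<in> box a b")
    case True
    have "(\<lambda>m. exp (- Q x) ^ m) \<longlonglongrightarrow> 0"
      using Qp[OF True] by (intro LIMSEQ_realpow_zero) auto
    then have "(\<lambda>m. exp ((- real m) * Q x)) \<longlonglongrightarrow> 0"
      by (simp add: exp_of_nat_mult[symmetric])
    then have "(\<lambda>m. \<phi> m x) \<longlonglongrightarrow> 1 + (-1) * 0"
      unfolding \<phi>_def by (intro tendsto_intros)
    then show ?thesis using True by simp
  qed (simp add: z)
  ultimately show ?thesis using z that by blast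
qed

section \<open>Symmetry of partial derivatives and the fundamental lemma\<close>

lemma smooth_fun_partial_commute:
  fixes f :: "real^'n::finite \<Rightarrow> real"
  assumes f: "smooth_fun f"
  shows "partial_deriv i (partial_deriv j f) = partial_deriv j (partial_deriv i f)"
proof
  fix x
  let ?ei = "axis i 1 :: real^'n" and ?ej = "axis j 1 :: real^'n"
  have sm: "smooth_fun (partial_deriv k f)" for k by (simp add: f smooth_fun_partial_deriv)
  text \<open>Either order of differentiation computes the same second difference by the mean value theorem.\<close>
  have mvt: "\<exists>\<sigma> \<tau>. 0 < \<sigma> \<and> \<sigma> < h \<and> 0 < \<tau> \<and> \<tau> < h \<and>
      f (x + h *\<^sub>R axis k 1 + h *\<^sub>R axis l 1) - f (x + h *\<^sub>R axis k 1) - f (x + h *\<^sub>R axis l 1) + f x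
      = h * (h * partial_deriv l (partial_deriv k f) (x + \<sigma> *\<^sub>R axis k 1 + \<tau> *\<^sub>R axis l 1))"
    if h: "0 < h" for h k l
  proof -
    let ?p = "\<lambda>s. f ((x + h *\<^sub>R axis l 1) + s *\<^sub>R axis k 1) - f (x + s *\<^sub>R axis k 1)"
    have "\<exists>z. 0 < z \<and> z < h \<and> ?p h - ?p 0 = (h - 0) *
        (partial_deriv k f ((x + h *\<^sub>R axis l 1) + z *\<^sub>R axis k 1) - partial_deriv k f (x + z *\<^sub>R axis k 1))"
      by (intro MVT2 h DERIV_diff partial_deriv_along_line smooth_fun_differentiable f)
    then obtain \<sigma> where \<sigma>: "0 < \<sigma>" "\<sigma> < h" "?p h - ?p 0 = h *
        (partial_deriv k f ((x + h *\<^sub>R axis l 1) + \<sigma> *\<^sub>R axis k 1) - partial_deriv k f (x + \<sigma> *\<^sub>R axis k 1))"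
      by auto
    let ?q = "\<lambda>t. partial_deriv k f ((x + \<sigma> *\<^sub>R axis k 1) + t *\<^sub>R axis l 1)"
    have "\<exists>z. 0 < z \<and> z < h \<and> ?q h - ?q 0 = (h - 0) *
        partial_deriv l (partial_deriv k f) ((x + \<sigma> *\<^sub>R axis k 1) + z *\<^sub>R axis l 1)"
      by (intro MVT2 h partial_deriv_along_line smooth_fun_differentiable sm)
    then obtain \<tau> where \<tau>: "0 < \<tau>" "\<tau> < h" "?q h - ?q 0 = h *
        partial_deriv l (partial_deriv k f) ((x + \<sigma> *\<^sub>R axis k 1) + \<tau> *\<^sub>R axis l 1)" by auto
    show ?thesis
      using \<sigma> \<tau> by (intro exI[of _ \<sigma>] exI[of _ \<tau>]) (simp add: add_ac)
  qed
  let ?F = "partial_deriv i (partial_deriv j f)" and ?G = "partial_deriv j (partial_deriv i f)"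
  have "\<bar>?F x - ?G x\<bar> \<le> \<epsilon>" if e: "0 < \<epsilon>" for \<epsilon>
  proof -
    have "continuous (at x) ?F" "continuous (at x) ?G"
      using smooth_fun_differentiable[OF smooth_fun_partial_deriv[OF sm]] differentiable_imp_continuous_within by blast+
    then obtain d1 d2 where d: "0 < d1" "\<And>y. dist y x < d1 \<Longrightarrow> dist (?F y) (?F x) < \<epsilon> / 2"
       "0 < d2" "\<And>y. dist y x < d2 \<Longrightarrow> dist (?G y) (?G x) < \<epsilon> / 2"
      using e unfolding continuous_at_eps_delta by (metis half_gt_zero)
    \<comment> \<open>An intermediate point is displaced by less than \<open>h\<close> along each of
      two unit vectors, hence lies within \<open>2 * h\<close> of \<open>x\<close>, and
      \<open>2 * h\<close> is at most \<open>d1\<close> and at most \<open>d2\<close>.\<close>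
    define h where "h = min d1 d2 / 2"
    have h: "0 < h" using d by (simp add: h_def)
    have near: "dist (x + \<sigma> *\<^sub>R axis k 1 + \<tau> *\<^sub>R axis l 1) x < 2 * h"
      if "0 < \<sigma>" "\<sigma> < h" "0 < \<tau>" "\<tau> < h" for \<sigma> \<tau> and k l :: 'n
    proof -
      have "norm (\<sigma> *\<^sub>R axis k 1 + \<tau> *\<^sub>R axis l 1 :: real^'n) \<le> \<sigma> + \<tau>"
        by (rule norm_triangle_le) (use that in \<open>simp add: norm_axis_1\<close>)
      then show ?thesis using that by (simp add: dist_norm)
    qed
    obtain \<sigma> \<tau> where 1: "0 < \<sigma>" "\<sigma> < h" "0 < \<tau>" "\<tau> < h"
      "f (x + h *\<^sub>R ?ei + h *\<^sub>R ?ej) - f (x + h *\<^sub>R ?ei) - f (x + h *\<^sub>R ?ej) + f x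
      = h * (h * ?G (x + \<sigma> *\<^sub>R ?ei + \<tau> *\<^sub>R ?ej))" using mvt[OF h, of i j] by blast
    obtain \<sigma>' \<tau>' where 2: "0 < \<sigma>'" "\<sigma>' < h" "0 < \<tau>'" "\<tau>' < h"
      "f (x + h *\<^sub>R ?ej + h *\<^sub>R ?ei) - f (x + h *\<^sub>R ?ej) - f (x + h *\<^sub>R ?ei) + f x
      = h * (h * ?F (x + \<sigma>' *\<^sub>R ?ej + \<tau>' *\<^sub>R ?ei))" using mvt[OF h, of j i] by blast
    have "h * (h * ?G (x + \<sigma> *\<^sub>R ?ei + \<tau> *\<^sub>R ?ej)) = h * (h * ?F (x + \<sigma>' *\<^sub>R ?ej + \<tau>' *\<^sub>R ?ei))"
    proof -
      have "f (x + h *\<^sub>R ?ej + h *\<^sub>R ?ei) = f (x + h *\<^sub>R ?ei + h *\<^sub>R ?ej)" by (simp add: add_ac)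
      then show ?thesis using 1(5) 2(5) by linarith
    qed
    then have eq: "?G (x + \<sigma> *\<^sub>R ?ei + \<tau> *\<^sub>R ?ej) = ?F (x + \<sigma>' *\<^sub>R ?ej + \<tau>' *\<^sub>R ?ei)" using h by simp
    have "dist (?G (x + \<sigma> *\<^sub>R ?ei + \<tau> *\<^sub>R ?ej)) (?G x) < \<epsilon> / 2"
      using near[OF 1(1-4), of i j] d by (simp add: h_def)
    moreover have "dist (?F (x + \<sigma>' *\<^sub>R ?ej + \<tau>' *\<^sub>R ?ei)) (?F x) < \<epsilon> / 2"
      using near[OF 2(1-4), of j i] d by (simp add: h_def)
    ultimately show ?thesis unfolding eq dist_real_def by linarith
  qed
  then have "\<bar>?F x - ?G x\<bar> \<le> 0" by (rule field_le_epsilon[of _ 0, simplified])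
  then show "?F x = ?G x" by simp
qed

section \<open>Multi-indices and the order of differentiation\<close>

lemma smooth_fun_funpow: "smooth_fun f \<Longrightarrow> smooth_fun ((partial_deriv i ^^ m) f)"
  by (induction m) (auto simp: smooth_fun_partial_deriv)

lemma funpow_partial_deriv_commute:
  "smooth_fun f \<Longrightarrow> (partial_deriv i ^^ m) (partial_deriv j f) = partial_deriv j ((partial_deriv i ^^ m) f)"
  by (induction m) (simp_all add: smooth_fun_partial_commute smooth_fun_funpow)

definition coord_enum :: "'n::finite list" where
  "coord_enum = (SOME xs. distinct xs \<and> set xs = UNIV)"

lemma coord_enum: "distinct (coord_enum :: 'n::finite list)" "set (coord_enum :: 'n list) = UNIV"
proof -
  have "\<exists>xs :: 'n list. distinct xs \<and> set xs = UNIV"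
    using finite_distinct_list[of "UNIV :: 'n set"] by auto
  from someI_ex[OF this] show "distinct (coord_enum :: 'n::finite list)" "set (coord_enum :: 'n list) = UNIV"
    by (auto simp: coord_enum_def)
qed

lemma multi_partial_eq: "multi_partial s f = foldr (\<lambda>i. partial_deriv i ^^ s i) coord_enum f"
  by (simp add: multi_partial_def coord_enum_def)

text \<open>The additional derivative is applied innermost. By symmetry it travels outward through
  the fixed enumeration until it meets the block of \<open>j\<close>, whose exponent it raises by
  one.\<close>

lemma multi_partial_partial_deriv:
  assumes f: "smooth_fun f"
  shows "multi_partial s (partial_deriv j f) = multi_partial (s(j := Suc (s j))) f"
proof -
  have sm: "smooth_fun (foldr (\<lambda>i. partial_deriv i ^^ s i) ys f)" for ys
    by (induction ys) (auto simp: f smooth_fun_funpow)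
  have out: "foldr (\<lambda>i. partial_deriv i ^^ s i) ys (partial_deriv j f) = partial_deriv j (foldr (\<lambda>i. partial_deriv i ^^ s i) ys f)" for ys
    by (induction ys) (auto simp: funpow_partial_deriv_commute sm)
  have same: "j \<notin> set ys \<Longrightarrow> foldr (\<lambda>i. partial_deriv i ^^ (s(j := Suc (s j))) i) ys f = foldr (\<lambda>i. partial_deriv i ^^ s i) ys f" for ys
    by (induction ys) auto
  have "distinct ys \<Longrightarrow> j \<in> set ys \<Longrightarrow>
    foldr (\<lambda>i. partial_deriv i ^^ s i) ys (partial_deriv j f) = foldr (\<lambda>i. partial_deriv i ^^ (s(j := Suc (s j))) i) ys f" for ys
  proof (induction ys)
    case (Cons y ys)
    show ?case
    proof (cases "y = j")
      case True
      then have "foldr (\<lambda>i. partial_deriv i ^^ (s(j := Suc (s j))) i) (y # ys) f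
        = (partial_deriv j ^^ Suc (s j)) (foldr (\<lambda>i. partial_deriv i ^^ s i) ys f)"
        using same[of ys] Cons.prems by (simp del: funpow.simps fun_upd_apply add: fun_upd_same)
      also have "\<dots> = (partial_deriv j ^^ s j) (partial_deriv j (foldr (\<lambda>i. partial_deriv i ^^ s i) ys f))"
        by (simp add: funpow_swap1)
      also have "\<dots> = foldr (\<lambda>i. partial_deriv i ^^ s i) (y # ys) (partial_deriv j f)"
        using True by (simp add: out)
      finally show ?thesis by simp
    qed (use Cons in auto)
  qed simp
  from this[OF coord_enum(1)] show ?thesis by (simp add: multi_partial_eq coord_enum(2))
qed

text \<open>A multi-index is spelled out as a list of single coordinates, the form in which
  integration by parts is iterated one coordinate at a time.\<close>

lemma multi_partial_as_foldr:
  fixes s :: "'a::finite \<Rightarrow> nat"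
  obtains L where "length L = mi_order s" "\<And>f. multi_partial s f = foldr partial_deriv L f"
proof -
  define L where "L ys = concat (map (\<lambda>i. replicate (s i) i) ys)" for ys
  have fp: "foldr partial_deriv (replicate m i) f = (partial_deriv i ^^ m) f" for m i f
    by (induction m) auto
  have "foldr (\<lambda>i. partial_deriv i ^^ s i) ys f = foldr partial_deriv (L ys) f" for ys f
    by (induction ys) (auto simp: L_def fp)
  then have "\<And>f. multi_partial s f = foldr partial_deriv (L coord_enum) f"
    by (simp add: multi_partial_eq)
  moreover have "length (L coord_enum) = mi_order s"
    using coord_enum[where 'n = 'a]
    by (simp add: L_def length_concat o_def mi_order_def sum_list_distinct_conv_sum_set)
  ultimately show ?thesis using that by blast
qed

text \<open>Borel functions and the uncompleted Lebesgue measure are used throughout, since Fubini's theorem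
  needs joint measurability of \<open>(x, s) \<mapsto> v (x + s *\<^sub>R e)\<close>.\<close>

definition borel_locint :: "('a::euclidean_space \<Rightarrow> real) \<Rightarrow> bool" where
  "borel_locint f \<longleftrightarrow> f \<in> borel_measurable borel \<and> (\<forall>K. compact K \<longrightarrow> set_integrable lborel K f)"

lemma borel_locintI:
  assumes "f \<in> borel_measurable borel" "\<And>R. set_integrable lborel (cball 0 R) f"
  shows "borel_locint f"
  unfolding borel_locint_def
proof (intro conjI allI impI assms(1))
  fix K :: "'a set" assume K: "compact K"
  then obtain R where "K \<subseteq> cball 0 R"
    by (meson ball_subset_cball bounded_subset_ballD compact_imp_bounded order_trans)
  moreover have "K \<in> sets lborel" using K by (simp add: compact_imp_closed)
  ultimately show "set_integrable lborel K f" using assms(2)[of R] set_integrable_subset by blast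
qed

lemma borel_locint_mult_integrable:
  assumes f: "borel_locint f" and g: "g \<in> borel_measurable borel" and B: "\<And>x. \<bar>g x\<bar> \<le> B"
    and K: "compact K" "\<And>x. x \<notin> K \<Longrightarrow> g x = 0"
  shows "integrable lborel (\<lambda>x. f x * g x)"
proof (rule Bochner_Integration.integrable_bound)
  show "integrable lborel (\<lambda>x. B * (indicator K x *\<^sub>R f x))"
    using f K unfolding borel_locint_def set_integrable_def by (intro integrable_mult_right) blast
  show "(\<lambda>x. f x * g x) \<in> borel_measurable lborel"
    using f g by (auto simp: borel_locint_def)
  have "0 \<le> B" using B[of 0] by linarith
  have "\<bar>f x * g x\<bar> \<le> \<bar>B * (indicator K x *\<^sub>R f x)\<bar>" for x
    using B[of x] K(2)[of x] \<open>0 \<le> B\<close> by (cases "x \<in> K") (auto simp: abs_mult mult.commute[of "\<bar>f x\<bar>"] intro: mult_right_mono)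
  then show "AE x in lborel. norm (f x * g x) \<le> norm (B * (indicator K x *\<^sub>R f x))" by simp
qed

lemma borel_locint_add: "borel_locint f \<Longrightarrow> borel_locint g \<Longrightarrow> borel_locint (\<lambda>x. f x + g x)"
  unfolding borel_locint_def by (auto intro: set_integral_add)

lemma borel_locint_diff: "borel_locint f \<Longrightarrow> borel_locint g \<Longrightarrow> borel_locint (\<lambda>x. f x - g x)"
  unfolding borel_locint_def by (auto intro: set_integral_diff)

lemma borel_locint_test_fun:
  assumes "borel_locint f" "test_fun \<phi>"
  shows "integrable lborel (\<lambda>x. f x * \<phi> x)"
proof -
  obtain B where B: "\<And>x. \<bar>\<phi> x\<bar> \<le> B" using test_fun_bounded[OF assms(2)] by blast
  show ?thesis
  proof (rule borel_locint_mult_integrable[OF assms(1) test_fun_borel[OF assms(2)] B])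
    show "compact (closure {x. \<phi> x \<noteq> 0})" using assms(2) by (simp add: test_fun_def)
  qed (use closure_subset[of "{x. \<phi> x \<noteq> 0}"] in auto)
qed

text \<open>The positive and the negative part of \<open>f\<close> are densities of two measures
  that agree on open boxes. Boxes form an intersection-stable generator, so the measures and hence
  the densities agree, and \<open>max y 0 = max (- y) 0\<close> forces \<open>y = 0\<close>.\<close>

lemma AE_zero_if_box_integrals_zero:
  fixes f :: "'a::euclidean_space \<Rightarrow> real"
  assumes f: "borel_locint f" and z: "\<And>a b. (LINT x:box a b|lborel. f x) = 0"
  shows "AE x in lborel. f x = 0"
proof -
  have [measurable]: "f \<in> borel_measurable borel" using f by (simp add: borel_locint_def)
  have int: "set_integrable lborel (box a b) f" for a b
    by (rule set_integrable_subset[of lborel "cbox a b"])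
      (use f box_subset_cbox[of a b] in \<open>auto simp: borel_locint_def\<close>)
  have pos: "set_integrable lborel (box a b) (\<lambda>x. max (f x) 0)" and
    neg: "set_integrable lborel (box a b) (\<lambda>x. max (- f x) 0)" for a b
    by (rule set_integrable_bound[OF int]; auto simp: set_borel_measurable_def)+
  have em: "emeasure (density lborel (\<lambda>x. ennreal (max (g x) 0))) (box a b) = ennreal (LINT x:box a b|lborel. max (g x) 0)"
    if [measurable]: "g \<in> borel_measurable borel" and i: "set_integrable lborel (box a b) (\<lambda>x. max (g x) 0)"
    for g :: "'a \<Rightarrow> real" and a b
  proof -
    have "emeasure (density lborel (\<lambda>x. ennreal (max (g x) 0))) (box a b)
      = (\<integral>\<^sup>+x. ennreal (max (g x) 0) * indicator (box a b) x \<partial>lborel)"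
      by (subst emeasure_density) auto
    also have "\<dots> = (\<integral>\<^sup>+x. ennreal (indicator (box a b) x *\<^sub>R max (g x) 0) \<partial>lborel)"
      by (intro nn_integral_cong) (simp add: indicator_def)
    also have "\<dots> = ennreal (LINT x:box a b|lborel. max (g x) 0)"
      unfolding set_lebesgue_integral_def using i unfolding set_integrable_def
      by (intro nn_integral_eq_integral) auto
    finally show ?thesis .
  qed
  have eq: "(LINT x:box a b|lborel. max (f x) 0) = (LINT x:box a b|lborel. max (- f x) 0)" for a b
  proof -
    have "(LINT x:box a b|lborel. max (f x) 0) - (LINT x:box a b|lborel. max (- f x) 0)
      = (LINT x:box a b|lborel. max (f x) 0 - max (- f x) 0)"
      by (rule set_integral_diff(2)[OF pos neg, symmetric])
    also have "\<dots> = (LINT x:box a b|lborel. f x)"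
      by (rule arg_cong[of _ _ "\<lambda>g. set_lebesgue_integral lborel (box a b) g"]) (auto simp: max_def)
    finally show ?thesis using z by simp
  qed
  have "density lborel (\<lambda>x. ennreal (max (f x) 0)) = density lborel (\<lambda>x. ennreal (max (- f x) 0))" (is "?M = ?N")
  proof (rule measure_eqI_generator_eq)
    show "Int_stable (range (\<lambda>(a, b). box a b :: 'a set))"
      by (auto simp: Int_stable_def box_Int_box)
    show "range (\<lambda>(a, b). box a b) \<subseteq> Pow UNIV" by simp
    show "emeasure ?M X = emeasure ?N X" if X: "X \<in> range (\<lambda>(a, b). box a b)" for X
      using X em[OF _ pos] em[OF _ neg] eq by auto
    show "sets ?M = sigma_sets UNIV (range (\<lambda>(a, b). box a b))" "sets ?N = sigma_sets UNIV (range (\<lambda>(a, b). box a b))"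
      by (simp_all add: borel_eq_box)
    let ?A = "\<lambda>n::nat. box (- (real n *\<^sub>R One)) (real n *\<^sub>R One) :: 'a set"
    show "range ?A \<subseteq> range (\<lambda>(a, b). box a b)" by auto
    show "(\<Union>i. ?A i) = UNIV" by (rule UN_box_eq_UNIV)
    show "emeasure ?M (?A i) \<noteq> \<infinity>" for i using em[OF _ pos] by simp
  qed
  then have "AE x in lborel. ennreal (max (f x) 0) = ennreal (max (- f x) 0)"
    by (intro sigma_finite_measure.density_unique[OF sigma_finite_lborel]) auto
  then show ?thesis
    by eventually_elim (auto simp: max_def split: if_splits)
qed

text \<open>Dominated convergence replaces test functions by the indicator of an open box; the
  majorant is the absolute value of \<open>f\<close> cut off to the closed box.\<close>

lemma AE_zero_if_test_integrals_zero:
  fixes f :: "real^'n::finite \<Rightarrow> real"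
  assumes f: "borel_locint f" and z: "\<And>\<phi>. test_fun \<phi> \<Longrightarrow> (\<integral>x. f x * \<phi> x \<partial>lborel) = 0"
  shows "AE x in lborel. f x = 0"
proof (rule AE_zero_if_box_integrals_zero[OF f])
  fix a b :: "real^'n"
  have [measurable]: "f \<in> borel_measurable borel" using f by (simp add: borel_locint_def)
  obtain \<phi> :: "nat \<Rightarrow> real^'n \<Rightarrow> real" where \<phi>: "\<And>m::nat. test_fun (\<phi> m)" "\<And>m x. 0 \<le> \<phi> m x" "\<And>m x. \<phi> m x \<le> 1"
    "\<And>m x. x \<notin> box a b \<Longrightarrow> \<phi> m x = 0" "\<And>x. (\<lambda>m. \<phi> m x) \<longlonglongrightarrow> indicator (box a b) x"
    using test_fun_approx_box by blast
  have [measurable]: "\<phi> m \<in> borel_measurable borel" for m using \<phi>(1) test_fun_borel by blast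
  have "(\<lambda>m. \<integral>x. f x * \<phi> m x \<partial>lborel) \<longlonglongrightarrow> (\<integral>x. f x * indicator (box a b) x \<partial>lborel)"
  proof (rule integral_dominated_convergence)
    show "integrable lborel (\<lambda>x. \<bar>indicator (cbox a b) x *\<^sub>R f x\<bar>)"
      using f by (intro integrable_abs) (auto simp: borel_locint_def set_integrable_def)
    show "AE x in lborel. (\<lambda>m. f x * \<phi> m x) \<longlonglongrightarrow> f x * indicator (box a b) x"
      by (intro AE_I2 tendsto_intros \<phi>)
    have "\<bar>f x * \<phi> m x\<bar> \<le> \<bar>indicator (cbox a b) x *\<^sub>R f x\<bar>" for m x
      using \<phi>(2,3)[of m x] \<phi>(4)[of x m] subsetD[OF box_subset_cbox[of a b], of x]
      by (cases "x \<in> box a b") (auto simp: abs_mult intro: mult_left_le)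
    then show "AE x in lborel. norm (f x * \<phi> m x) \<le> \<bar>indicator (cbox a b) x *\<^sub>R f x\<bar>" for m by simp
  qed auto
  then show "(LINT x:box a b|lborel. f x) = 0"
    using z[OF \<phi>(1)] by (simp add: LIMSEQ_const_iff set_lebesgue_integral_def mult.commute)
qed


section \<open>The chain rule for absolutely continuous functions of one variable\<close>

lemma absolutely_integrable_continuous_mult:
  fixes f g :: "real \<Rightarrow> real"
  assumes "continuous_on {a..b} g" "f absolutely_integrable_on {a..b}"
  shows "(\<lambda>x. g x * f x) absolutely_integrable_on {a..b}"
  by (rule absolutely_integrable_bounded_measurable_product_real)
    (use assms in \<open>auto intro!: continuous_imp_measurable_on_sets_lebesgue compact_imp_bounded compact_continuous_image\<close>)

text \<open>The error of the fundamental theorem is additive over adjacent intervals and, by the mean value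
  theorem, locally at most \<open>\<epsilon>\<close> times the integral of \<open>\<bar>f\<^sub>1\<bar> + \<bar>f\<^sub>2\<bar>\<close>.\<close>

lemma absolutely_continuous_chain_rule:
  fixes f1 f2 :: "real \<Rightarrow> real" and \<Phi> D1 D2 :: "real \<times> real \<Rightarrow> real"
  assumes h: "0 \<le> h"
    and f1: "f1 absolutely_integrable_on {0..h}" and f2: "f2 absolutely_integrable_on {0..h}"
    and \<Phi>: "\<And>z. (\<Phi> has_derivative (\<lambda>k. fst k * D1 z + snd k * D2 z)) (at z)"
    and D1: "continuous_on UNIV D1" and D2: "continuous_on UNIV D2"
    and U: "\<And>s. U s = (c1 + integral {0..s} f1, c2 + integral {0..s} f2)"
  shows "(\<lambda>s. D1 (U s) * f1 s + D2 (U s) * f2 s) absolutely_integrable_on {0..h}" (is "?D absolutely_integrable_on _")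
    and "\<Phi> (U h) - \<Phi> (U 0) = integral {0..h} (\<lambda>s. D1 (U s) * f1 s + D2 (U s) * f2 s)"
proof -
  have f1i: "f1 integrable_on {0..h}" and f2i: "f2 integrable_on {0..h}"
    using f1 f2 by (auto simp: absolutely_integrable_on_def)
  have cU: "continuous_on {0..h} U"
    unfolding U[abs_def] by (intro continuous_intros indefinite_integral_continuous_1 f1i f2i)
  have cD: "continuous_on {0..h} (\<lambda>s. D1 (U s))" "continuous_on {0..h} (\<lambda>s. D2 (U s))"
    by (intro continuous_on_compose2[OF D1 cU] continuous_on_compose2[OF D2 cU] subset_UNIV)+
  show Dabs: "?D absolutely_integrable_on {0..h}"
    by (intro set_integral_add(1) absolutely_integrable_continuous_mult cD f1 f2)
  define A where "A s = \<bar>f1 s\<bar> + \<bar>f2 s\<bar>" for s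
  have Aabs: "A absolutely_integrable_on {0..h}"
    unfolding A_def using f1 f2
    by (intro set_integral_add(1) set_integrable_abs)
  have sub: "g integrable_on {a..b}" if "g absolutely_integrable_on {0..h}" "0 \<le> a" "b \<le> h" for g :: "real \<Rightarrow> real" and a b
    using that by (meson absolutely_integrable_on_def atLeastatMost_subset_iff integrable_on_subinterval)
  have comb: "integral {a..c} g = integral {a..b} g + integral {b..c} g"
    if "g absolutely_integrable_on {0..h}" "0 \<le> a" "a \<le> b" "b \<le> c" "c \<le> h" for g :: "real \<Rightarrow> real" and a b c
    using Henstock_Kurzweil_Integration.integral_combine[of a b c g] sub[of g a c] that by simp
  define E where "E a b = \<Phi> (U b) - \<Phi> (U a) - integral {a..b} ?D" for a b
  have small: "\<bar>E 0 h\<bar> \<le> e * integral {0..h} A" if e: "0 < e" for e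
  proof -
    \<comment> \<open>The bounds \<open>0 \<le> a\<close> and \<open>b \<le> h\<close> are premises
      inside \<open>P\<close>, since the bisection principle \<open>Bolzano\<close> asks for
      \<open>P\<close> on all short intervals around a point, including those that leave
      \<open>{0..h}\<close>.\<close>
    define P where "P a b \<longleftrightarrow> (0 \<le> a \<and> a \<le> b \<and> b \<le> h \<longrightarrow> \<bar>E a b\<bar> \<le> e * integral {a..b} A)" for a b
    have "P 0 h" using h
    proof (induction rule: Bolzano)
      case (trans a b c)
      show ?case unfolding P_def
      proof
        assume b: "0 \<le> a \<and> a \<le> c \<and> c \<le> h"
        have "E a c = E a b + E b c"
          using comb[OF Dabs, of a b c] b trans by (simp add: E_def)
        moreover have "integral {a..c} A = integral {a..b} A + integral {b..c} A"
          using comb[OF Aabs, of a b c] b trans by simp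
        ultimately show "\<bar>E a c\<bar> \<le> e * integral {a..c} A"
          using trans b by (auto simp: P_def ring_distribs)
      qed
    next
      case (local x)
      \<comment> \<open>Half of \<open>e\<close>, because the partials are later compared at two
        points of this ball, \<open>V \<tau>\<close> and \<open>U s\<close>.\<close>
      have "\<exists>d>0. \<forall>z. dist z (U x) < d \<longrightarrow> \<bar>D1 z - D1 (U x)\<bar> < e / 2 \<and> \<bar>D2 z - D2 (U x)\<bar> < e / 2"
      proof -
        have "isCont D1 (U x)" "isCont D2 (U x)"
          using D1 D2 continuous_on_eq_continuous_at[OF open_UNIV] by blast+
        then obtain d1 d2 where "0 < d1" "\<And>z. dist z (U x) < d1 \<Longrightarrow> dist (D1 z) (D1 (U x)) < e / 2"
          "0 < d2" "\<And>z. dist z (U x) < d2 \<Longrightarrow> dist (D2 z) (D2 (U x)) < e / 2"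
          using e unfolding continuous_at_eps_delta by (metis half_gt_zero)
        then show ?thesis by (intro exI[of _ "min d1 d2"]) (auto simp: dist_real_def)
      qed
      then obtain d where d: "0 < d" "\<And>z. dist z (U x) < d \<Longrightarrow> \<bar>D1 z - D1 (U x)\<bar> < e / 2 \<and> \<bar>D2 z - D2 (U x)\<bar> < e / 2"
        by blast
      have "\<exists>\<delta>>0. \<forall>y\<in>{0..h}. dist y x < \<delta> \<longrightarrow> dist (U y) (U x) < d"
        using cU local d(1) unfolding continuous_on_iff by (meson atLeastAtMost_iff)
      then obtain \<delta> where \<delta>: "0 < \<delta>" "\<And>y. y \<in> {0..h} \<Longrightarrow> dist y x < \<delta> \<Longrightarrow> dist (U y) (U x) < d"
        by blast
      have "P a b" if ab: "a \<le> x" "x \<le> b" "b - a < \<delta>" for a b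
        unfolding P_def
      proof (intro impI, elim conjE)
        assume ab0: "0 \<le> a" "a \<le> b" "b \<le> h"
        have near: "U y \<in> ball (U x) d" if "y \<in> {a..b}" for y
          using \<delta>(2)[of y] that ab ab0 by (auto simp: dist_commute dist_real_def)
        \<comment> \<open>The mean value theorem on the chord from \<open>U a\<close> to
          \<open>U b\<close> evaluates both partials at a single point. As constants they pass under
          the integrals of \<open>f1\<close> and \<open>f2\<close> that make up
          \<open>U b - U a\<close>, so the error becomes one integral.\<close>
        define V where "V \<tau> = U a + \<tau> *\<^sub>R (U b - U a)" for \<tau>
        have Vder: "((\<lambda>\<tau>. \<Phi> (V \<tau>)) has_real_derivative
            fst (U b - U a) * D1 (V \<tau>) + snd (U b - U a) * D2 (V \<tau>)) (at \<tau>)" for \<tau>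
        proof -
          have "(V has_derivative (\<lambda>t. t *\<^sub>R (U b - U a))) (at \<tau>)"
            unfolding V_def by (auto intro!: derivative_eq_intros)
          then have "((\<lambda>\<tau>. \<Phi> (V \<tau>)) has_derivative
              (\<lambda>t. fst (t *\<^sub>R (U b - U a)) * D1 (V \<tau>) + snd (t *\<^sub>R (U b - U a)) * D2 (V \<tau>))) (at \<tau>)"
            by (rule has_derivative_compose[OF _ \<Phi>])
          then show ?thesis
            unfolding has_field_derivative_def
            by (rule has_derivative_eq_rhs) (simp add: fun_eq_iff algebra_simps)
        qed
        obtain \<tau> where \<tau>: "0 < \<tau>" "\<tau> < 1"
          "\<Phi> (V 1) - \<Phi> (V 0) = (1 - 0) * (fst (U b - U a) * D1 (V \<tau>) + snd (U b - U a) * D2 (V \<tau>))"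
          using MVT2[of 0 1 "\<lambda>\<tau>. \<Phi> (V \<tau>)", OF _ Vder] by auto
        have "V \<tau> \<in> closed_segment (U a) (U b)"
          unfolding in_segment using \<tau> by (intro exI[of _ \<tau>]) (auto simp: V_def algebra_simps)
        moreover have "closed_segment (U a) (U b) \<subseteq> ball (U x) d"
          using near[of a] near[of b] ab0 by (intro closed_segment_subset) auto
        ultimately have V: "dist (V \<tau>) (U x) < d" by (auto simp: dist_commute)
        have fstU: "fst (U b - U a) = integral {a..b} f1" and sndU: "snd (U b - U a) = integral {a..b} f2"
          using comb[OF f1, of 0 a b] comb[OF f2, of 0 a b] ab0 by (auto simp: U)
        have i1: "(\<lambda>s. c * f1 s) integrable_on {a..b}" and i2: "(\<lambda>s. c * f2 s) integrable_on {a..b}" for c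
          using integrable_on_cmult_left[OF sub[OF f1 ab0(1,3)], of c]
            integrable_on_cmult_left[OF sub[OF f2 ab0(1,3)], of c] by auto
        have "\<Phi> (U b) - \<Phi> (U a) = integral {a..b} (\<lambda>s. D1 (V \<tau>) * f1 s + D2 (V \<tau>) * f2 s)"
        proof -
          have "integral {a..b} (\<lambda>s. D1 (V \<tau>) * f1 s + D2 (V \<tau>) * f2 s)
            = D1 (V \<tau>) * integral {a..b} f1 + D2 (V \<tau>) * integral {a..b} f2"
            by (subst Henstock_Kurzweil_Integration.integral_add[OF i1 i2]) auto
          then show ?thesis using \<tau>(3) unfolding fstU sndU by (simp add: V_def mult.commute)
        qed
        then have "E a b = integral {a..b} (\<lambda>s. (D1 (V \<tau>) * f1 s + D2 (V \<tau>) * f2 s) - ?D s)"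
          unfolding E_def
          by (subst Henstock_Kurzweil_Integration.integral_diff[OF integrable_add[OF i1 i2] sub[OF Dabs ab0(1,3)]]) auto
        also have "norm \<dots> \<le> integral {a..b} (\<lambda>s. e * A s)"
        proof (rule integral_norm_bound_integral)
          show "(\<lambda>s. (D1 (V \<tau>) * f1 s + D2 (V \<tau>) * f2 s) - ?D s) integrable_on {a..b}"
            by (intro integrable_diff integrable_add i1 i2 sub[OF Dabs ab0(1,3)])
          show "(\<lambda>s. e * A s) integrable_on {a..b}"
            using integrable_on_cmult_left[OF sub[OF Aabs ab0(1,3)], of e] by simp
          fix s assume s: "s \<in> {a..b}"
          have "\<bar>D1 (V \<tau>) - D1 (U s)\<bar> \<le> e" "\<bar>D2 (V \<tau>) - D2 (U s)\<bar> \<le> e"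
          proof -
            have "dist (U s) (U x) < d" using near[OF s] by (simp add: dist_commute)
            from d(2)[OF this] d(2)[OF V] show "\<bar>D1 (V \<tau>) - D1 (U s)\<bar> \<le> e" "\<bar>D2 (V \<tau>) - D2 (U s)\<bar> \<le> e"
              by linarith+
          qed
          then have "\<bar>(D1 (V \<tau>) - D1 (U s)) * f1 s\<bar> + \<bar>(D2 (V \<tau>) - D2 (U s)) * f2 s\<bar> \<le> e * \<bar>f1 s\<bar> + e * \<bar>f2 s\<bar>"
            unfolding abs_mult by (intro add_mono mult_right_mono) auto
          then show "norm (D1 (V \<tau>) * f1 s + D2 (V \<tau>) * f2 s - ?D s) \<le> e * A s"
            by (simp add: A_def algebra_simps)
        qed
        finally show "\<bar>E a b\<bar> \<le> e * integral {a..b} A" by simp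
      qed
      then show ?case using \<delta>(1) by blast
    qed
    then show ?thesis using h by (simp add: P_def)
  qed
  have A0: "0 \<le> integral {0..h} A"
    by (intro integral_nonneg sub[OF Aabs]) (auto simp: A_def)
  have "\<bar>E 0 h\<bar> \<le> e" if e: "0 < e" for e
  proof -
    have "\<bar>E 0 h\<bar> \<le> e / (integral {0..h} A + 1) * integral {0..h} A"
      using e A0 by (intro small) auto
    also have "\<dots> \<le> e" using e A0 by (simp add: field_simps)
    finally show ?thesis .
  qed
  then have "\<bar>E 0 h\<bar> \<le> 0" by (rule field_le_epsilon[of _ 0, simplified])
  then show "\<Phi> (U h) - \<Phi> (U 0) = integral {0..h} ?D" by (simp add: E_def)
qed

section \<open>Increments along lines\<close>

lemma
  fixes f :: "'a::euclidean_space \<Rightarrow> real"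
  assumes [measurable]: "f \<in> borel_measurable borel"
  shows lborel_integrable_translate: "integrable lborel (\<lambda>x. f (x + c)) \<longleftrightarrow> integrable lborel f"
    and lborel_integral_translate: "(\<integral>x. f (x + c) \<partial>lborel) = (\<integral>x. f x \<partial>lborel)"
proof -
  show "integrable lborel (\<lambda>x. f (x + c)) \<longleftrightarrow> integrable lborel f"
    by (subst (2) lborel_distr_plus[of c, symmetric]) (simp add: integrable_distr_eq add.commute)
  show "(\<integral>x. f (x + c) \<partial>lborel) = (\<integral>x. f x \<partial>lborel)"
    by (subst (2) lborel_distr_plus[of c, symmetric]) (simp add: integral_distr add.commute)
qed

text \<open>The bound \<open>B\<close>, uniform in \<open>s\<close>, makes \<open>w\<close> jointly
  integrable on the slab over \<open>{0..h}\<close>; after that everything is Fubini's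
  theorem.\<close>

lemma slab_Fubini:
  fixes w :: "real \<Rightarrow> 'a::euclidean_space \<Rightarrow> real"
  assumes [measurable]: "(\<lambda>(s, x). w s x) \<in> borel_measurable (borel \<Otimes>\<^sub>M borel)"
    and int: "\<And>s. s \<in> {0..h} \<Longrightarrow> integrable lborel (w s)"
    and bd: "\<And>s. s \<in> {0..h} \<Longrightarrow> (\<integral>x. \<bar>w s x\<bar> \<partial>lborel) \<le> B"
  shows "(\<integral>x. (LINT s:{0..h}|lborel. w s x) \<partial>lborel) = (LINT s:{0..h}|lborel. (\<integral>x. w s x \<partial>lborel))"
    and "AE x in lborel. set_integrable lborel {0..h} (\<lambda>s. w s x)"
    and "integrable lborel (\<lambda>x. LINT s:{0..h}|lborel. w s x)"
proof -
  have P: "pair_sigma_finite (lborel :: real measure) (lborel :: 'a measure)" ..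
  let ?f = "\<lambda>(s, x). indicator {0..h} s *\<^sub>R w s x"
  have m[measurable]: "?f \<in> borel_measurable (lborel \<Otimes>\<^sub>M lborel)" by measurable
  have f: "integrable (lborel \<Otimes>\<^sub>M lborel) ?f"
  proof (rule pair_sigma_finite.Fubini_integrable[OF P m])
    show "integrable lborel (\<lambda>s. \<integral>x. norm (?f (s, x)) \<partial>lborel)"
    proof (rule Bochner_Integration.integrable_bound)
      show "integrable lborel (\<lambda>s. indicator {0..h} s *\<^sub>R B)"
        using borel_integrable_atLeastAtMost'[OF continuous_on_const[of "{0..h}" B]]
        unfolding set_integrable_def .
      show "(\<lambda>s. \<integral>x. norm (?f (s, x)) \<partial>lborel) \<in> borel_measurable lborel" by measurable
      have "norm (\<integral>x. norm (?f (s, x)) \<partial>lborel) \<le> norm (indicator {0..h} s *\<^sub>R B)" for s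
      proof (cases "s \<in> {0..h}")
        case True
        then have "(\<integral>x. norm (?f (s, x)) \<partial>lborel) \<le> \<bar>B\<bar>" using bd[of s] by simp
        then show ?thesis using True by (simp add: integral_nonneg_AE)
      qed simp
      then show "AE s in lborel. norm (\<integral>x. norm (?f (s, x)) \<partial>lborel) \<le> norm (indicator {0..h} s *\<^sub>R B)"
        by simp
    qed
    have "integrable lborel (\<lambda>x. ?f (s, x))" for s
      using int[of s] by (cases "s \<in> {0..h}") auto
    then show "AE s in lborel. integrable lborel (\<lambda>x. ?f (s, x))" by simp
  qed
  then have f': "integrable (lborel \<Otimes>\<^sub>M lborel) (case_prod (\<lambda>s x. indicator {0..h} s *\<^sub>R w s x))" .
  have "(\<integral>x. (\<integral>s. indicator {0..h} s *\<^sub>R w s x \<partial>lborel) \<partial>lborel)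
     = (\<integral>s. (\<integral>x. indicator {0..h} s *\<^sub>R w s x \<partial>lborel) \<partial>lborel)"
    by (rule pair_sigma_finite.Fubini_integral[OF P f'])
  then show "(\<integral>x. (LINT s:{0..h}|lborel. w s x) \<partial>lborel) = (LINT s:{0..h}|lborel. (\<integral>x. w s x \<partial>lborel))"
    by (simp add: set_lebesgue_integral_def)
  show "AE x in lborel. set_integrable lborel {0..h} (\<lambda>s. w s x)"
    unfolding set_integrable_def by (rule pair_sigma_finite.AE_integrable_snd[OF P f'])
  show "integrable lborel (\<lambda>x. LINT s:{0..h}|lborel. w s x)"
    unfolding set_lebesgue_integral_def by (rule pair_sigma_finite.integrable_snd[OF P f'])
qed

text \<open>All shifts of \<open>g\<close> by \<open>s *\<^sub>R e\<close> with \<open>s\<close> in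
  \<open>{0..h}\<close> vanish outside the ball of radius \<open>R + h * norm e\<close>, so one
  majorant serves for all of them.\<close>

lemma locint_shift_bound:
  fixes v g :: "'a::euclidean_space \<Rightarrow> real"
  assumes v: "borel_locint v" and g[measurable]: "g \<in> borel_measurable borel"
    and B: "\<And>x. \<bar>g x\<bar> \<le> B" and R: "\<And>x. norm x > R \<Longrightarrow> g x = 0"
  obtains G where "integrable lborel G" "\<And>s x. s \<in> {0..h} \<Longrightarrow> \<bar>v x * g (x - s *\<^sub>R e)\<bar> \<le> G x"
proof
  have B0: "0 \<le> B" using B[of 0] by linarith
  let ?K = "cball 0 (R + h * norm e)"
  let ?G = "\<lambda>x. B * \<bar>indicator ?K x *\<^sub>R v x\<bar>"
  show "integrable lborel ?G"
    using v unfolding borel_locint_def set_integrable_def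
    by (intro integrable_mult_right integrable_abs) auto
  show "\<bar>v x * g (x - s *\<^sub>R e)\<bar> \<le> ?G x" if s: "s \<in> {0..h}" for s x
  proof (cases "x \<in> ?K")
    case True
    then show ?thesis using B[of "x - s *\<^sub>R e"] by (simp add: abs_mult mult.commute[of "\<bar>v x\<bar>"] mult_right_mono)
  next
    case False
    have "norm x \<le> norm (x - s *\<^sub>R e) + norm (s *\<^sub>R e)" using norm_triangle_ineq[of "x - s *\<^sub>R e" "s *\<^sub>R e"] by simp
    moreover have "norm (s *\<^sub>R e) \<le> h * norm e" using s by (simp add: mult_right_mono)
    ultimately have "norm (x - s *\<^sub>R e) > R" using False by simp
    then show ?thesis using R B0 by simp
  qed
qed

text \<open>Line integrals of the shifted \<open>g\<close> and of the oppositely shifted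
  \<open>v\<close> lead to the same iterated integral by translation invariance. This is how
  averages along lines are passed between a function and a test function.\<close>

lemma locint_shift_Fubini:
  fixes v g :: "'a::euclidean_space \<Rightarrow> real"
  assumes v: "borel_locint v" and g[measurable]: "g \<in> borel_measurable borel"
    and B: "\<And>x. \<bar>g x\<bar> \<le> B" and R: "\<And>x. norm x > R \<Longrightarrow> g x = 0"
  shows "(\<integral>x. v x * (LINT s:{0..h}|lborel. g (x - s *\<^sub>R e)) \<partial>lborel) = (LINT s:{0..h}|lborel. (\<integral>x. v x * g (x - s *\<^sub>R e) \<partial>lborel))"
    and "(\<integral>x. (LINT s:{0..h}|lborel. v (x + s *\<^sub>R e)) * g x \<partial>lborel) = (LINT s:{0..h}|lborel. (\<integral>x. v x * g (x - s *\<^sub>R e) \<partial>lborel))"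
    and "AE x in lborel. set_integrable lborel {0..h} (\<lambda>s. v (x + s *\<^sub>R e) * g x)"
    and "integrable lborel (\<lambda>x. (LINT s:{0..h}|lborel. v (x + s *\<^sub>R e)) * g x)"
proof -
  have [measurable]: "v \<in> borel_measurable borel" using v by (simp add: borel_locint_def)
  obtain G where G: "integrable lborel G" "\<And>s x. s \<in> {0..h} \<Longrightarrow> \<bar>v x * g (x - s *\<^sub>R e)\<bar> \<le> G x"
    using locint_shift_bound[OF v g B R] by metis
  have int: "integrable lborel (\<lambda>x. v x * g (x - s *\<^sub>R e))" if "s \<in> {0..h}" for s
    by (rule Bochner_Integration.integrable_bound[OF G(1)]) (use G(2)[OF that] in \<open>auto intro!: AE_I2 order_trans[OF _ abs_ge_self]\<close>)
  have bd: "(\<integral>x. \<bar>v x * g (x - s *\<^sub>R e)\<bar> \<partial>lborel) \<le> (\<integral>x. G x \<partial>lborel)" if "s \<in> {0..h}" for s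
    by (rule integral_mono[OF integrable_abs[OF int[OF that]] G(1)]) (rule G(2)[OF that])
  have m1: "(\<lambda>(s, x). v x * g (x - s *\<^sub>R e)) \<in> borel_measurable (borel \<Otimes>\<^sub>M borel)" by measurable
  have m2: "(\<lambda>(s, x). v (x + s *\<^sub>R e) * g x) \<in> borel_measurable (borel \<Otimes>\<^sub>M borel)" by measurable
  show "(\<integral>x. v x * (LINT s:{0..h}|lborel. g (x - s *\<^sub>R e)) \<partial>lborel) = (LINT s:{0..h}|lborel. (\<integral>x. v x * g (x - s *\<^sub>R e) \<partial>lborel))"
    using slab_Fubini(1)[OF m1 int bd] by simp
  have tr: "v (x + s *\<^sub>R e) * g x = (\<lambda>x. v x * g (x - s *\<^sub>R e)) (x + s *\<^sub>R e)" for s x by simp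
  have int2: "integrable lborel (\<lambda>x. v (x + s *\<^sub>R e) * g x)" if "s \<in> {0..h}" for s
    unfolding tr using int[OF that] by (subst lborel_integrable_translate) auto
  have bd2: "(\<integral>x. \<bar>v (x + s *\<^sub>R e) * g x\<bar> \<partial>lborel) \<le> (\<integral>x. G x \<partial>lborel)" if "s \<in> {0..h}" for s
    using bd[OF that] lborel_integral_translate[of "\<lambda>x. \<bar>v x * g (x - s *\<^sub>R e)\<bar>" "s *\<^sub>R e"] by simp
  have eq: "(\<integral>x. v (x + s *\<^sub>R e) * g x \<partial>lborel) = (\<integral>x. v x * g (x - s *\<^sub>R e) \<partial>lborel)" for s
    using lborel_integral_translate[of "\<lambda>x. v x * g (x - s *\<^sub>R e)" "s *\<^sub>R e"] by simp
  show "(\<integral>x. (LINT s:{0..h}|lborel. v (x + s *\<^sub>R e)) * g x \<partial>lborel) = (LINT s:{0..h}|lborel. (\<integral>x. v x * g (x - s *\<^sub>R e) \<partial>lborel))"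
    using slab_Fubini(1)[OF m2 int2 bd2] by (simp add: eq)
  show "AE x in lborel. set_integrable lborel {0..h} (\<lambda>s. v (x + s *\<^sub>R e) * g x)"
    using slab_Fubini(2)[OF m2 int2 bd2] by simp
  show "integrable lborel (\<lambda>x. (LINT s:{0..h}|lborel. v (x + s *\<^sub>R e)) * g x)"
    using slab_Fubini(3)[OF m2 int2 bd2] by simp
qed

text \<open>The preceding lemma wants a bounded factor of bounded support; indicators of balls of
  integer radius provide it, at the cost of countably many null sets.\<close>

lemma AE_line_set_integrable:
  fixes v :: "'a::euclidean_space \<Rightarrow> real"
  assumes v: "borel_locint v"
  shows "AE x in lborel. set_integrable lborel {0..h} (\<lambda>s. v (x + s *\<^sub>R e))"
proof -
  have "AE x in lborel. set_integrable lborel {0..h} (\<lambda>s. v (x + s *\<^sub>R e) * indicator (cball 0 (real m)) x)" for m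
    by (rule locint_shift_Fubini(3)[OF v borel_measurable_indicator, where B = 1 and R = "real m"]) auto
  then have "AE x in lborel. \<forall>m::nat. set_integrable lborel {0..h} (\<lambda>s. v (x + s *\<^sub>R e) * indicator (cball 0 (real m)) x)"
    unfolding AE_all_countable by blast
  then show ?thesis
  proof eventually_elim
    case (elim x)
    obtain m :: nat where "norm x \<le> real m" using real_arch_simple by blast
    then show ?case using elim[rule_format, of m] by simp
  qed
qed

lemma borel_locint_line_integral:
  fixes v :: "'a::euclidean_space \<Rightarrow> real"
  assumes v: "borel_locint v"
  shows "borel_locint (\<lambda>x. LINT s:{0..h}|lborel. v (x + s *\<^sub>R e))"
proof (rule borel_locintI)
  have [measurable]: "v \<in> borel_measurable borel" using v by (simp add: borel_locint_def)
  show "(\<lambda>x. LINT s:{0..h}|lborel. v (x + s *\<^sub>R e)) \<in> borel_measurable borel"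
    unfolding set_lebesgue_integral_def by measurable
  fix R
  have "integrable lborel (\<lambda>x. (LINT s:{0..h}|lborel. v (x + s *\<^sub>R e)) * indicator (cball 0 R) x)"
    by (rule locint_shift_Fubini(4)[OF v borel_measurable_indicator, where B = 1 and R = R]) auto
  then show "set_integrable lborel (cball 0 R) (\<lambda>x. LINT s:{0..h}|lborel. v (x + s *\<^sub>R e))"
    by (simp add: set_integrable_def mult.commute)
qed

lemma borel_locint_translate:
  fixes v :: "'a::euclidean_space \<Rightarrow> real"
  assumes v: "borel_locint v"
  shows "borel_locint (\<lambda>x. v (x + c))"
proof (rule borel_locintI)
  have [measurable]: "v \<in> borel_measurable borel" using v by (simp add: borel_locint_def)
  show "(\<lambda>x. v (x + c)) \<in> borel_measurable borel" by measurable
  fix R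
  have "integrable lborel (\<lambda>x. v x * indicator (cball 0 R) (x - c))"
    by (rule borel_locint_mult_integrable[OF v, where B = 1 and K = "cball c R"])
      (auto simp: indicator_def dist_norm norm_minus_commute split: if_splits)
  then have "integrable lborel (\<lambda>x. (\<lambda>x. v x * indicator (cball 0 R) (x - c)) (x + c))"
    by (subst lborel_integrable_translate) auto
  then show "set_integrable lborel (cball 0 R) (\<lambda>x. v (x + c))"
    by (simp add: set_integrable_def mult.commute)
qed

text \<open>Weak derivatives in the direction of a basis vector, expressed through increments along lines.
  In this form the chain rule reduces to one dimension.\<close>

definition line_deriv :: "'a::euclidean_space \<Rightarrow> ('a \<Rightarrow> real) \<Rightarrow> ('a \<Rightarrow> real) \<Rightarrow> bool" where
  "line_deriv e u v \<longleftrightarrow> borel_locint u \<and> borel_locint v \<and>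
     (\<forall>h\<ge>0. AE x in lborel. u (x + h *\<^sub>R e) - u x = (LINT s:{0..h}|lborel. v (x + s *\<^sub>R e)))"

lemma test_fun_norm_bound:
  fixes \<phi> :: "real^'n::finite \<Rightarrow> real"
  assumes "test_fun \<phi>"
  obtains R where "\<And>x. norm x > R \<Longrightarrow> \<phi> x = 0"
proof -
  have "bounded (closure {x. \<phi> x \<noteq> 0})" using assms by (simp add: test_fun_def compact_imp_bounded)
  then obtain R where "\<And>x. x \<in> closure {x. \<phi> x \<noteq> 0} \<Longrightarrow> norm x \<le> R" by (auto simp: bounded_iff)
  then have "\<phi> x = 0" if "norm x > R" for x
    using that closure_subset[of "{x. \<phi> x \<noteq> 0}"] by force
  then show ?thesis using that by blast
qed

text \<open>The translation is moved onto the test function, where the classical fundamental theorem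
  of calculus applies. The sign comes from the test function being shifted backwards.\<close>

lemma increment_test_integral:
  fixes u :: "real^'n::finite \<Rightarrow> real"
  assumes u: "borel_locint u" and \<phi>: "test_fun \<phi>" and h: "0 \<le> h"
  shows "(\<integral>x. (u (x + h *\<^sub>R axis i 1) - u x) * \<phi> x \<partial>lborel)
    = - (LINT s:{0..h}|lborel. (\<integral>x. u x * partial_deriv i \<phi> (x - s *\<^sub>R axis i 1) \<partial>lborel))"
proof -
  let ?e = "axis i 1 :: real^'n"
  have [measurable]: "u \<in> borel_measurable borel" using u by (simp add: borel_locint_def)
  have [measurable]: "\<phi> \<in> borel_measurable borel" using \<phi> by (rule test_fun_borel)
  have \<phi>h: "test_fun (\<lambda>x. \<phi> (x - h *\<^sub>R ?e))" using test_fun_translate[OF \<phi>, of "- (h *\<^sub>R ?e)"] by simp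
  have p: "test_fun (partial_deriv i \<phi>)" by (rule test_fun_partial_deriv[OF \<phi>])
  obtain B where B: "\<And>x. \<bar>partial_deriv i \<phi> x\<bar> \<le> B" using test_fun_bounded[OF p] by blast
  obtain R where R: "\<And>x. norm x > R \<Longrightarrow> partial_deriv i \<phi> x = 0" using test_fun_norm_bound[OF p] by blast
  have i1: "integrable lborel (\<lambda>x. u x * \<phi> (x - h *\<^sub>R ?e))" by (rule borel_locint_test_fun[OF u \<phi>h])
  have i2: "integrable lborel (\<lambda>x. u x * \<phi> x)" by (rule borel_locint_test_fun[OF u \<phi>])
  have tr: "u (x + h *\<^sub>R ?e) * \<phi> x = (\<lambda>x. u x * \<phi> (x - h *\<^sub>R ?e)) (x + h *\<^sub>R ?e)" for x by simp
  have i1': "integrable lborel (\<lambda>x. u (x + h *\<^sub>R ?e) * \<phi> x)"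
    unfolding tr using i1 by (subst lborel_integrable_translate) auto
  have FTC: "\<phi> (x - h *\<^sub>R ?e) - \<phi> x = - (LINT s:{0..h}|lborel. partial_deriv i \<phi> (x - s *\<^sub>R ?e))" for x
  proof -
    let ?F = "\<lambda>s. - \<phi> (x - s *\<^sub>R ?e)"
    have der: "(?F has_real_derivative partial_deriv i \<phi> (x - s *\<^sub>R ?e)) (at s)" for s
    proof -
      have "((\<lambda>s. \<phi> (x + s *\<^sub>R ?e)) has_real_derivative partial_deriv i \<phi> (x + (- s) *\<^sub>R ?e)) (at (- s))"
        using \<phi> by (intro partial_deriv_along_line smooth_fun_differentiable) (simp add: test_fun_def)
      from DERIV_minus[OF DERIV_chain2[OF this DERIV_minus[OF DERIV_ident]]]
      show ?thesis by simp
    qed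
    have "continuous_on {0..h} (\<lambda>s. partial_deriv i \<phi> (x - s *\<^sub>R ?e))"
      by (intro continuous_on_compose2[OF test_fun_continuous[OF p, of UNIV]] continuous_intros) auto
    then have "(LINT s:{0..h}|lborel. partial_deriv i \<phi> (x - s *\<^sub>R ?e)) = ?F h - ?F 0"
      unfolding set_lebesgue_integral_def
      by (intro integral_FTC_Icc h) (use der in \<open>auto simp: has_real_derivative_iff_has_vector_derivative[symmetric] intro: has_field_derivative_at_within\<close>)
    then show ?thesis by simp
  qed
  have "(\<integral>x. (u (x + h *\<^sub>R ?e) - u x) * \<phi> x \<partial>lborel) = (\<integral>x. u (x + h *\<^sub>R ?e) * \<phi> x \<partial>lborel) - (\<integral>x. u x * \<phi> x \<partial>lborel)"
    using i1' i2 by (simp add: left_diff_distrib)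
  also have "(\<integral>x. u (x + h *\<^sub>R ?e) * \<phi> x \<partial>lborel) = (\<integral>x. u x * \<phi> (x - h *\<^sub>R ?e) \<partial>lborel)"
    unfolding tr by (rule lborel_integral_translate) auto
  also have "\<dots> - (\<integral>x. u x * \<phi> x \<partial>lborel) = (\<integral>x. u x * (\<phi> (x - h *\<^sub>R ?e) - \<phi> x) \<partial>lborel)"
    using i1 i2 by (simp add: right_diff_distrib)
  also have "\<dots> = - (\<integral>x. u x * (LINT s:{0..h}|lborel. partial_deriv i \<phi> (x - s *\<^sub>R ?e)) \<partial>lborel)"
    unfolding FTC by simp
  also have "\<dots> = - (LINT s:{0..h}|lborel. (\<integral>x. u x * partial_deriv i \<phi> (x - s *\<^sub>R ?e) \<partial>lborel))"
    using locint_shift_Fubini(1)[OF u test_fun_borel[OF p] B R] by simp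
  finally show ?thesis .
qed

text \<open>Applying the hypothesis to all shifts of a test function and integrating over the shift
  shows that both sides of the increment identity have the same integral against that test function;
  the fundamental lemma concludes.\<close>

lemma line_deriv_of_weak:
  fixes u v :: "real^'n::finite \<Rightarrow> real"
  assumes u: "borel_locint u" and v: "borel_locint v"
    and w: "\<And>\<phi>. test_fun \<phi> \<Longrightarrow> (\<integral>x. u x * partial_deriv i \<phi> x \<partial>lborel) = - (\<integral>x. v x * \<phi> x \<partial>lborel)"
  shows "line_deriv (axis i 1) u v"
  unfolding line_deriv_def
proof (intro conjI u v allI impI)
  fix h :: real assume h: "0 \<le> h"
  let ?e = "axis i 1 :: real^'n"
  let ?V = "\<lambda>x. LINT s:{0..h}|lborel. v (x + s *\<^sub>R ?e)"
  have lV: "borel_locint ?V" by (rule borel_locint_line_integral[OF v])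
  have lu: "borel_locint (\<lambda>x. u (x + h *\<^sub>R ?e) - u x)"
    by (intro borel_locint_diff borel_locint_translate u)
  have "AE x in lborel. (u (x + h *\<^sub>R ?e) - u x) - ?V x = 0"
  proof (rule AE_zero_if_test_integrals_zero)
    show "borel_locint (\<lambda>x. (u (x + h *\<^sub>R ?e) - u x) - ?V x)"
      by (intro borel_locint_diff[OF lu lV])
    fix \<phi> :: "real^'n \<Rightarrow> real" assume \<phi>: "test_fun \<phi>"
    obtain B where B: "\<And>x. \<bar>\<phi> x\<bar> \<le> B" using test_fun_bounded[OF \<phi>] by blast
    obtain R where R: "\<And>x. norm x > R \<Longrightarrow> \<phi> x = 0" using test_fun_norm_bound[OF \<phi>] by blast
    have sh: "(\<integral>x. u x * partial_deriv i \<phi> (x - s *\<^sub>R ?e) \<partial>lborel) = - (\<integral>x. v x * \<phi> (x - s *\<^sub>R ?e) \<partial>lborel)" for s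
    proof -
      have "test_fun (\<lambda>x. \<phi> (x + - (s *\<^sub>R ?e)))" by (rule test_fun_translate[OF \<phi>])
      from w[OF this] show ?thesis unfolding partial_deriv_translate by simp
    qed
    have "(\<integral>x. ((u (x + h *\<^sub>R ?e) - u x) - ?V x) * \<phi> x \<partial>lborel)
      = (\<integral>x. (u (x + h *\<^sub>R ?e) - u x) * \<phi> x \<partial>lborel) - (\<integral>x. ?V x * \<phi> x \<partial>lborel)"
      using borel_locint_test_fun[OF lu \<phi>] borel_locint_test_fun[OF lV \<phi>]
      by (simp only: left_diff_distrib[of "_ - _"] Bochner_Integration.integral_diff)
    also have "(\<integral>x. (u (x + h *\<^sub>R ?e) - u x) * \<phi> x \<partial>lborel) = (LINT s:{0..h}|lborel. (\<integral>x. v x * \<phi> (x - s *\<^sub>R ?e) \<partial>lborel))"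
      by (simp add: increment_test_integral[OF u \<phi> h] sh set_lebesgue_integral_def)
    also have "\<dots> = (\<integral>x. ?V x * \<phi> x \<partial>lborel)"
      using locint_shift_Fubini(2)[OF v test_fun_borel[OF \<phi>] B R] by simp
    finally show "(\<integral>x. ((u (x + h *\<^sub>R ?e) - u x) - ?V x) * \<phi> x \<partial>lborel) = 0" by simp
  qed
  then show "AE x in lborel. u (x + h *\<^sub>R ?e) - u x = ?V x" by eventually_elim simp
qed

text \<open>Provides the continuity at shift 0 that allows a pointwise identity to be recovered from
  its averages over shifts.\<close>

lemma continuous_on_shift_integral:
  fixes u :: "real^'n::finite \<Rightarrow> real"
  assumes u: "borel_locint u" and \<phi>: "test_fun \<phi>"
  shows "continuous_on {0..h} (\<lambda>s. \<integral>x. u x * \<phi> (x - s *\<^sub>R e) \<partial>lborel)"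
  unfolding continuous_on_sequentially
proof (intro ballI allI impI, elim conjE)
  fix s :: real and \<sigma> :: "nat \<Rightarrow> real"
  assume s: "s \<in> {0..h}" and \<sigma>: "\<forall>n. \<sigma> n \<in> {0..h}" "\<sigma> \<longlonglongrightarrow> s"
  have [measurable]: "u \<in> borel_measurable borel" using u by (simp add: borel_locint_def)
  have [measurable]: "\<phi> \<in> borel_measurable borel" using \<phi> by (rule test_fun_borel)
  obtain B where B: "\<And>x. \<bar>\<phi> x\<bar> \<le> B" using test_fun_bounded[OF \<phi>] by blast
  obtain R where R: "\<And>x. norm x > R \<Longrightarrow> \<phi> x = 0" using test_fun_norm_bound[OF \<phi>] by blast
  obtain G where G: "integrable lborel G" "\<And>s x. s \<in> {0..h} \<Longrightarrow> \<bar>u x * \<phi> (x - s *\<^sub>R e)\<bar> \<le> G x"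
    using locint_shift_bound[OF u test_fun_borel[OF \<phi>] B R] by metis
  show "((\<lambda>s. \<integral>x. u x * \<phi> (x - s *\<^sub>R e) \<partial>lborel) \<circ> \<sigma>) \<longlonglongrightarrow> (\<integral>x. u x * \<phi> (x - s *\<^sub>R e) \<partial>lborel)"
    unfolding o_def
  proof (rule integral_dominated_convergence[OF _ _ G(1)])
    have "(\<lambda>n. \<phi> (x - \<sigma> n *\<^sub>R e)) \<longlonglongrightarrow> \<phi> (x - s *\<^sub>R e)" for x
      using \<sigma>(2) test_fun_continuous[OF \<phi>, of UNIV]
      by (intro isCont_tendsto_compose[of _ \<phi>] tendsto_intros) (auto simp: continuous_on_eq_continuous_at simp del: split_paired_All)
    then show "AE x in lborel. (\<lambda>n. u x * \<phi> (x - \<sigma> n *\<^sub>R e)) \<longlonglongrightarrow> u x * \<phi> (x - s *\<^sub>R e)"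
      by (intro AE_I2 tendsto_intros)
    show "AE x in lborel. norm (u x * \<phi> (x - \<sigma> n *\<^sub>R e)) \<le> G x" for n
      using G(2) \<sigma>(1) by simp
  qed auto
qed

text \<open>\<open>q 0\<close> is the one-sided derivative at 0 of the indefinite integral, which is
  constant.\<close>

lemma zero_if_initial_integrals_zero:
  fixes q :: "real \<Rightarrow> real"
  assumes q: "continuous_on {0..1} q" and z: "\<And>h. 0 \<le> h \<Longrightarrow> h \<le> 1 \<Longrightarrow> (LINT s:{0..h}|lborel. q s) = 0"
  shows "q 0 = 0"
proof -
  have "integral {0..h} q = 0" if "h \<in> {0..1}" for h
  proof -
    have "continuous_on {0..h} q" using q that continuous_on_subset by fastforce
    then show ?thesis
      using set_borel_integral_eq_integral(2)[OF borel_integrable_atLeastAtMost'[of 0 h q]] z[of h] that by auto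
  qed
  moreover have "((\<lambda>u. integral {0..u} q) has_vector_derivative q 0) (at 0 within {0..1})"
    by (rule integral_has_vector_derivative[OF q]) auto
  ultimately have "((\<lambda>u. 0) has_vector_derivative q 0) (at 0 within {0..1})"
    by (elim has_vector_derivative_transform[rotated 2]) auto
  moreover have "((\<lambda>u. 0) has_vector_derivative (0::real)) (at 0 within {0..1})" by simp
  ultimately show ?thesis
    using vector_derivative_unique_within_closed_interval[of 0 1 0 "\<lambda>u. 0" "q 0" 0] by simp
qed

text \<open>The claim is the case of shift 0 of an identity between \<open>I\<close> and
  \<open>- J\<close>. Integrated over shifts in \<open>{0..h}\<close> that identity is the increment
  identity tested against \<phi>, true for each \<open>h\<close>; both sides are continuous in the
  shift.\<close>

lemma weak_of_line_deriv:
  fixes u v :: "real^'n::finite \<Rightarrow> real"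
  assumes l: "line_deriv (axis i 1) u v" and \<phi>: "test_fun \<phi>"
  shows "(\<integral>x. u x * partial_deriv i \<phi> x \<partial>lborel) = - (\<integral>x. v x * \<phi> x \<partial>lborel)"
proof -
  let ?e = "axis i 1 :: real^'n"
  have u: "borel_locint u" and v: "borel_locint v" using l by (auto simp: line_deriv_def)
  have p: "test_fun (partial_deriv i \<phi>)" by (rule test_fun_partial_deriv[OF \<phi>])
  obtain B where B: "\<And>x. \<bar>\<phi> x\<bar> \<le> B" using test_fun_bounded[OF \<phi>] by blast
  obtain R where R: "\<And>x. norm x > R \<Longrightarrow> \<phi> x = 0" using test_fun_norm_bound[OF \<phi>] by blast
  define I where "I s = (\<integral>x. u x * partial_deriv i \<phi> (x - s *\<^sub>R ?e) \<partial>lborel)" for s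
  define J where "J s = (\<integral>x. v x * \<phi> (x - s *\<^sub>R ?e) \<partial>lborel)" for s
  have cI: "continuous_on {0..h} I" and cJ: "continuous_on {0..h} J" for h
    unfolding I_def J_def by (intro continuous_on_shift_integral u v p \<phi>)+
  have "I 0 + J 0 = 0"
  proof (rule zero_if_initial_integrals_zero[of "\<lambda>s. I s + J s"])
    show "continuous_on {0..1} (\<lambda>s. I s + J s)" by (intro continuous_intros cI cJ)
    fix h :: real assume h: "0 \<le> h" "h \<le> 1"
    have "(LINT s:{0..h}|lborel. I s + J s) = (LINT s:{0..h}|lborel. I s) + (LINT s:{0..h}|lborel. J s)"
      by (intro set_integral_add(2) borel_integrable_atLeastAtMost' cI cJ)
    also have "(LINT s:{0..h}|lborel. I s) = - (\<integral>x. (u (x + h *\<^sub>R ?e) - u x) * \<phi> x \<partial>lborel)"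
      using increment_test_integral[OF u \<phi> h(1), of i] by (simp add: I_def)
    also have "(\<integral>x. (u (x + h *\<^sub>R ?e) - u x) * \<phi> x \<partial>lborel) = (\<integral>x. (LINT s:{0..h}|lborel. v (x + s *\<^sub>R ?e)) * \<phi> x \<partial>lborel)"
    proof (rule integral_cong_AE)
      show "AE x in lborel. (u (x + h *\<^sub>R ?e) - u x) * \<phi> x = (LINT s:{0..h}|lborel. v (x + s *\<^sub>R ?e)) * \<phi> x"
        using l h(1) by (auto simp: line_deriv_def)
      show "(\<lambda>x. (u (x + h *\<^sub>R ?e) - u x) * \<phi> x) \<in> borel_measurable lborel"
        using borel_locint_translate[OF u, of "h *\<^sub>R ?e"] u test_fun_borel[OF \<phi>]
        by (auto simp: borel_locint_def)
      show "(\<lambda>x. (LINT s:{0..h}|lborel. v (x + s *\<^sub>R ?e)) * \<phi> x) \<in> borel_measurable lborel"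
        using borel_locint_line_integral[OF v, of h ?e] test_fun_borel[OF \<phi>]
        by (auto simp: borel_locint_def)
    qed
    also have "\<dots> = (LINT s:{0..h}|lborel. J s)"
      unfolding J_def by (rule locint_shift_Fubini(2)[OF v test_fun_borel[OF \<phi>] B R])
    finally show "(LINT s:{0..h}|lborel. I s + J s) = 0" by simp
  qed
  then show ?thesis by (simp add: I_def J_def)
qed


lemma set_integrable_lborel_imp_absolutely_integrable:
  fixes f :: "'a::euclidean_space \<Rightarrow> real"
  assumes "set_integrable lborel S f"
  shows "f absolutely_integrable_on S"
  using assms integrable_completion[of "\<lambda>x. indicator S x *\<^sub>R f x" lborel]
    borel_measurable_integrable[of lborel "\<lambda>x. indicator S x *\<^sub>R f x"]
  unfolding set_integrable_def by blast

text \<open>In \<open>line_deriv\<close> the exceptional set of \<open>x\<close> depends on the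
  increment. Fubini's theorem exchanges the quantifiers, so that on almost every line
  \<open>u\<close> coincides for almost all \<open>s\<close> with an indefinite integral.\<close>

lemma AE_line_deriv_along:
  fixes u v :: "'a::euclidean_space \<Rightarrow> real"
  assumes l: "line_deriv e u v"
  shows "AE x in lborel. AE s in lborel. s \<in> {0..h} \<longrightarrow> u (x + s *\<^sub>R e) = u x + (LINT r:{0..s}|lborel. v (x + r *\<^sub>R e))"
proof -
  have P: "pair_sigma_finite (lborel :: 'a measure) (lborel :: real measure)" ..
  have [measurable]: "u \<in> borel_measurable borel" "v \<in> borel_measurable borel"
    using l by (auto simp: line_deriv_def borel_locint_def)
  have "AE x in lborel. s \<in> {0..h} \<longrightarrow> u (x + s *\<^sub>R e) = u x + (LINT r:{0..s}|lborel. v (x + r *\<^sub>R e))" for s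
  proof (cases "s \<in> {0..h}")
    case True
    then have "AE x in lborel. u (x + s *\<^sub>R e) - u x = (LINT r:{0..s}|lborel. v (x + r *\<^sub>R e))"
      using l by (simp add: line_deriv_def)
    then show ?thesis by eventually_elim simp
  qed auto
  then have "AE s in lborel. AE x in lborel. s \<in> {0..h} \<longrightarrow> u (x + s *\<^sub>R e) = u x + (LINT r:{0..s}|lborel. v (x + r *\<^sub>R e))"
    by simp
  moreover have "{p \<in> space (lborel \<Otimes>\<^sub>M lborel). snd p \<in> {0..h} \<longrightarrow> u (fst p + snd p *\<^sub>R e) = u (fst p) +
     (LINT r:{0..snd p}|lborel. v (fst p + r *\<^sub>R e))} \<in> sets (lborel \<Otimes>\<^sub>M lborel)"
  proof -
    have [measurable]: "(\<lambda>p. (LINT r:{0..snd p}|lborel. v (fst p + r *\<^sub>R e))) \<in> borel_measurable (lborel \<Otimes>\<^sub>M lborel)"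
    proof -
      \<comment> \<open>The moving domain is absorbed into the integrand, which is then jointly
        measurable in \<open>p\<close> and \<open>r\<close>.\<close>
      have "(LINT r:{0..snd p}|lborel. v (fst p + r *\<^sub>R e)) = (\<integral>r. (if 0 \<le> r \<and> r \<le> snd p then v (fst p + r *\<^sub>R e) else 0) \<partial>lborel)" for p
        unfolding set_lebesgue_integral_def by (rule Bochner_Integration.integral_cong) (auto simp: indicator_def)
      then show ?thesis by simp
    qed
    show ?thesis by measurable
  qed
  ultimately show ?thesis
    using pair_sigma_finite.AE_commute[OF P, of "\<lambda>x s. s \<in> {0..h} \<longrightarrow> u (x + s *\<^sub>R e) = u x + (LINT r:{0..s}|lborel. v (x + r *\<^sub>R e))"]
    by blast
qed

text \<open>Under the integral it suffices that the absolutely continuous \<open>U\<close> agrees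
  with the pair \<open>u1\<close>, \<open>u2\<close> for almost all \<open>s\<close>. The endpoints
  need true equality: at 0 it holds by construction, at \<open>h\<close> it is the increment
  identity for this particular \<open>h\<close>.\<close>

lemma line_deriv_chain:
  fixes u1 u2 v1 v2 :: "'a::euclidean_space \<Rightarrow> real" and \<Phi> D1 D2 :: "real \<times> real \<Rightarrow> real"
  assumes l1: "line_deriv e u1 v1" and l2: "line_deriv e u2 v2"
    and \<Phi>: "\<And>z. (\<Phi> has_derivative (\<lambda>k. fst k * D1 z + snd k * D2 z)) (at z)"
    and D1: "continuous_on UNIV D1" and D2: "continuous_on UNIV D2"
    and loc: "borel_locint (\<lambda>x. \<Phi> (u1 x, u2 x))" 
      "borel_locint (\<lambda>x. D1 (u1 x, u2 x) * v1 x + D2 (u1 x, u2 x) * v2 x)" (is "borel_locint ?W")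
  shows "line_deriv e (\<lambda>x. \<Phi> (u1 x, u2 x)) (\<lambda>x. D1 (u1 x, u2 x) * v1 x + D2 (u1 x, u2 x) * v2 x)"
  unfolding line_deriv_def
proof (intro conjI loc allI impI)
  fix h :: real assume h: "0 \<le> h"
  have v: "borel_locint v1" "borel_locint v2" using l1 l2 by (auto simp: line_deriv_def)
  have "AE x in lborel. u1 (x + h *\<^sub>R e) - u1 x = (LINT s:{0..h}|lborel. v1 (x + s *\<^sub>R e))"
    "AE x in lborel. u2 (x + h *\<^sub>R e) - u2 x = (LINT s:{0..h}|lborel. v2 (x + s *\<^sub>R e))"
    using l1 l2 h by (auto simp: line_deriv_def)
  then show "AE x in lborel. \<Phi> (u1 (x + h *\<^sub>R e), u2 (x + h *\<^sub>R e)) - \<Phi> (u1 x, u2 x)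
      = (LINT s:{0..h}|lborel. ?W (x + s *\<^sub>R e))"
    using AE_line_set_integrable[OF v(1), of h e] AE_line_set_integrable[OF v(2), of h e]
      AE_line_set_integrable[OF loc(2), of h e] AE_line_deriv_along[OF l1, of h] AE_line_deriv_along[OF l2, of h]
  proof eventually_elim
    case (elim x)
    let ?f1 = "\<lambda>s. v1 (x + s *\<^sub>R e)" and ?f2 = "\<lambda>s. v2 (x + s *\<^sub>R e)"
    define U where "U s = (u1 x + integral {0..s} ?f1, u2 x + integral {0..s} ?f2)" for s
    have eq: "(LINT r:{0..s}|lborel. ?f1 r) = integral {0..s} ?f1" "(LINT r:{0..s}|lborel. ?f2 r) = integral {0..s} ?f2"
      if "s \<in> {0..h}" for s
      using set_borel_integral_eq_integral(2)[OF set_integrable_subset[OF elim(3), of "{0..s}"]]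
        set_borel_integral_eq_integral(2)[OF set_integrable_subset[OF elim(4), of "{0..s}"]] that by auto
    note chain = absolutely_continuous_chain_rule(2)[OF h
        set_integrable_lborel_imp_absolutely_integrable[OF elim(3)]
        set_integrable_lborel_imp_absolutely_integrable[OF elim(4)] \<Phi> D1 D2, of U "u1 x" "u2 x"]
    have Uh: "U h = (u1 (x + h *\<^sub>R e), u2 (x + h *\<^sub>R e))"
      using elim(1,2) eq[of h] h by (simp add: U_def)
    have U0: "U 0 = (u1 x, u2 x)" by (simp add: U_def)
    have "AE s in lborel. s \<in> {0..h} \<longrightarrow> U s = (u1 (x + s *\<^sub>R e), u2 (x + s *\<^sub>R e))"
      using elim(6,7)
    proof eventually_elim
      case (elim s)
      then show ?case using eq[of s] by (auto simp: U_def)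
    qed
    then have "AE s in lebesgue. s \<in> {0..h} \<longrightarrow> U s = (u1 (x + s *\<^sub>R e), u2 (x + s *\<^sub>R e))"
      by (rule AE_completion)
    then obtain N where N: "N \<in> null_sets lebesgue" "{s. \<not> (s \<in> {0..h} \<longrightarrow> U s = (u1 (x + s *\<^sub>R e), u2 (x + s *\<^sub>R e)))} \<subseteq> N"
      unfolding eventually_ae_filter by auto
    have "\<Phi> (U h) - \<Phi> (U 0) = integral {0..h} (\<lambda>s. D1 (U s) * ?f1 s + D2 (U s) * ?f2 s)"
      by (rule chain) (rule U_def)
    also have "\<dots> = integral {0..h} (\<lambda>s. ?W (x + s *\<^sub>R e))"
    proof (rule integral_spike[of N])
      show "negligible N" using N(1) by (simp add: negligible_iff_null_sets)
      fix s assume "s \<in> {0..h} - N"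
      then have "U s = (u1 (x + s *\<^sub>R e), u2 (x + s *\<^sub>R e))" using N(2) by blast
      then show "?W (x + s *\<^sub>R e) = D1 (U s) * ?f1 s + D2 (U s) * ?f2 s" by simp
    qed
    also have "\<dots> = (LINT s:{0..h}|lborel. ?W (x + s *\<^sub>R e))"
      by (rule set_borel_integral_eq_integral(2)[OF elim(5), symmetric])
    finally show ?case unfolding Uh U0 .
  qed
qed

lemma line_deriv_mult:
  assumes l1: "line_deriv e u1 v1" and l2: "line_deriv e u2 v2"
    and loc: "borel_locint (\<lambda>x. u1 x * u2 x)" "borel_locint (\<lambda>x. u2 x * v1 x + u1 x * v2 x)"
  shows "line_deriv e (\<lambda>x. u1 x * u2 x) (\<lambda>x. u2 x * v1 x + u1 x * v2 x)"
proof -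
  have "((\<lambda>z::real \<times> real. fst z * snd z) has_derivative (\<lambda>k. fst k * snd z + snd k * fst z)) (at z)" for z
    by (auto intro!: derivative_eq_intros)
  from line_deriv_chain[OF l1 l2 this] loc show ?thesis by (simp add: continuous_on_snd continuous_on_fst)
qed

lemma line_deriv_add:
  assumes l1: "line_deriv e u1 v1" and l2: "line_deriv e u2 v2"
  shows "line_deriv e (\<lambda>x. u1 x + u2 x) (\<lambda>x. v1 x + v2 x)"
proof -
  have "((\<lambda>z::real \<times> real. fst z + snd z) has_derivative (\<lambda>k. fst k * 1 + snd k * 1)) (at z)" for z
    by (auto intro!: derivative_eq_intros)
  from line_deriv_chain[OF l1 l2 this] l1 l2 show ?thesis by (simp add: borel_locint_add line_deriv_def)
qed

section \<open>The formula of Faa di Bruno for weak derivatives\<close>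

lemma mi_order_add_one [simp]: "mi_order (s(i := Suc (s i))) = Suc (mi_order s)"
proof -
  have "mi_order (s(i := Suc (s i))) = (\<Sum>j\<in>UNIV. s j + (if j = i then 1 else 0))"
    unfolding mi_order_def by (rule sum.cong) auto
  then show ?thesis by (simp add: sum.distrib mi_order_def)
qed

lemma mi_order_zero [simp]: "mi_order (\<lambda>_. 0) = 0"
  by (simp add: mi_order_def)

lemma mi_order_eq_0_iff: "mi_order s = 0 \<longleftrightarrow> s = (\<lambda>_. 0)"
  by (auto simp: mi_order_def)

text \<open>Each term is replaced by the largest one, which gives the power mean inequality with a
  cruder constant.\<close>

lemma sum_powr_le:
  fixes f :: "'a \<Rightarrow> real"
  assumes I: "finite I" and f: "\<And>i. i \<in> I \<Longrightarrow> 0 \<le> f i" and p: "0 < p"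
  shows "(\<Sum>i\<in>I. f i) powr p \<le> real (card I) powr p * (\<Sum>i\<in>I. f i powr p)"
proof (cases "I = {}")
  case False
  define m where "m = Max (f ` I)"
  have "m \<in> f ` I" unfolding m_def using I False by (intro Max_in) auto
  then obtain j where j: "j \<in> I" "m = f j" by auto
  have le: "f i \<le> m" if "i \<in> I" for i unfolding m_def using I that by simp
  have "(\<Sum>i\<in>I. f i) \<le> real (card I) * m" using sum_bounded_above[of I f m] le by simp
  then have "(\<Sum>i\<in>I. f i) powr p \<le> (real (card I) * m) powr p"
    using f p by (intro powr_mono2) (auto intro: sum_nonneg)
  also have "\<dots> = real (card I) powr p * f j powr p" using j f by (simp add: powr_mult)
  also have "\<dots> \<le> real (card I) powr p * (\<Sum>i\<in>I. f i powr p)"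
    using I j by (intro mult_left_mono member_le_sum) auto
  finally show ?thesis .
qed simp

lemma powr_le_one_plus:
  assumes "(0::real) \<le> x" "0 < p" "p \<le> q"
  shows "x powr p \<le> 1 + x powr q"
proof (cases "x \<le> 1")
  case True
  then have "x powr p \<le> 1 powr p" using assms by (intro powr_mono2) auto
  then show ?thesis by (simp add: add_increasing2)
next
  case False
  then have "x powr p \<le> x powr q" using assms by (intro powr_mono) auto
  then show ?thesis by simp
qed

text \<open>Membership encodes that derivatives of all orders exist and are bounded: the partials
  are again members, so the chain rule can be iterated without leaving \<open>S\<close>.\<close>

definition smooth_class :: "(real \<times> real \<Rightarrow> real) set \<Rightarrow> bool" where
  "smooth_class S \<longleftrightarrow> (\<forall>\<beta>\<in>S. (\<exists>B. \<forall>z. \<bar>\<beta> z\<bar> \<le> B) \<and>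
     (\<exists>\<beta>1\<in>S. \<exists>\<beta>2\<in>S. \<forall>z. (\<beta> has_derivative (\<lambda>k. fst k * \<beta>1 z + snd k * \<beta>2 z)) (at z)))"

lemma smooth_class_continuous:
  assumes "smooth_class S" "\<beta> \<in> S" shows "continuous_on A \<beta>"
  using assms unfolding smooth_class_def
  by (meson continuous_at_imp_continuous_on has_derivative_continuous)

text \<open>A family \<open>A c s\<close> stands for the derivatives \<open>D\<^sup>s\<close> of two functions, selected by \<open>c\<close>. The relation
  \<open>fdb_op S j T\<close> says that \<open>T A\<close> is a sum of terms as in the formula of Faa di Bruno for a derivative of
  order \<open>j\<close>; homogeneity of degree \<open>j\<close> is what matches the exponents \<open>\<lambda>\<^sub>1 / j\<close>.\<close>

type_synonym 'n deriv_family = "bool \<Rightarrow> ('n \<Rightarrow> nat) \<Rightarrow> real^'n \<Rightarrow> real"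

inductive fdb_op :: "(real \<times> real \<Rightarrow> real) set \<Rightarrow> nat \<Rightarrow> ('n::finite deriv_family \<Rightarrow> real^'n \<Rightarrow> real) \<Rightarrow> bool"
  for S where
  base: "\<beta> \<in> S \<Longrightarrow> fdb_op S 0 (\<lambda>A x. \<beta> (A False (\<lambda>_. 0) x, A True (\<lambda>_. 0) x))"
| deriv: "1 \<le> mi_order s \<Longrightarrow> fdb_op S (mi_order s) (\<lambda>A. A c s)"
| mult: "fdb_op S i T1 \<Longrightarrow> fdb_op S j T2 \<Longrightarrow> fdb_op S (i + j) (\<lambda>A x. T1 A x * T2 A x)"
| add: "fdb_op S j T1 \<Longrightarrow> fdb_op S j T2 \<Longrightarrow> fdb_op S j (\<lambda>A x. T1 A x + T2 A x)"

text \<open>The root of order \<open>mi_order s\<close> makes every derivative homogeneous of degree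
  one, so a term of total order \<open>j\<close> compares with the \<open>j\<close>-th power of the
  gauge, and each summand is a function in L with exponent \<open>\<Lambda> 1\<close>.\<close>

definition fdb_gauge :: "nat \<Rightarrow> 'n::finite deriv_family \<Rightarrow> real^'n \<Rightarrow> real" where
  "fdb_gauge k A x = (\<Sum>(c, s)\<in>UNIV \<times> {s. 1 \<le> mi_order s \<and> mi_order s \<le> k}. \<bar>A c s x\<bar> powr (1 / real (mi_order s)))"

lemma finite_gauge_index [simp]: "finite (UNIV \<times> {s :: 'n::finite \<Rightarrow> nat. 1 \<le> mi_order s \<and> mi_order s \<le> k} :: (bool \<times> _) set)"
  by (intro finite_cartesian_product finite) (rule finite_subset[OF _ finite_mi_order_le[of k]], auto)

lemmas finite_gauge_index' [simp] = finite_gauge_index[unfolded One_nat_def]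

lemma gauge_nonneg: "0 \<le> fdb_gauge k A x"
  unfolding fdb_gauge_def by (intro sum_nonneg) auto

lemma gauge_ge:
  assumes "1 \<le> mi_order s" "mi_order s \<le> k"
  shows "\<bar>A c s x\<bar> powr (1 / real (mi_order s)) \<le> fdb_gauge k A x"
proof -
  have "(\<lambda>(c, s). \<bar>A c s x\<bar> powr (1 / real (mi_order s))) (c, s) \<le> fdb_gauge k A x"
    unfolding fdb_gauge_def using assms by (intro member_le_sum) auto
  then show ?thesis by simp
qed

lemma gauge_mono:
  assumes "\<And>c s. 1 \<le> mi_order s \<Longrightarrow> mi_order s \<le> k \<Longrightarrow> \<bar>A c s x\<bar> \<le> \<bar>B c s x\<bar>"
  shows "fdb_gauge k A x \<le> fdb_gauge k B x"
  unfolding fdb_gauge_def using assms by (intro sum_mono) (auto intro!: powr_mono2)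

text \<open>Coefficients are bounded, a derivative of order \<open>j\<close> is at most the
  \<open>j\<close>-th power of its own summand in the gauge, and degrees add up in products.
  \<open>K\<close> comes before \<open>A\<close> and \<open>x\<close>; the passage to the limit
  along a sequence of families relies on this.\<close>

lemma fdb_op_bound:
  assumes S: "smooth_class S"
  shows "fdb_op S j T \<Longrightarrow> j \<le> k \<Longrightarrow> \<exists>K\<ge>0. \<forall>A x. \<bar>T A x\<bar> \<le> K * fdb_gauge k A x ^ j"
proof (induction rule: fdb_op.induct)
  case (base \<beta>)
  then obtain B where B: "\<And>z. \<bar>\<beta> z\<bar> \<le> B" using S unfolding smooth_class_def by blast
  then have "0 \<le> B" using abs_ge_zero order_trans by blast
  with B show ?case by (intro exI[of _ B]) auto
next
  case (deriv s c)
  have "\<bar>A c s x\<bar> \<le> 1 * fdb_gauge k A x ^ mi_order s" for A :: "'a deriv_family" and x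
  proof -
    have "\<bar>A c s x\<bar> = (\<bar>A c s x\<bar> powr (1 / real (mi_order s))) ^ mi_order s"
      using deriv by (cases "A c s x = 0") (auto simp: powr_power)
    also have "\<dots> \<le> fdb_gauge k A x ^ mi_order s"
      using deriv by (intro power_mono gauge_ge) auto
    finally show ?thesis by simp
  qed
  then show ?case by (intro exI[of _ 1]) auto
next
  case (mult i T1 j T2)
  then obtain K1 K2 where K: "0 \<le> K1" "\<And>A x. \<bar>T1 A x\<bar> \<le> K1 * fdb_gauge k A x ^ i" "0 \<le> K2" "\<And>A x. \<bar>T2 A x\<bar> \<le> K2 * fdb_gauge k A x ^ j"
    by force
  have "\<bar>T1 A x * T2 A x\<bar> \<le> (K1 * K2) * fdb_gauge k A x ^ (i + j)" for A x
  proof -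
    have "\<bar>T1 A x * T2 A x\<bar> \<le> (K1 * fdb_gauge k A x ^ i) * (K2 * fdb_gauge k A x ^ j)"
      unfolding abs_mult using K gauge_nonneg[of k A x] by (intro mult_mono) auto
    then show ?thesis by (simp add: power_add mult_ac)
  qed
  then show ?case using K by (intro exI[of _ "K1 * K2"]) auto
next
  case (add j T1 T2)
  then obtain K1 K2 where K: "0 \<le> K1" "\<And>A x. \<bar>T1 A x\<bar> \<le> K1 * fdb_gauge k A x ^ j" "0 \<le> K2" "\<And>A x. \<bar>T2 A x\<bar> \<le> K2 * fdb_gauge k A x ^ j"
    by force
  have "\<bar>T1 A x + T2 A x\<bar> \<le> (K1 + K2) * fdb_gauge k A x ^ j" for A x
    using K(2)[of A x] K(4)[of A x] by (simp add: ring_distribs)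
  then show ?case using K by (intro exI[of _ "K1 + K2"]) auto
qed

lemma fdb_op_borel:
  assumes S: "smooth_class S" and A: "\<And>c s. mi_order s \<le> k \<Longrightarrow> A c s \<in> borel_measurable borel"
  shows "fdb_op S j T \<Longrightarrow> j \<le> k \<Longrightarrow> T A \<in> borel_measurable borel"
proof (induction rule: fdb_op.induct)
  case (base \<beta>)
  have [measurable]: "\<beta> \<in> borel_measurable borel"
    by (rule borel_measurable_continuous_onI[OF smooth_class_continuous[OF S base(1)]])
  have [measurable]: "A c (\<lambda>_. 0) \<in> borel_measurable borel" for c using A by simp
  show ?case by measurable
qed (use A in auto)

lemma fdb_op_tendsto:
  assumes S: "smooth_class S" and A: "\<And>c s. mi_order s \<le> k \<Longrightarrow> (\<lambda>n. A n c s x) \<longlonglongrightarrow> B c s x"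
  shows "fdb_op S j T \<Longrightarrow> j \<le> k \<Longrightarrow> (\<lambda>n. T (A n) x) \<longlonglongrightarrow> T B x"
proof (induction rule: fdb_op.induct)
  case (base \<beta>)
  have "isCont \<beta> z" for z
    using smooth_class_continuous[OF S base(1), of UNIV] continuous_on_eq_continuous_at[OF open_UNIV] by blast
  then show ?case
    by (rule isCont_tendsto_compose) (intro tendsto_Pair A, auto)
next
  case (deriv s c)
  then show ?case by (intro A)
qed (auto intro!: tendsto_add tendsto_mult)

text \<open>What the Sobolev argument takes from the measure: Lebesgue null sets are null, and
  integrability implies local integrability with respect to Lebesgue measure. The latter gives
  access to increments along lines, which know nothing of the weight.\<close>

locale sobolev_measure = finite_measure \<mu> for \<mu> :: "(real^'n::finite) measure" +
  fixes k :: nat and \<Lambda> :: "nat \<Rightarrow> real"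
  assumes sets_mu: "sets \<mu> = sets lebesgue"
    and AE_mu: "\<And>P. AE x in lborel. P x \<Longrightarrow> AE x in \<mu>. P x"
    and locint_mu: "\<And>f. f \<in> borel_measurable borel \<Longrightarrow> integrable \<mu> f \<Longrightarrow> borel_locint f"
    and k: "1 \<le> k" and Lambda_0: "\<Lambda> 1 \<le> \<Lambda> 0" and Lambda_1: "real k \<le> \<Lambda> 1"
    and Lambda_j: "\<And>j. 1 \<le> j \<Longrightarrow> j \<le> k \<Longrightarrow> \<Lambda> j = \<Lambda> 1 / real j"
begin

text \<open>Here \<open>real k \<le> \<Lambda> 1\<close> enters. With exponents at least 1 every
  derivative up to order \<open>k\<close> is locally integrable.\<close>

lemma Lambda_ge_1:
  assumes "j \<le> k" shows "1 \<le> \<Lambda> j"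
proof (cases "j = 0")
  case True
  then show ?thesis using Lambda_0 Lambda_1 k by simp
next
  case False
  then have "real j \<le> \<Lambda> 1" using assms Lambda_1 by simp
  then show ?thesis using False assms Lambda_j[of j] by simp
qed

lemma borel_imp_mu: "f \<in> borel_measurable borel \<Longrightarrow> f \<in> borel_measurable \<mu>"
  unfolding measurable_cong_sets[OF sets_mu refl] by (rule measurable_completion) simp

text \<open>Derivatives are linked to those of the next order by \<open>line_deriv\<close>, not to
  the original function, so that a term of the formula of Faa di Bruno can be differentiated factor
  by factor.\<close>

definition good_family :: "'n deriv_family \<Rightarrow> bool" where
  "good_family A \<longleftrightarrow> (\<forall>c s. mi_order s \<le> k \<longrightarrow> A c s \<in> borel_measurable borel \<and>
       integrable \<mu> (\<lambda>x. \<bar>A c s x\<bar> powr \<Lambda> (mi_order s))) \<and>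
     (\<forall>c s i. mi_order s < k \<longrightarrow> line_deriv (axis i 1) (A c s) (A c (s(i := Suc (s i)))))"

text \<open>Formulated for \<open>\<mu>\<close>-measurable families because it is also applied to
  the majorant of a sequence, which is not given as a Borel function.\<close>

lemma integrable_gauge:
  assumes A: "\<And>c s. mi_order s \<le> k \<Longrightarrow> A c s \<in> borel_measurable \<mu>"
    "\<And>c s. mi_order s \<le> k \<Longrightarrow> integrable \<mu> (\<lambda>x. \<bar>A c s x\<bar> powr \<Lambda> (mi_order s))"
  shows "integrable \<mu> (\<lambda>x. fdb_gauge k A x powr \<Lambda> 1)"
proof (rule Bochner_Integration.integrable_bound)
  let ?I = "UNIV \<times> {s :: 'n \<Rightarrow> nat. 1 \<le> mi_order s \<and> mi_order s \<le> k} :: (bool \<times> _) set"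
  let ?f = "\<lambda>(c, s) x. \<bar>A c s x\<bar> powr (1 / real (mi_order s))"
  have [measurable]: "A c s \<in> borel_measurable \<mu>" if "mi_order s \<le> k" for c s
    using A that by blast
  \<comment> \<open>This is the relation \<open>\<Lambda> j = \<Lambda> 1 / j\<close>: the root
    taken in the gauge turns the exponent \<open>\<Lambda> 1\<close> into
    \<open>\<Lambda> (mi_order s)\<close>.\<close>
  have pow: "?f p x powr \<Lambda> 1 = \<bar>A (fst p) (snd p) x\<bar> powr \<Lambda> (mi_order (snd p))" if "p \<in> ?I" for p x
    using that Lambda_j[of "mi_order (snd p)"] by (auto simp: powr_powr)
  show "integrable \<mu> (\<lambda>x. real (card ?I) powr \<Lambda> 1 * (\<Sum>p\<in>?I. \<bar>A (fst p) (snd p) x\<bar> powr \<Lambda> (mi_order (snd p))))"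
    by (intro integrable_mult_right Bochner_Integration.integrable_sum A) auto
  have "(\<lambda>x. fdb_gauge k A x) \<in> borel_measurable \<mu>"
    unfolding fdb_gauge_def by (intro borel_measurable_sum) (auto intro!: powr_real_measurable borel_measurable_abs)
  then show "(\<lambda>x. fdb_gauge k A x powr \<Lambda> 1) \<in> borel_measurable \<mu>" by simp
  have "fdb_gauge k A x powr \<Lambda> 1 \<le> real (card ?I) powr \<Lambda> 1 * (\<Sum>p\<in>?I. \<bar>A (fst p) (snd p) x\<bar> powr \<Lambda> (mi_order (snd p)))" for x
  proof -
    have "(\<Sum>p\<in>?I. ?f p x) powr \<Lambda> 1 \<le> real (card ?I) powr \<Lambda> 1 * (\<Sum>p\<in>?I. ?f p x powr \<Lambda> 1)"
      using Lambda_ge_1[of 1] k by (intro sum_powr_le) auto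
    also have "(\<Sum>p\<in>?I. ?f p x powr \<Lambda> 1) = (\<Sum>p\<in>?I. \<bar>A (fst p) (snd p) x\<bar> powr \<Lambda> (mi_order (snd p)))"
      by (rule sum.cong[OF refl pow])
    finally show ?thesis by (simp add: fdb_gauge_def case_prod_unfold)
  qed
  then show "AE x in \<mu>. norm (fdb_gauge k A x powr \<Lambda> 1) \<le> norm (real (card ?I) powr \<Lambda> 1 * (\<Sum>p\<in>?I. \<bar>A (fst p) (snd p) x\<bar> powr \<Lambda> (mi_order (snd p))))"
    by (intro AE_I2) (simp add: abs_of_nonneg sum_nonneg)
qed

text \<open>The power \<open>j\<close> of the gauge cancels against the denominator of
  \<open>\<Lambda> j = \<Lambda> 1 / j\<close>, so the right-hand side no longer depends on the
  order apart from \<open>K\<close>. This takes the place of Hoelder's inequality for products of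
  derivatives.\<close>

lemma fdb_op_powr_bound:
  assumes S: "smooth_class S" and T: "fdb_op S j T" and j: "1 \<le> j" "j \<le> k"
  obtains K where "0 \<le> K" "\<And>A x. \<bar>T A x\<bar> powr \<Lambda> j \<le> K * fdb_gauge k A x powr \<Lambda> 1"
proof -
  obtain K where K: "0 \<le> K" "\<And>A x. \<bar>T A x\<bar> \<le> K * fdb_gauge k A x ^ j" using fdb_op_bound[OF S T j(2)] by blast
  have "\<bar>T A x\<bar> powr \<Lambda> j \<le> K powr \<Lambda> j * fdb_gauge k A x powr \<Lambda> 1" for A x
  proof -
    have g: "(fdb_gauge k A x ^ j) powr \<Lambda> j = fdb_gauge k A x powr \<Lambda> 1"
    proof (cases "fdb_gauge k A x = 0")
      case False
      then have "0 < fdb_gauge k A x" using gauge_nonneg[of k A x] by simp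
      then show ?thesis using Lambda_j[OF j] j by (simp add: powr_realpow[symmetric] powr_powr)
    qed (use j in simp)
    have "\<bar>T A x\<bar> powr \<Lambda> j \<le> (K * fdb_gauge k A x ^ j) powr \<Lambda> j"
      using K(2) Lambda_ge_1[OF j(2)] by (intro powr_mono2) auto
    also have "\<dots> = K powr \<Lambda> j * fdb_gauge k A x powr \<Lambda> 1"
      using K(1) gauge_nonneg[of k A x] by (simp add: powr_mult g)
    finally show ?thesis .
  qed
  then show ?thesis using that[of "K powr \<Lambda> j"] by simp
qed

lemma fdb_op_Lp:
  assumes S: "smooth_class S" and T: "fdb_op S j T" and j: "1 \<le> j" "j \<le> k" and A: "good_family A"
  shows "integrable \<mu> (\<lambda>x. \<bar>T A x\<bar> powr \<Lambda> j)"
proof -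
  obtain K where K: "0 \<le> K" "\<And>A x. \<bar>T A x\<bar> powr \<Lambda> j \<le> K * fdb_gauge k A x powr \<Lambda> 1"
    using fdb_op_powr_bound[OF S T j] by blast
  have T': "T A \<in> borel_measurable \<mu>"
    using A by (intro borel_imp_mu fdb_op_borel[OF S _ T j(2)]) (auto simp: good_family_def)
  show ?thesis
  proof (rule Bochner_Integration.integrable_bound)
    show "integrable \<mu> (\<lambda>x. K * fdb_gauge k A x powr \<Lambda> 1)"
      using A by (intro integrable_mult_right integrable_gauge) (auto simp: good_family_def borel_imp_mu)
    show "(\<lambda>x. \<bar>T A x\<bar> powr \<Lambda> j) \<in> borel_measurable \<mu>" using T' by simp
    show "AE x in \<mu>. norm (\<bar>T A x\<bar> powr \<Lambda> j) \<le> norm (K * fdb_gauge k A x powr \<Lambda> 1)"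
      using K(2) by (intro AE_I2) (auto intro: order_trans[OF _ abs_ge_self])
  qed
qed

text \<open>The measure is finite and \<open>y \<le> 1 + y powr p\<close> for nonnegative
  \<open>y\<close>, which reduces the claim to exponent 1.\<close>

lemma locint_of_Lp:
  assumes f: "f \<in> borel_measurable borel" and p: "1 \<le> p" and i: "integrable \<mu> (\<lambda>x. \<bar>f x\<bar> powr p)"
  shows "borel_locint f"
proof (rule locint_mu[OF f], rule Bochner_Integration.integrable_bound)
  show "integrable \<mu> (\<lambda>x. 1 + \<bar>f x\<bar> powr p)" using i by simp
  show "f \<in> borel_measurable \<mu>" by (rule borel_imp_mu[OF f])
  show "AE x in \<mu>. norm (f x) \<le> norm (1 + \<bar>f x\<bar> powr p)"
  proof (rule AE_I2)
    fix x
    show "norm (f x) \<le> norm (1 + \<bar>f x\<bar> powr p)"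
      using powr_le_one_plus[of "\<bar>f x\<bar>" 1 p] p by simp
  qed
qed

lemma fdb_op_locint:
  assumes S: "smooth_class S" and T: "fdb_op S j T" and j: "j \<le> k" and A: "good_family A"
  shows "borel_locint (T A)"
proof -
  have T': "T A \<in> borel_measurable borel"
    using A by (intro fdb_op_borel[OF S _ T j]) (auto simp: good_family_def)
  show ?thesis
  proof (cases "j = 0")
    \<comment> \<open>Terms of order 0 are bounded, hence integrable for a finite measure; the
      exponent relation starts at order 1.\<close>
    case True
    then obtain K where "\<And>A x. \<bar>T A x\<bar> \<le> K" using fdb_op_bound[OF S T j] by auto
    then show ?thesis
      by (intro locint_mu T' integrable_const_bound[of _ K] borel_imp_mu) auto
  next
    case False
    then show ?thesis using locint_of_Lp[OF T' Lambda_ge_1[OF j] fdb_op_Lp[OF S T _ j A]] by simp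
  qed
qed

lemma good_family_line_deriv:
  "good_family A \<Longrightarrow> mi_order s < k \<Longrightarrow> line_deriv (axis i 1) (A c s) (A c (s(i := Suc (s i))))"
  by (simp add: good_family_def)

text \<open>\<Phi> may be unbounded and lie outside \<open>S\<close>. Its first derivative is
  already a term of order 1 with coefficients in \<open>S\<close>, and later differentiations stay
  within \<open>fdb_op\<close>.\<close>

lemma line_deriv_superposition:
  assumes S: "smooth_class S" and D: "D1 \<in> S" "D2 \<in> S"
    and \<Phi>: "\<And>z. (\<Phi> has_derivative (\<lambda>k. fst k * D1 z + snd k * D2 z)) (at z)"
  obtains T where "fdb_op S 1 T"
    "\<And>A. good_family A \<Longrightarrow> borel_locint (\<lambda>x. \<Phi> (A False (\<lambda>_. 0) x, A True (\<lambda>_. 0) x)) \<Longrightarrow>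
       line_deriv (axis i 1) (\<lambda>x. \<Phi> (A False (\<lambda>_. 0) x, A True (\<lambda>_. 0) x)) (T A)"
proof -
  let ?o = "\<lambda>_. 0 :: nat" and ?s = "(\<lambda>_. 0 :: nat)(i := Suc 0)"
  let ?T = "\<lambda>A x. D1 (A False ?o x, A True ?o x) * A False ?s x + D2 (A False ?o x, A True ?o x) * A True ?s x"
  have s: "mi_order ?s = 1" using mi_order_add_one[of ?o i] by simp
  have "fdb_op S (0 + mi_order ?s) ?T"
    using D s by (intro fdb_op.add fdb_op.mult fdb_op.base fdb_op.deriv) auto
  then have T: "fdb_op S 1 ?T" using s by simp
  moreover have "line_deriv (axis i 1) (\<lambda>x. \<Phi> (A False ?o x, A True ?o x)) (?T A)"
    if A: "good_family A" "borel_locint (\<lambda>x. \<Phi> (A False ?o x, A True ?o x))" for A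
  proof (rule line_deriv_chain[OF _ _ \<Phi>])
    show "line_deriv (axis i 1) (A False ?o) (A False ?s)" "line_deriv (axis i 1) (A True ?o) (A True ?s)"
      using good_family_line_deriv[OF A(1), of ?o] k by auto
    show "continuous_on UNIV D1" "continuous_on UNIV D2"
      using smooth_class_continuous[OF S] D by auto
    show "borel_locint (?T A)" using fdb_op_locint[OF S T _ A(1)] k by simp
  qed (rule A)
  ultimately show ?thesis using that by blast
qed

text \<open>Each differentiation raises the order by one, and \<open>j < k\<close> keeps the result
  in the range where terms are locally integrable, as the product rule requires.\<close>

lemma fdb_op_line_deriv:
  assumes S: "smooth_class S"
  shows "fdb_op S j T \<Longrightarrow> j < k \<Longrightarrow>
    \<exists>T'. fdb_op S (Suc j) T' \<and> (\<forall>A. good_family A \<longrightarrow> line_deriv (axis i 1) (T A) (T' A))"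
proof (induction rule: fdb_op.induct)
  case (base \<beta>)
  have "\<exists>\<beta>1\<in>S. \<exists>\<beta>2\<in>S. \<forall>z. (\<beta> has_derivative (\<lambda>k. fst k * \<beta>1 z + snd k * \<beta>2 z)) (at z)"
    using S base unfolding smooth_class_def by blast
  then obtain \<beta>1 \<beta>2 where \<beta>: "\<beta>1 \<in> S" "\<beta>2 \<in> S" "\<And>z. (\<beta> has_derivative (\<lambda>k. fst k * \<beta>1 z + snd k * \<beta>2 z)) (at z)"
    by blast
  obtain T where T: "fdb_op S 1 T"
    "\<And>A. good_family A \<Longrightarrow> borel_locint (\<lambda>x. \<beta> (A False (\<lambda>_. 0) x, A True (\<lambda>_. 0) x)) \<Longrightarrow>
       line_deriv (axis i 1) (\<lambda>x. \<beta> (A False (\<lambda>_. 0) x, A True (\<lambda>_. 0) x)) (T A)"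
    using line_deriv_superposition[OF S \<beta>] by blast
  moreover have "borel_locint (\<lambda>x. \<beta> (A False (\<lambda>_. 0) x, A True (\<lambda>_. 0) x))" if "good_family A" for A
    using fdb_op_locint[OF S fdb_op.base[OF base(1)] _ that] by simp
  ultimately show ?case by auto
next
  case (deriv s c)
  show ?case
  proof (intro exI conjI allI impI)
    show "fdb_op S (Suc (mi_order s)) (\<lambda>A. A c (s(i := Suc (s i))))"
      using fdb_op.deriv[of "s(i := Suc (s i))" S c] by simp
    show "line_deriv (axis i 1) (A c s) (A c (s(i := Suc (s i))))" if "good_family A" for A
      using good_family_line_deriv[OF that] deriv by simp
  qed
next
  case (mult l T1 j T2)
  then obtain T1' T2' where T': "fdb_op S (Suc l) T1'" "\<And>A. good_family A \<Longrightarrow> line_deriv (axis i 1) (T1 A) (T1' A)"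
    "fdb_op S (Suc j) T2'" "\<And>A. good_family A \<Longrightarrow> line_deriv (axis i 1) (T2 A) (T2' A)" by force
  let ?T = "\<lambda>A x. T2 A x * T1' A x + T1 A x * T2' A x"
  have T: "fdb_op S (Suc (l + j)) ?T"
  proof (rule fdb_op.add)
    show "fdb_op S (Suc (l + j)) (\<lambda>A x. T2 A x * T1' A x)" using fdb_op.mult[OF mult(2) T'(1)] by (simp add: add.commute)
    show "fdb_op S (Suc (l + j)) (\<lambda>A x. T1 A x * T2' A x)" using fdb_op.mult[OF mult(1) T'(3)] by simp
  qed
  show ?case
  proof (intro exI conjI allI impI)
    show "fdb_op S (Suc (l + j)) ?T" by (rule T)
    show "line_deriv (axis i 1) (\<lambda>x. T1 A x * T2 A x) (?T A)" if A: "good_family A" for A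
      using fdb_op_locint[OF S T _ A] fdb_op_locint[OF S fdb_op.mult[OF mult(1,2)] _ A] mult.prems
      by (intro line_deriv_mult T' A) auto
  qed
next
  case (add j T1 T2)
  then obtain T1' T2' where T': "fdb_op S (Suc j) T1'" "\<And>A. good_family A \<Longrightarrow> line_deriv (axis i 1) (T1 A) (T1' A)"
    "fdb_op S (Suc j) T2'" "\<And>A. good_family A \<Longrightarrow> line_deriv (axis i 1) (T2 A) (T2' A)" by force
  show ?case
    using fdb_op.add[OF T'(1,3)] line_deriv_add[OF T'(2,4)] by (intro exI conjI allI impI)
qed

text \<open>The head of the list is the derivative that \<open>foldr\<close> applies last, so it is
  moved off first; what it acts on is still a test function.\<close>

lemma fdb_op_iterated:
  assumes S: "smooth_class S"
  shows "fdb_op S j T \<Longrightarrow> j + length L \<le> k \<Longrightarrow> \<exists>T'. fdb_op S (j + length L) T' \<and>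
    (\<forall>A \<phi>. good_family A \<longrightarrow> test_fun \<phi> \<longrightarrow>
      (\<integral>x. T A x * foldr partial_deriv L \<phi> x \<partial>lborel) = (- 1) ^ length L * (\<integral>x. T' A x * \<phi> x \<partial>lborel))"
proof (induction L arbitrary: j T)
  case Nil
  then show ?case by auto
next
  case (Cons i L)
  obtain T1 where T1: "fdb_op S (Suc j) T1" "\<And>A. good_family A \<Longrightarrow> line_deriv (axis i 1) (T A) (T1 A)"
    using fdb_op_line_deriv[OF S Cons.prems(1), of i] Cons.prems(2) by auto
  obtain T' where T': "fdb_op S (Suc j + length L) T'" "\<And>A \<phi>. good_family A \<Longrightarrow> test_fun \<phi> \<Longrightarrow>
      (\<integral>x. T1 A x * foldr partial_deriv L \<phi> x \<partial>lborel) = (- 1) ^ length L * (\<integral>x. T' A x * \<phi> x \<partial>lborel)"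
    using Cons.IH[OF T1(1)] Cons.prems(2) by auto
  show ?case
  proof (intro exI conjI allI impI)
    show "fdb_op S (j + length (i # L)) T'" using T'(1) by simp
    fix A and \<phi> :: "real^'n \<Rightarrow> real" assume A: "good_family A" and \<phi>: "test_fun \<phi>"
    show "(\<integral>x. T A x * foldr partial_deriv (i # L) \<phi> x \<partial>lborel) = (- 1) ^ length (i # L) * (\<integral>x. T' A x * \<phi> x \<partial>lborel)"
      using weak_of_line_deriv[OF T1(2)[OF A] test_fun_foldr_partial_deriv[OF \<phi>, of L]] T'(2)[OF A \<phi>] by simp
  qed
qed

text \<open>The first integration by parts leads from \<Phi> into \<open>fdb_op\<close> at order 1,
  the others are \<open>fdb_op_iterated\<close>. The condition \<open>1 \<le> mi_order s\<close>
  makes the list of coordinates nonempty.\<close>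

lemma superposition_weak_deriv:
  assumes S: "smooth_class S" and D: "D1 \<in> S" "D2 \<in> S"
    and \<Phi>: "\<And>z. (\<Phi> has_derivative (\<lambda>k. fst k * D1 z + snd k * D2 z)) (at z)"
    and s: "1 \<le> mi_order s" "mi_order s \<le> k"
  obtains T where "fdb_op S (mi_order s) T"
    "\<And>A \<phi>. good_family A \<Longrightarrow> borel_locint (\<lambda>x. \<Phi> (A False (\<lambda>_. 0) x, A True (\<lambda>_. 0) x)) \<Longrightarrow> test_fun \<phi> \<Longrightarrow>
      (\<integral>x. \<Phi> (A False (\<lambda>_. 0) x, A True (\<lambda>_. 0) x) * multi_partial s \<phi> x \<partial>lborel)
      = (- 1) ^ mi_order s * (\<integral>x. T A x * \<phi> x \<partial>lborel)"
proof -
  obtain L where L: "length L = mi_order s" "\<And>f. multi_partial s f = foldr partial_deriv L f"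
    using multi_partial_as_foldr[of s] by blast
  then obtain i L' where iL: "L = i # L'" using s by (cases L) auto
  obtain T1 where T1: "fdb_op S 1 T1"
    "\<And>A. good_family A \<Longrightarrow> borel_locint (\<lambda>x. \<Phi> (A False (\<lambda>_. 0) x, A True (\<lambda>_. 0) x)) \<Longrightarrow>
       line_deriv (axis i 1) (\<lambda>x. \<Phi> (A False (\<lambda>_. 0) x, A True (\<lambda>_. 0) x)) (T1 A)"
    using line_deriv_superposition[OF S D \<Phi>] by blast
  obtain T where T: "fdb_op S (1 + length L') T" "\<And>A \<phi>. good_family A \<Longrightarrow> test_fun \<phi> \<Longrightarrow>
      (\<integral>x. T1 A x * foldr partial_deriv L' \<phi> x \<partial>lborel) = (- 1) ^ length L' * (\<integral>x. T A x * \<phi> x \<partial>lborel)"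
    using fdb_op_iterated[OF S T1(1), of L'] L s iL by auto
  show ?thesis
  proof (rule that)
    show "fdb_op S (mi_order s) T" using T(1) L(1) iL by simp
    fix A and \<phi> :: "real^'n \<Rightarrow> real" assume A: "good_family A" "borel_locint (\<lambda>x. \<Phi> (A False (\<lambda>_. 0) x, A True (\<lambda>_. 0) x))" and \<phi>: "test_fun \<phi>"
    show "(\<integral>x. \<Phi> (A False (\<lambda>_. 0) x, A True (\<lambda>_. 0) x) * multi_partial s \<phi> x \<partial>lborel)
      = (- 1) ^ mi_order s * (\<integral>x. T A x * \<phi> x \<partial>lborel)"
      using weak_of_line_deriv[OF T1(2)[OF A] test_fun_foldr_partial_deriv[OF \<phi>, of L']] T(2)[OF A(1) \<phi>] L iL
      by (simp flip: L(1))
  qed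
qed

end

section \<open>The reference measure\<close>

lemma borel_measurable_theta_abs:
  assumes "strict_mono_on {0..} \<theta>"
  shows "(\<lambda>z::real. \<theta> \<bar>z\<bar> :: real) \<in> borel_measurable borel"
proof -
  \<comment> \<open>\<theta> is arbitrary on the negative axis; freezing it there at its value at 0
    gives a function that is monotone, hence Borel, on the whole line.\<close>
  have "mono (\<lambda>z. \<theta> (max z 0))"
    by (intro monoI strict_mono_on_leD[OF assms]) auto
  then have "(\<lambda>z. \<theta> (max z 0)) \<in> borel_measurable borel" by (rule borel_measurable_mono)
  from measurable_compose[OF borel_measurable_abs[OF measurable_ident_sets[OF refl]] this]
  show ?thesis by simp
qed

lemma prod_Basis_vec: "(\<Prod>b\<in>(Basis :: (real^'n::finite) set). g (x \<bullet> b)) = (\<Prod>i\<in>UNIV. g (x $ i))"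
proof -
  have B: "Basis = (\<lambda>i. axis i 1 :: real^'n) ` UNIV" by (auto simp: Basis_vec_def)
  have inj: "inj (\<lambda>i. axis i 1 :: real^'n)" by (auto simp: inj_on_def axis_eq_axis)
  show ?thesis unfolding B by (subst prod.reindex[OF inj]) (simp add: inner_axis)
qed

text \<open>The density is a product over the coordinates, so the total mass is a power of the
  one-dimensional mass 1. On each ball the density has a positive lower bound, which yields local
  integrability.\<close>

lemma sobolev_measure_ref_measure:
  fixes \<mu> :: "(real^'n::finite) measure"
  assumes theta: "admissible_theta t \<theta>"
    and C: "(\<integral>z. exp (C - \<theta> \<bar>z\<bar>) \<partial>lebesgue) = 1"
    and mu: "\<mu> = ref_measure \<theta> C"
    and k: "k \<ge> 1"
    and Lambda_0: "\<Lambda> 0 \<ge> \<Lambda> 1"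
    and Lambda_1: "\<Lambda> 1 \<ge> real k"
    and Lambda_j: "\<forall>j. 2 \<le> j \<and> j \<le> k \<longrightarrow> \<Lambda> j = \<Lambda> 1 / real j"
  shows "sobolev_measure \<mu> k \<Lambda>"
proof -
  have sm: "strict_mono_on {0..} \<theta>" using theta by (simp add: admissible_theta_def)
  note [measurable] = borel_measurable_theta_abs[OF sm]
  define r where "r x = exp (ref_log_density \<theta> C x)" for x :: "real^'n"
  have r[measurable]: "r \<in> borel_measurable borel"
    unfolding r_def ref_log_density_def by measurable
  have mu': "\<mu> = density lebesgue (\<lambda>x. ennreal (r x))" by (simp add: mu ref_measure_def r_def)
  \<comment> \<open>The Bochner integral of a function that is not integrable is 0, so the value 1
    certifies integrability.\<close>
  have "integrable lebesgue (\<lambda>z. exp (C - \<theta> \<bar>z\<bar>))"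
    using C not_integrable_integral_eq by fastforce
  then have "(\<integral>\<^sup>+z. ennreal (exp (C - \<theta> \<bar>z\<bar>)) \<partial>lebesgue) = 1"
    using C by (subst nn_integral_eq_integral) auto
  then have one: "(\<integral>\<^sup>+z. ennreal (exp (C - \<theta> \<bar>z\<bar>)) \<partial>lborel) = 1"
    by (simp add: nn_integral_completion)
  have "emeasure \<mu> (space \<mu>) = (\<integral>\<^sup>+x. ennreal (r x) \<partial>lborel)"
    unfolding mu' by (subst emeasure_density) (auto simp: nn_integral_completion measurable_completion)
  also have "\<dots> = (\<integral>\<^sup>+x. (\<Prod>b\<in>Basis. ennreal (exp (C - \<theta> \<bar>x \<bullet> b\<bar>))) \<partial>(lborel :: (real^'n) measure))"
    by (intro nn_integral_cong)
      (simp add: r_def ref_log_density_def exp_sum prod_ennreal prod_Basis_vec[of "\<lambda>z. exp (C - \<theta> \<bar>z\<bar>)"])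
  also have "\<dots> = 1"
    by (subst nn_integral_lborel_prod) (auto simp: one)
  finally have fin: "finite_measure \<mu>" by (intro finite_measureI) simp
  have pos: "0 < r x" for x by (simp add: r_def)
  have "borel_locint f" if [measurable]: "f \<in> borel_measurable borel" and f: "integrable \<mu> f" for f :: "real^'n \<Rightarrow> real"
  proof (rule borel_locintI[OF that(1)])
    fix R :: real
    have "integrable lebesgue (\<lambda>x. r x *\<^sub>R f x)"
      using f pos unfolding mu' 
      by (subst (asm) integrable_density) (auto simp: measurable_completion less_imp_le)
    then have i: "integrable lborel (\<lambda>x. r x * f x)"
      by (subst (asm) integrable_completion) auto
    \<comment> \<open>On the ball of radius \<open>R\<close> every coordinate is at most
      \<open>R\<close> in absolute value, so each of the \<open>CARD('n)\<close> summands of the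
      exponent is at least \<open>C - \<theta> R\<close>.\<close>
    define c where "c = exp (real CARD('n) * (C - \<theta> R))"
    have c: "c \<le> r x" if x: "x \<in> cball 0 R" for x
    proof -
      have "\<theta> \<bar>x $ i\<bar> \<le> \<theta> R" for i
        using x component_le_norm_cart[of x i]
        by (intro strict_mono_on_leD[OF sm]) auto
      then have "(\<Sum>i\<in>(UNIV::'n set). C - \<theta> R) \<le> (\<Sum>i\<in>UNIV. C - \<theta> \<bar>x $ i\<bar>)" by (intro sum_mono) auto
      then show ?thesis by (simp add: c_def r_def ref_log_density_def)
    qed
    have c0: "0 < c" by (simp add: c_def)
    show "set_integrable lborel (cball 0 R) f"
      unfolding set_integrable_def
    proof (rule Bochner_Integration.integrable_bound)
      show "integrable lborel (\<lambda>x. inverse c * (r x * f x))" by (intro integrable_mult_right i)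
      have "\<bar>indicator (cball 0 R) x *\<^sub>R f x\<bar> \<le> \<bar>inverse c * (r x * f x)\<bar>" for x
      proof (cases "x \<in> cball 0 R")
        case True
        have "c * \<bar>f x\<bar> \<le> r x * \<bar>f x\<bar>" using c[OF True] by (intro mult_right_mono) auto
        then show ?thesis using True c0 pos[of x] by (simp add: abs_mult field_simps)
      qed simp
      then show "AE x in lborel. norm (indicator (cball 0 R) x *\<^sub>R f x) \<le> norm (inverse c * (r x * f x))" by simp
      show "(\<lambda>x. indicator (cball 0 R) x *\<^sub>R f x) \<in> borel_measurable lborel"
        using that(1) by (intro borel_measurable_scaleR borel_measurable_indicator) auto
    qed
  qed
  moreover have "AE x in \<mu>. P x" if "AE x in lborel. P x" for P
    unfolding mu' using AE_completion[OF that] by (subst AE_density) (auto simp: measurable_completion)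
  moreover have "\<Lambda> j = \<Lambda> 1 / real j" if "1 \<le> j" "j \<le> k" for j
    using that Lambda_j by (cases "j = 1") auto
  moreover have "sets \<mu> = sets lebesgue" by (simp add: mu')
  ultimately show ?thesis
    by (intro sobolev_measure.intro sobolev_measure_axioms.intro fin k Lambda_0 Lambda_1)
qed

section \<open>The deformed exponential\<close>

lemma psi_pos [simp]: "0 < psi y"
  and log_d_psi [simp]: "log_d (psi y) = y"
proof -
  have "y \<in> log_d ` {0<..}" using bij_betw_log_d by (simp add: bij_betw_def)
  then show "0 < psi y" "log_d (psi y) = y"
    using inv_into_into[of y log_d "{0<..}"] f_inv_into_f[of y log_d "{0<..}"] by (auto simp: psi_def)
qed

lemma psi_log_d [simp]: "0 < x \<Longrightarrow> psi (log_d x) = x"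
  using bij_betw_log_d by (simp add: psi_def bij_betw_def inv_into_f_f)

text \<open>In \<open>log_d y = y - 1 + ln y\<close> the logarithm contributes an increment of the
  same sign, so \<open>log_d\<close> expands distances and its inverse contracts them. Besides the
  continuity of \<open>psi\<close>, this gives the order 0 part of the continuity of the
  operator.\<close>

lemma psi_lipschitz: "\<bar>psi x - psi y\<bar> \<le> \<bar>x - y\<bar>"
proof -
  have "psi a - psi b \<le> a - b" if "psi b \<le> psi a" for a b
  proof -
    have "ln (psi b) \<le> ln (psi a)" using that psi_pos[of a] psi_pos[of b] by simp
    moreover have "psi a - 1 + ln (psi a) = a" "psi b - 1 + ln (psi b) = b"
      using log_d_psi by (simp_all add: log_d_def del: log_d_psi)
    ultimately show ?thesis by linarith
  qed
  from this[of x y] this[of y x] show ?thesis by linarith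
qed

text \<open>The factor \<open>1 / (1 + psi x)\<close> is kept apart because it is a generator of
  \<open>mix_class\<close>.\<close>

lemma has_derivative_psi: "(psi has_real_derivative (psi x * (1 / (1 + psi x)))) (at x)"
proof -
  have "isCont psi x"
    unfolding continuous_at_eps_delta dist_real_def
    using psi_lipschitz by (meson le_less_trans)
  moreover have "(log_d has_real_derivative 1 + inverse (psi x)) (at (psi x))"
    unfolding log_d_def by (auto intro!: derivative_eq_intros simp: divide_inverse)
  moreover have "0 < 1 + inverse (psi x)" by (simp add: add_pos_pos)
  ultimately have "(psi has_real_derivative inverse (1 + inverse (psi x))) (at x)"
    by (intro DERIV_inverse_function[where f = log_d and a = "x - 1" and b = "x + 1"]) auto
  moreover have "inverse (1 + inverse (psi x)) = psi x * (1 / (1 + psi x))"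
  proof -
    have "psi x \<noteq> 0" using psi_pos[of x] by linarith
    then have "1 + inverse (psi x) = (1 + psi x) / psi x" by (simp add: field_simps)
    then show ?thesis by simp
  qed
  ultimately show ?thesis by simp
qed

text \<open>The variables \<open>p = u \<psi>(a) / (u \<psi>(a) + v \<psi>(b))\<close>, \<open>1 / (1 + \<psi>(a))\<close> and \<open>1 / (1 + \<psi>(b))\<close> are bounded
  and their partial derivatives are polynomials in the same three variables.\<close>

definition mix :: "real \<Rightarrow> real \<Rightarrow> real \<times> real \<Rightarrow> real" where
  "mix u v z = u * psi (fst z) + v * psi (snd z)"

definition mix_ratio :: "real \<Rightarrow> real \<Rightarrow> real \<times> real \<Rightarrow> real" where
  "mix_ratio u v z = u * psi (fst z) / mix u v z"

inductive_set mix_class :: "real \<Rightarrow> real \<Rightarrow> (real \<times> real \<Rightarrow> real) set" for u v where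
  const: "(\<lambda>_. c) \<in> mix_class u v"
| ratio: "mix_ratio u v \<in> mix_class u v"
| fst: "(\<lambda>z. 1 / (1 + psi (fst z))) \<in> mix_class u v"
| snd: "(\<lambda>z. 1 / (1 + psi (snd z))) \<in> mix_class u v"
| add: "f \<in> mix_class u v \<Longrightarrow> g \<in> mix_class u v \<Longrightarrow> (\<lambda>z. f z + g z) \<in> mix_class u v"
| mult: "f \<in> mix_class u v \<Longrightarrow> g \<in> mix_class u v \<Longrightarrow> (\<lambda>z. f z * g z) \<in> mix_class u v"

lemma one_minus_mix_class: "f \<in> mix_class u v \<Longrightarrow> (\<lambda>z. 1 - f z) \<in> mix_class u v"
  using mix_class.add[OF mix_class.const[of 1] mix_class.mult[OF mix_class.const[of "-1"]]] by simp

lemma uminus_mix_class: "f \<in> mix_class u v \<Longrightarrow> (\<lambda>z. - f z) \<in> mix_class u v"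
  using mix_class.mult[OF mix_class.const[of "-1"]] by simp

lemma has_derivative_psi_fst:
  "((\<lambda>z. psi (fst z)) has_derivative (\<lambda>k. fst k * (psi (fst z) * (1 / (1 + psi (fst z)))))) (at z)"
  using has_derivative_compose[OF has_derivative_fst[OF has_derivative_ident] has_derivative_psi[unfolded has_field_derivative_def]]
  by (simp add: mult.commute)

lemma has_derivative_psi_snd:
  "((\<lambda>z. psi (snd z)) has_derivative (\<lambda>k. snd k * (psi (snd z) * (1 / (1 + psi (snd z)))))) (at z)"
  using has_derivative_compose[OF has_derivative_snd[OF has_derivative_ident] has_derivative_psi[unfolded has_field_derivative_def]]
  by (simp add: mult.commute)

lemma mix_pos:
  assumes "0 \<le> u" "0 \<le> v" "u + v = 1" shows "0 < mix u v z"
proof (cases "u = 0")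
  case True
  then show ?thesis using assms by (simp add: mix_def)
next
  case False
  then have "0 < u * psi (fst z)" using assms by simp
  moreover have "0 \<le> v * psi (snd z)" using assms by (simp add: less_imp_le)
  ultimately show ?thesis by (simp add: mix_def)
qed

lemma has_derivative_mix:
  "(mix u v has_derivative (\<lambda>k. fst k * (u * (psi (fst z) * (1 / (1 + psi (fst z)))))
     + snd k * (v * (psi (snd z) * (1 / (1 + psi (snd z))))))) (at z)"
  unfolding mix_def
  by (rule has_derivative_eq_rhs[OF has_derivative_add[OF
      has_derivative_mult_right[OF has_derivative_psi_fst] has_derivative_mult_right[OF has_derivative_psi_snd]]])
    (simp add: fun_eq_iff algebra_simps)

text \<open>For positive weights the ratio is the logistic function of
  \<open>ln (u * psi a) - ln (v * psi b)\<close>. Hence the factor p (1 - p), times the derivative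
  of \<open>ln (psi a)\<close>, which is \<open>1 / (1 + psi a)\<close>, and likewise for b with the
  opposite sign.\<close>

lemma has_derivative_mix_ratio:
  assumes uv: "0 \<le> u" "0 \<le> v" "u + v = 1"
  shows "(mix_ratio u v has_derivative (\<lambda>k.
      fst k * (mix_ratio u v z * (1 - mix_ratio u v z) * (1 / (1 + psi (fst z))))
    + snd k * (- (mix_ratio u v z * (1 - mix_ratio u v z) * (1 / (1 + psi (snd z))))))) (at z)"
proof -
  define F H W1 W2 Y where "F = psi (fst z)" "H = psi (snd z)" "W1 = 1 / (1 + F)" "W2 = 1 / (1 + H)" "Y = mix u v z"
  note defs = this
  have Y: "0 < Y" using mix_pos[OF uv] by (simp add: defs)
  have YFH: "v * H = Y - u * F" by (simp add: defs mix_def)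
  have "(mix_ratio u v has_derivative (\<lambda>k. - (u * F) * (inverse Y * (fst k * (u * (F * W1)) + snd k * (v * (H * W2))) * inverse Y)
      + u * (fst k * (F * W1)) / Y)) (at z)"
    using has_derivative_divide[OF has_derivative_mult_right[OF has_derivative_psi_fst, of u] has_derivative_mix[of u v z]] Y
    unfolding mix_ratio_def[abs_def] defs by simp
  then show ?thesis
  proof (rule has_derivative_eq_rhs)
    have R: "mix_ratio u v z = u * F / Y" by (simp add: mix_ratio_def defs)
    have e: "1 - u * F / Y = v * H / Y" unfolding YFH using Y by (simp add: field_simps)
    have "- (u * F) * (inverse Y * (a * (u * (F * W1)) + b * (v * (H * W2))) * inverse Y) + u * (a * (F * W1)) / Y
      = a * (u * F / Y * (1 - u * F / Y) * W1) + b * (- (u * F / Y * (v * H / Y) * W2))" for a b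
      using Y by (simp add: field_simps power2_eq_square)
    then show "(\<lambda>k. - (u * F) * (inverse Y * (fst k * (u * (F * W1)) + snd k * (v * (H * W2))) * inverse Y)
      + u * (fst k * (F * W1)) / Y) = (\<lambda>k.
      fst k * (mix_ratio u v z * (1 - mix_ratio u v z) * (1 / (1 + psi (fst z))))
    + snd k * (- (mix_ratio u v z * (1 - mix_ratio u v z) * (1 / (1 + psi (snd z))))))"
      unfolding R e by (simp add: defs fun_eq_iff)
  qed
qed

text \<open>With w = 1 / (1 + g) one has g w = 1 - w, so the derivative - g w^3 becomes the
  polynomial - (1 - w) w^2 in w. The direction \<open>d\<close> is left open to cover both
  coordinates.\<close>

lemma has_derivative_inverse_psi:
  fixes g :: "'a::real_normed_vector \<Rightarrow> real"
  assumes g: "(g has_derivative (\<lambda>k. d k * (g z * (1 / (1 + g z))))) (at z)" and pos: "0 < g z"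
  shows "((\<lambda>z. 1 / (1 + g z)) has_derivative (\<lambda>k. d k * - ((1 - 1 / (1 + g z)) * (1 / (1 + g z)) * (1 / (1 + g z))))) (at z)"
proof -
  have ne: "1 + g z \<noteq> 0" using pos by linarith
  have "((\<lambda>z. 1 / (1 + g z)) has_derivative (\<lambda>k. - 1 * (inverse (1 + g z) * (0 + d k * (g z * (1 / (1 + g z)))) * inverse (1 + g z)) + 0 / (1 + g z))) (at z)"
    by (rule has_derivative_divide[OF has_derivative_const has_derivative_add[OF has_derivative_const g] ne])
  then show ?thesis
    by (rule has_derivative_eq_rhs) (use ne in \<open>simp add: fun_eq_iff field_simps\<close>)
qed

lemma smooth_class_memberI:
  assumes "\<And>z. \<bar>\<beta> z\<bar> \<le> B" "\<beta>1 \<in> S" "\<beta>2 \<in> S"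
    "\<And>z. (\<beta> has_derivative (\<lambda>k. fst k * \<beta>1 z + snd k * \<beta>2 z)) (at z)"
  shows "(\<exists>B. \<forall>z. \<bar>\<beta> z\<bar> \<le> B) \<and>
     (\<exists>\<beta>1\<in>S. \<exists>\<beta>2\<in>S. \<forall>z. (\<beta> has_derivative (\<lambda>k. fst k * \<beta>1 z + snd k * \<beta>2 z)) (at z))"
  using assms by blast

lemma smooth_class_mix_class:
  assumes uv: "0 \<le> u" "0 \<le> v" "u + v = 1"
  shows "smooth_class (mix_class u v)"
  unfolding smooth_class_def
proof
  fix \<beta> assume "\<beta> \<in> mix_class u v"
  then show "(\<exists>B. \<forall>z. \<bar>\<beta> z\<bar> \<le> B) \<and> (\<exists>\<beta>1\<in>mix_class u v. \<exists>\<beta>2\<in>mix_class u v.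
      \<forall>z. (\<beta> has_derivative (\<lambda>k. fst k * \<beta>1 z + snd k * \<beta>2 z)) (at z))"
  proof induction
    case (const c)
    have "((\<lambda>_. c) has_derivative (\<lambda>k. fst k * 0 + snd k * 0)) (at z)" for z :: "real \<times> real" by simp
    then show ?case using mix_class.const[of 0 u v]
      by (intro smooth_class_memberI[of _ "\<bar>c\<bar>" "\<lambda>_. 0" _ "\<lambda>_. 0"]) auto
  next
    case ratio
    have "\<bar>mix_ratio u v z\<bar> \<le> 1" for z
    proof -
      have "0 \<le> u * psi (fst z)" "0 \<le> v * psi (snd z)" using uv by (auto simp: less_imp_le)
      then show ?thesis using mix_pos[OF uv, of z] unfolding mix_ratio_def mix_def by (simp add: abs_of_nonneg)
    qed
    moreover have "(\<lambda>z. mix_ratio u v z * (1 - mix_ratio u v z) * (1 / (1 + psi (fst z)))) \<in> mix_class u v"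
      "(\<lambda>z. - (mix_ratio u v z * (1 - mix_ratio u v z) * (1 / (1 + psi (snd z))))) \<in> mix_class u v"
      by (intro uminus_mix_class mix_class.mult mix_class.ratio one_minus_mix_class mix_class.fst mix_class.snd)+
    ultimately show ?case using has_derivative_mix_ratio[OF uv] by (rule smooth_class_memberI)
  next
    case fst
    let ?w = "\<lambda>z. 1 / (1 + psi (fst z))"
    have "\<bar>?w z\<bar> \<le> 1" for z :: "real \<times> real"
    proof -
      have "1 \<le> 1 + psi (fst z)" by (simp add: less_imp_le)
      then show ?thesis by (simp only: abs_div_pos abs_of_nonneg abs_one divide_le_eq_1 abs_divide) auto
    qed
    moreover have "(\<lambda>z. - ((1 - ?w z) * ?w z * ?w z)) \<in> mix_class u v"
      by (intro uminus_mix_class mix_class.mult one_minus_mix_class mix_class.fst)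
    moreover have "(?w has_derivative (\<lambda>k. fst k * - ((1 - ?w z) * ?w z * ?w z) + snd k * 0)) (at z)" for z
      using has_derivative_inverse_psi[OF has_derivative_psi_fst] by simp
    ultimately show ?case using smooth_class_memberI[OF _ _ mix_class.const[of 0 u v], of ?w 1] by blast
  next
    case snd
    let ?w = "\<lambda>z. 1 / (1 + psi (snd z))"
    have "\<bar>?w z\<bar> \<le> 1" for z :: "real \<times> real"
    proof -
      have "1 \<le> 1 + psi (snd z)" by (simp add: less_imp_le)
      then show ?thesis by (simp only: abs_div_pos abs_of_nonneg abs_one divide_le_eq_1 abs_divide) auto
    qed
    moreover have "(\<lambda>z. - ((1 - ?w z) * ?w z * ?w z)) \<in> mix_class u v"
      by (intro uminus_mix_class mix_class.mult one_minus_mix_class mix_class.snd)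
    moreover have "(?w has_derivative (\<lambda>k. fst k * 0 + snd k * - ((1 - ?w z) * ?w z * ?w z))) (at z)" for z
      using has_derivative_inverse_psi[OF has_derivative_psi_snd] by simp
    ultimately show ?case using smooth_class_memberI[OF _ mix_class.const[of 0 u v], of ?w 1] by blast
  next
    case (add f g)
    then obtain B1 B2 f1 f2 g1 g2 where *: "\<And>z. \<bar>f z\<bar> \<le> B1" "\<And>z. \<bar>g z\<bar> \<le> B2"
      "f1 \<in> mix_class u v" "f2 \<in> mix_class u v" "g1 \<in> mix_class u v" "g2 \<in> mix_class u v"
      "\<And>z. (f has_derivative (\<lambda>k. fst k * f1 z + snd k * f2 z)) (at z)"
      "\<And>z. (g has_derivative (\<lambda>k. fst k * g1 z + snd k * g2 z)) (at z)" by blast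
    have "\<bar>f z + g z\<bar> \<le> B1 + B2" for z using *(1)[of z] *(2)[of z] by simp
    moreover have "((\<lambda>z. f z + g z) has_derivative (\<lambda>k. fst k * (f1 z + g1 z) + snd k * (f2 z + g2 z))) (at z)" for z
      by (rule has_derivative_eq_rhs[OF has_derivative_add[OF *(7,8)]]) (simp add: fun_eq_iff algebra_simps)
    moreover have "(\<lambda>z. f1 z + g1 z) \<in> mix_class u v" "(\<lambda>z. f2 z + g2 z) \<in> mix_class u v"
      using * by (auto intro: mix_class.add)
    ultimately show ?case
      by (intro smooth_class_memberI[of "\<lambda>z. f z + g z" "B1 + B2" "\<lambda>z. f1 z + g1 z" _ "\<lambda>z. f2 z + g2 z"])
  next
    case (mult f g)
    then obtain B1 B2 f1 f2 g1 g2 where *: "\<And>z. \<bar>f z\<bar> \<le> B1" "\<And>z. \<bar>g z\<bar> \<le> B2"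
      "f1 \<in> mix_class u v" "f2 \<in> mix_class u v" "g1 \<in> mix_class u v" "g2 \<in> mix_class u v"
      "\<And>z. (f has_derivative (\<lambda>k. fst k * f1 z + snd k * f2 z)) (at z)"
      "\<And>z. (g has_derivative (\<lambda>k. fst k * g1 z + snd k * g2 z)) (at z)" by blast
    have "\<bar>f z * g z\<bar> \<le> B1 * B2" for z
      unfolding abs_mult using *(1)[of z] *(2)[of z] by (intro mult_mono) auto
    moreover have "((\<lambda>z. f z * g z) has_derivative (\<lambda>k. fst k * (f z * g1 z + f1 z * g z) + snd k * (f z * g2 z + f2 z * g z))) (at z)" for z
      by (rule has_derivative_eq_rhs[OF has_derivative_mult[OF *(7,8)]]) (simp add: fun_eq_iff algebra_simps)
    moreover have "(\<lambda>z. f z * g1 z + f1 z * g z) \<in> mix_class u v" "(\<lambda>z. f z * g2 z + f2 z * g z) \<in> mix_class u v"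
      using * mult by (auto intro: mix_class.add mix_class.mult)
    ultimately show ?case
      by (intro smooth_class_memberI[of "\<lambda>z. f z * g z" "B1 * B2" "\<lambda>z. f z * g1 z + f1 z * g z" _ "\<lambda>z. f z * g2 z + f2 z * g z"])
  qed
qed

lemma psi_fst_partials:
  obtains D1 D2 where "D1 \<in> mix_class u v" "D2 \<in> mix_class u v"
    "\<And>z. ((\<lambda>z. psi (fst z)) has_derivative (\<lambda>k. fst k * D1 z + snd k * D2 z)) (at z)"
proof
  show "(\<lambda>z. 1 - 1 / (1 + psi (fst z))) \<in> mix_class u v" "(\<lambda>_. 0) \<in> mix_class u v"
    by (intro one_minus_mix_class mix_class.fst mix_class.const)+
  have "psi x * (1 / (1 + psi x)) = 1 - 1 / (1 + psi x)" for x
  proof -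
    have "1 + psi x \<noteq> 0" using psi_pos[of x] by linarith
    then show ?thesis by (simp add: field_simps)
  qed
  then show "((\<lambda>z. psi (fst z)) has_derivative (\<lambda>k. fst k * (1 - 1 / (1 + psi (fst z))) + snd k * 0)) (at z)" for z
    using has_derivative_psi_fst[of z] by simp
qed

text \<open>The derivative of \<open>log_d\<close> contributes the unbounded factor
  \<open>1 / Y\<close>. It always meets \<open>u * psi (fst z)\<close> or
  \<open>v * psi (snd z)\<close>, and these quotients are the bounded shares p and 1 - p; the
  remaining part is handled by \<open>F * W1 = 1 - W1\<close>.\<close>

lemma log_d_mix_partials:
  assumes uv: "0 \<le> u" "0 \<le> v" "u + v = 1"
  obtains D1 D2 where "D1 \<in> mix_class u v" "D2 \<in> mix_class u v"
    "\<And>z. ((\<lambda>z. log_d (mix u v z)) has_derivative (\<lambda>k. fst k * D1 z + snd k * D2 z)) (at z)"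
proof
  let ?w1 = "\<lambda>z. 1 / (1 + psi (fst z))" and ?w2 = "\<lambda>z. 1 / (1 + psi (snd z))"
  show "(\<lambda>z. u * (1 - ?w1 z) + mix_ratio u v z * ?w1 z) \<in> mix_class u v"
    "(\<lambda>z. v * (1 - ?w2 z) + (1 - mix_ratio u v z) * ?w2 z) \<in> mix_class u v"
    by (intro mix_class.add mix_class.mult one_minus_mix_class mix_class.fst mix_class.snd mix_class.ratio mix_class.const)+
  fix z
  define F H W1 W2 Y where "F = psi (fst z)" "H = psi (snd z)" "W1 = 1 / (1 + F)" "W2 = 1 / (1 + H)" "Y = mix u v z"
  note defs = this
  have Y: "0 < Y" using mix_pos[OF uv] by (simp add: defs)
  have YFH: "v * H = Y - u * F" by (simp add: defs mix_def)
  have W: "F * W1 = 1 - W1" "H * W2 = 1 - W2"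
  proof -
    have "1 + F \<noteq> 0" "1 + H \<noteq> 0"
      using psi_pos[of "fst z"] psi_pos[of "snd z"] unfolding defs(1,2) by linarith+
    then show "F * W1 = 1 - W1" "H * W2 = 1 - W2" unfolding defs(3,4) by (simp_all add: field_simps)
  qed
  have w: "1 / (1 + psi (fst z)) = W1" "1 / (1 + psi (snd z)) = W2" by (simp_all add: defs)
  have R: "mix_ratio u v z = u * F / Y" by (simp add: mix_ratio_def defs)
  have e: "1 - u * F / Y = v * H / Y" unfolding YFH using Y by (simp add: field_simps)
  have "(log_d has_real_derivative 1 + 1 / Y) (at (mix u v z))"
    unfolding log_d_def defs by (auto intro!: derivative_eq_intros simp: mix_pos[OF uv])
  from has_derivative_compose[OF has_derivative_mix this[unfolded has_field_derivative_def]]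
  have "((\<lambda>z. log_d (mix u v z)) has_derivative (\<lambda>k. (1 + 1 / Y) * (fst k * (u * (F * W1)) + snd k * (v * (H * W2))))) (at z)"
    unfolding defs by simp
  then show "((\<lambda>z. log_d (mix u v z)) has_derivative (\<lambda>k. fst k * (u * (1 - ?w1 z) + mix_ratio u v z * ?w1 z)
      + snd k * (v * (1 - ?w2 z) + (1 - mix_ratio u v z) * ?w2 z))) (at z)"
  proof (rule has_derivative_eq_rhs)
    have "(1 + 1 / Y) * (a * (u * (F * W1)) + b * (v * (H * W2)))
      = a * (u * (F * W1) + u * F / Y * W1) + b * (v * (H * W2) + v * H / Y * W2)" for a b
      by (simp add: ring_distribs)
    then show "(\<lambda>k. (1 + 1 / Y) * (fst k * (u * (F * W1)) + snd k * (v * (H * W2))))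
      = (\<lambda>k. fst k * (u * (1 - ?w1 z) + mix_ratio u v z * ?w1 z) + snd k * (v * (1 - ?w2 z) + (1 - mix_ratio u v z) * ?w2 z))"
      unfolding R e w W[symmetric] by (rule ext)
  qed
qed

section \<open>Sobolev functions and their Borel representatives\<close>

lemma lebesgue_borel_representative:
  fixes f :: "'a::euclidean_space \<Rightarrow> real"
  assumes "f \<in> borel_measurable lebesgue"
  obtains g where "g \<in> borel_measurable borel" "AE x in lborel. f x = g x"
  using completion_ex_borel_measurable_real[OF assms] by auto

lemma locally_integrable_AE_iff:
  fixes f g :: "real^'n::finite \<Rightarrow> real"
  assumes f: "f \<in> borel_measurable lebesgue" and g: "g \<in> borel_measurable borel"
    and eq: "AE x in lborel. f x = g x"
  shows "locally_integrable f \<longleftrightarrow> borel_locint g"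
proof -
  have "set_integrable lebesgue K f \<longleftrightarrow> set_integrable lborel K g" if "compact K" for K
  proof -
    have K: "K \<in> sets borel" using that by (simp add: compact_imp_closed)
    have m: "(\<lambda>x. indicator K x *\<^sub>R g x) \<in> borel_measurable lborel" using K g by simp
    have "set_integrable lebesgue K f \<longleftrightarrow> integrable lebesgue (\<lambda>x. indicator K x *\<^sub>R g x)"
      unfolding set_integrable_def
    proof (rule integrable_cong_AE)
      show "(\<lambda>x. indicator K x *\<^sub>R f x) \<in> borel_measurable lebesgue" using f K by (intro borel_measurable_scaleR borel_measurable_indicator) auto
      show "(\<lambda>x. indicator K x *\<^sub>R g x) \<in> borel_measurable lebesgue" using measurable_completion[OF m] .
      show "AE x in lebesgue. indicator K x *\<^sub>R f x = indicator K x *\<^sub>R g x"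
        using AE_completion[OF eq] by eventually_elim simp
    qed
    then show ?thesis unfolding integrable_completion[OF m] by (simp add: set_integrable_def)
  qed
  then show ?thesis using g unfolding locally_integrable_def borel_locint_def by blast
qed

text \<open>Serves the function picked by \<open>weak_deriv\<close>, about whose measurability
  nothing is known beyond local integrability; it is the limit of its truncations to balls.\<close>

lemma locally_integrable_measurable:
  fixes f :: "real^'n::finite \<Rightarrow> real"
  assumes "locally_integrable f"
  shows "f \<in> borel_measurable lebesgue"
proof (rule borel_measurable_LIMSEQ_real)
  have "set_integrable lebesgue (cball 0 (real n)) f" for n
    using assms compact_cball unfolding locally_integrable_def by blast
  then show "(\<lambda>x. indicator (cball 0 (real n)) x *\<^sub>R f x) \<in> borel_measurable lebesgue" for n
    unfolding set_integrable_def by (rule borel_measurable_integrable)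
  show "(\<lambda>n. indicator (cball 0 (real n)) x *\<^sub>R f x) \<longlonglongrightarrow> f x" for x
  proof (rule tendsto_eventually)
    obtain m :: nat where "norm x \<le> real m" using real_arch_simple by blast
    then show "\<forall>\<^sub>F n in sequentially. indicator (cball 0 (real n)) x *\<^sub>R f x = f x"
      unfolding eventually_sequentially by (intro exI[of _ m]) auto
  qed
qed

lemma integral_lebesgue_representative:
  fixes f g h :: "'a::euclidean_space \<Rightarrow> real"
  assumes f: "f \<in> borel_measurable lebesgue" and g: "g \<in> borel_measurable borel"
    and h: "h \<in> borel_measurable borel" and eq: "AE x in lborel. f x = g x"
  shows "(\<integral>x. f x * h x \<partial>lebesgue) = (\<integral>x. g x * h x \<partial>lborel)"
proof -
  have m: "(\<lambda>x. g x * h x) \<in> borel_measurable lborel" using g h by simp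
  have "(\<integral>x. f x * h x \<partial>lebesgue) = (\<integral>x. g x * h x \<partial>lebesgue)"
  proof (rule integral_cong_AE)
    have "h \<in> borel_measurable lebesgue" using h by (intro measurable_completion) simp
    then show "(\<lambda>x. f x * h x) \<in> borel_measurable lebesgue" using f by (intro borel_measurable_times)
    show "(\<lambda>x. g x * h x) \<in> borel_measurable lebesgue" using measurable_completion[OF m] .
    show "AE x in lebesgue. f x * h x = g x * h x" using AE_completion[OF eq] by eventually_elim simp
  qed
  also have "\<dots> = (\<integral>x. g x * h x \<partial>lborel)" by (rule integral_completion[OF m])
  finally show ?thesis .
qed

lemma test_fun_multi_partial: "test_fun \<phi> \<Longrightarrow> test_fun (multi_partial s \<phi>)"
  using multi_partial_as_foldr[of s] test_fun_foldr_partial_deriv by metis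

lemma multi_partial_zero: "multi_partial (\<lambda>_. 0) \<phi> = \<phi>"
proof -
  have "foldr (\<lambda>i. partial_deriv i ^^ 0) ys \<phi> = \<phi>" for ys by (induction ys) auto
  then show ?thesis by (simp add: multi_partial_eq)
qed

context sobolev_measure
begin

lemma mu_measurable_iff: "f \<in> borel_measurable \<mu> \<longleftrightarrow> f \<in> borel_measurable lebesgue"
  by (simp only: measurable_cong_sets[OF sets_mu refl])

text \<open>Borel representatives of a function of the Sobolev space and of its weak derivatives.\<close>

definition represents :: "(('n \<Rightarrow> nat) \<Rightarrow> real^'n \<Rightarrow> real) \<Rightarrow> (real^'n \<Rightarrow> real) \<Rightarrow> bool" where
  "represents A a \<longleftrightarrow> a \<in> borel_measurable \<mu> \<and> (AE x in lborel. a x = A (\<lambda>_. 0) x) \<and>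
     (\<forall>s. mi_order s \<le> k \<longrightarrow> A s \<in> borel_measurable borel \<and> integrable \<mu> (\<lambda>x. \<bar>A s x\<bar> powr \<Lambda> (mi_order s)) \<and>
        (\<forall>\<phi>. test_fun \<phi> \<longrightarrow> (\<integral>x. A (\<lambda>_. 0) x * multi_partial s \<phi> x \<partial>lborel) = (- 1) ^ mi_order s * (\<integral>x. A s x * \<phi> x \<partial>lborel)))"

lemma representsD:
  assumes "represents A a"
  shows "a \<in> borel_measurable \<mu>" "AE x in lborel. a x = A (\<lambda>_. 0) x"
    "mi_order s \<le> k \<Longrightarrow> A s \<in> borel_measurable borel"
    "mi_order s \<le> k \<Longrightarrow> integrable \<mu> (\<lambda>x. \<bar>A s x\<bar> powr \<Lambda> (mi_order s))"
    "mi_order s \<le> k \<Longrightarrow> test_fun \<phi> \<Longrightarrow> (\<integral>x. A (\<lambda>_. 0) x * multi_partial s \<phi> x \<partial>lborel) = (- 1) ^ mi_order s * (\<integral>x. A s x * \<phi> x \<partial>lborel)"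
    "mi_order s \<le> k \<Longrightarrow> borel_locint (A s)"
  using assms locint_of_Lp[OF _ Lambda_ge_1[of "mi_order s"], of "A s"] by (auto simp: represents_def)

lemma integrable_Lp_representative:
  assumes f: "f \<in> borel_measurable \<mu>" and g: "g \<in> borel_measurable borel" and eq: "AE x in lborel. f x = g x"
  shows "integrable \<mu> (\<lambda>x. \<bar>f x\<bar> powr p) \<longleftrightarrow> integrable \<mu> (\<lambda>x. \<bar>g x\<bar> powr p)"
    and "Lp_norm p \<mu> f = Lp_norm p \<mu> g"
proof -
  have m: "(\<lambda>x. \<bar>f x\<bar> powr p) \<in> borel_measurable \<mu>" "(\<lambda>x. \<bar>g x\<bar> powr p) \<in> borel_measurable \<mu>"
    using f borel_imp_mu[OF g] by (auto intro: measurable_abs_powr)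
  have e: "AE x in \<mu>. \<bar>f x\<bar> powr p = \<bar>g x\<bar> powr p"
    using AE_mu[OF eq] by eventually_elim simp
  show "integrable \<mu> (\<lambda>x. \<bar>f x\<bar> powr p) \<longleftrightarrow> integrable \<mu> (\<lambda>x. \<bar>g x\<bar> powr p)"
    by (rule integrable_cong_AE[OF m e])
  show "Lp_norm p \<mu> f = Lp_norm p \<mu> g"
    unfolding Lp_norm_def integral_cong_AE[OF m e] ..
qed

lemma is_weak_deriv_representative:
  assumes a: "a \<in> borel_measurable lebesgue" "a' \<in> borel_measurable borel" "AE x in lborel. a x = a' x"
    and v: "v \<in> borel_measurable lebesgue" "v' \<in> borel_measurable borel" "AE x in lborel. v x = v' x"
  shows "is_weak_deriv s a v \<longleftrightarrow> borel_locint a' \<and> borel_locint v' \<and>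
    (\<forall>\<phi>. test_fun \<phi> \<longrightarrow> (\<integral>x. a' x * multi_partial s \<phi> x \<partial>lborel) = (- 1) ^ mi_order s * (\<integral>x. v' x * \<phi> x \<partial>lborel))"
proof -
  have "(\<integral>x. a x * multi_partial s \<phi> x \<partial>lebesgue) = (\<integral>x. a' x * multi_partial s \<phi> x \<partial>lborel)"
    "(\<integral>x. v x * \<phi> x \<partial>lebesgue) = (\<integral>x. v' x * \<phi> x \<partial>lborel)" if "test_fun \<phi>" for \<phi>
    using integral_lebesgue_representative[OF a(1,2) test_fun_borel[OF test_fun_multi_partial[OF that]] a(3)]
      integral_lebesgue_representative[OF v(1,2) test_fun_borel[OF that] v(3)] by auto
  then show ?thesis
    unfolding is_weak_deriv_def locally_integrable_AE_iff[OF a] locally_integrable_AE_iff[OF v] by auto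
qed

lemma represents_is_weak_deriv:
  assumes r: "represents A a" and s: "mi_order s \<le> k"
  shows "is_weak_deriv s a (A s)"
proof -
  have "A s \<in> borel_measurable lebesgue" using borel_imp_mu[OF representsD(3)[OF r s]] mu_measurable_iff by blast
  moreover have "a \<in> borel_measurable lebesgue" using representsD(1)[OF r] mu_measurable_iff by blast
  ultimately show ?thesis
    using is_weak_deriv_representative[of a "A (\<lambda>_. 0)" "A s" "A s" s] representsD[OF r] s by simp
qed

lemma represents_imp_sobolev:
  assumes r: "represents A a"
  shows "a \<in> sobolev_space k \<Lambda> \<mu>"
  unfolding sobolev_space_def
proof (intro CollectI conjI allI impI)
  show "a \<in> Lp_space (\<Lambda> 0) \<mu>"
    using representsD(1)[OF r] integrable_Lp_representative(1)[OF representsD(1)[OF r] representsD(3)[OF r] representsD(2)[OF r], of "\<Lambda> 0"]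
      representsD(4)[OF r, of "\<lambda>_. 0"] by (simp add: Lp_space_def)
  fix s :: "'n \<Rightarrow> nat" assume s: "1 \<le> mi_order s \<and> mi_order s \<le> k"
  show "\<exists>v\<in>Lp_space (\<Lambda> (mi_order s)) \<mu>. is_weak_deriv s a v"
    using represents_is_weak_deriv[OF r] representsD(3,4)[OF r, of s] borel_imp_mu s
    by (intro bexI[of _ "A s"]) (auto simp: Lp_space_def)
qed

lemma sobolev_imp_represents:
  assumes a: "a \<in> sobolev_space k \<Lambda> \<mu>"
  obtains A where "represents A a"
proof -
  have ap: "a \<in> borel_measurable \<mu>" "integrable \<mu> (\<lambda>x. \<bar>a x\<bar> powr \<Lambda> 0)"
    using a by (auto simp: sobolev_space_def Lp_space_def)
  then have al: "a \<in> borel_measurable lebesgue" using mu_measurable_iff by blast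
  then obtain a' where a': "a' \<in> borel_measurable borel" "AE x in lborel. a x = a' x"
    using lebesgue_borel_representative by blast
  define R where "R s g \<longleftrightarrow> g \<in> borel_measurable borel \<and> integrable \<mu> (\<lambda>x. \<bar>g x\<bar> powr \<Lambda> (mi_order s)) \<and>
      (\<forall>\<phi>. test_fun \<phi> \<longrightarrow> (\<integral>x. a' x * multi_partial s \<phi> x \<partial>lborel) = (- 1) ^ mi_order s * (\<integral>x. g x * \<phi> x \<partial>lborel))"
    for s g
  have "\<exists>g. R s g" if s: "1 \<le> mi_order s" "mi_order s \<le> k" for s :: "'n \<Rightarrow> nat"
  proof -
    obtain v where v: "v \<in> Lp_space (\<Lambda> (mi_order s)) \<mu>" "is_weak_deriv s a v"
      using a s unfolding sobolev_space_def by blast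
    then have vm: "v \<in> borel_measurable \<mu>" and vl: "v \<in> borel_measurable lebesgue"
      using mu_measurable_iff by (auto simp: Lp_space_def)
    obtain v' where v': "v' \<in> borel_measurable borel" "AE x in lborel. v x = v' x"
      using lebesgue_borel_representative[OF vl] by blast
    show ?thesis
      using v integrable_Lp_representative(1)[OF vm v'] is_weak_deriv_representative[OF al a' vl v', of s] v'
      by (intro exI[of _ v']) (auto simp: Lp_space_def R_def)
  qed
  then obtain g where "\<And>s. 1 \<le> mi_order s \<Longrightarrow> mi_order s \<le> k \<Longrightarrow> R s (g s)" by metis
  then have g: "\<And>s :: 'n \<Rightarrow> nat. 1 \<le> mi_order s \<Longrightarrow> mi_order s \<le> k \<Longrightarrow>
      g s \<in> borel_measurable borel \<and> integrable \<mu> (\<lambda>x. \<bar>g s x\<bar> powr \<Lambda> (mi_order s)) \<and>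
      (\<forall>\<phi>. test_fun \<phi> \<longrightarrow> (\<integral>x. a' x * multi_partial s \<phi> x \<partial>lborel) = (- 1) ^ mi_order s * (\<integral>x. g s x * \<phi> x \<partial>lborel))"
    unfolding R_def by blast
  \<comment> \<open>At order 0 the family has to be the representative of \<open>a\<close> itself;
    \<open>g\<close> is controlled from order 1 on.\<close>
  have "represents (\<lambda>s. if s = (\<lambda>_. 0) then a' else g s) a"
    unfolding represents_def
  proof (intro conjI allI impI)
    fix s :: "'n \<Rightarrow> nat" and \<phi> :: "real^'n \<Rightarrow> real" assume s: "mi_order s \<le> k"
    show "(if s = (\<lambda>_. 0) then a' else g s) \<in> borel_measurable borel"
      using g[of s] a' s mi_order_eq_0_iff[of s] by auto
    show "integrable \<mu> (\<lambda>x. \<bar>(if s = (\<lambda>_. 0) then a' else g s) x\<bar> powr \<Lambda> (mi_order s))"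
    proof (cases "s = (\<lambda>_. 0)")
      case True
      then show ?thesis using ap integrable_Lp_representative(1)[OF ap(1) a'] by simp
    next
      case False
      then show ?thesis using g[of s] s mi_order_eq_0_iff[of s] by auto
    qed
    show "(\<integral>x. (if (\<lambda>_. 0) = (\<lambda>_. 0) then a' else g (\<lambda>_. 0)) x * multi_partial s \<phi> x \<partial>lborel) =
        (- 1) ^ mi_order s * (\<integral>x. (if s = (\<lambda>_. 0) then a' else g s) x * \<phi> x \<partial>lborel)" if "test_fun \<phi>"
    proof (cases "s = (\<lambda>_. 0)")
      case True
      then show ?thesis by (simp add: multi_partial_zero)
    next
      case False
      then show ?thesis using g[of s] s that mi_order_eq_0_iff[of s] by auto
    qed
  qed (use ap a' in auto)
  then show ?thesis by (rule that)
qed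

text \<open>The derivative of multi-index \<open>s\<close> tested against the \<open>i\<close>-th
  partial of \<phi>, and the next derivative tested against \<phi>, both reduce to the same integral
  of the undifferentiated function, with signs that differ by one factor -1.\<close>

lemma represents_line_deriv:
  assumes r: "represents A a" and s: "mi_order s < k"
  shows "line_deriv (axis i 1) (A s) (A (s(i := Suc (s i))))"
proof (rule line_deriv_of_weak)
  show "borel_locint (A s)" "borel_locint (A (s(i := Suc (s i))))"
    using representsD(6)[OF r] s by auto
  fix \<phi> :: "real^'n \<Rightarrow> real" assume \<phi>: "test_fun \<phi>"
  let ?I = "\<integral>x. A (\<lambda>_. 0) x * multi_partial (s(i := Suc (s i))) \<phi> x \<partial>lborel"
  have "?I = (- 1) ^ mi_order s * (\<integral>x. A s x * partial_deriv i \<phi> x \<partial>lborel)"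
    using representsD(5)[OF r, of s "partial_deriv i \<phi>"] test_fun_partial_deriv[OF \<phi>] \<phi> s
    by (simp add: multi_partial_partial_deriv test_fun_def)
  moreover have "?I = (- 1) ^ Suc (mi_order s) * (\<integral>x. A (s(i := Suc (s i))) x * \<phi> x \<partial>lborel)"
    using representsD(5)[OF r, of "s(i := Suc (s i))" \<phi>] \<phi> s by simp
  ultimately show "(\<integral>x. A s x * partial_deriv i \<phi> x \<partial>lborel) = - (\<integral>x. A (s(i := Suc (s i))) x * \<phi> x \<partial>lborel)"
    by (cases "even (mi_order s)") simp_all
qed

lemma good_family_represents:
  assumes "represents A a" "represents B b"
  shows "good_family (\<lambda>c. if c then B else A)"
  using representsD(3,4)[OF assms(1)] representsD(3,4)[OF assms(2)]
    represents_line_deriv[OF assms(1)] represents_line_deriv[OF assms(2)]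
  by (auto simp: good_family_def)

text \<open>Weak derivatives are unique up to null sets by the fundamental lemma, so the choice
  inside \<open>weak_deriv\<close> may be exchanged for any family of representatives.\<close>

lemma represents_weak_deriv_norm:
  assumes r: "represents A a" and s: "mi_order s \<le> k"
  shows "Lp_norm p \<mu> (weak_deriv s a) = Lp_norm p \<mu> (A s)"
proof -
  define w where "w = weak_deriv s a"
  have w: "is_weak_deriv s a w"
    unfolding w_def weak_deriv_def by (rule someI[of "is_weak_deriv s a"]) (rule represents_is_weak_deriv[OF r s])
  then have wl: "w \<in> borel_measurable lebesgue"
    by (intro locally_integrable_measurable) (simp add: is_weak_deriv_def)
  then obtain w' where w': "w' \<in> borel_measurable borel" "AE x in lborel. w x = w' x"
    using lebesgue_borel_representative by blast
  have al: "a \<in> borel_measurable lebesgue" using representsD(1)[OF r] mu_measurable_iff by blast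
  have W: "borel_locint w'" and I: "\<And>\<phi>. test_fun \<phi> \<Longrightarrow> (\<integral>x. A (\<lambda>_. 0) x * multi_partial s \<phi> x \<partial>lborel) = (- 1) ^ mi_order s * (\<integral>x. w' x * \<phi> x \<partial>lborel)"
    using w is_weak_deriv_representative[OF al representsD(3)[OF r] representsD(2)[OF r] wl w', of s] by auto
  have "AE x in lborel. w' x - A s x = 0"
  proof (rule AE_zero_if_test_integrals_zero)
    show "borel_locint (\<lambda>x. w' x - A s x)" by (intro borel_locint_diff W representsD(6)[OF r s])
    fix \<phi> :: "real^'n \<Rightarrow> real" assume \<phi>: "test_fun \<phi>"
    have "(\<integral>x. w' x * \<phi> x \<partial>lborel) = (\<integral>x. A s x * \<phi> x \<partial>lborel)"
      using I[OF \<phi>] representsD(5)[OF r s \<phi>] by simp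
    then show "(\<integral>x. (w' x - A s x) * \<phi> x \<partial>lborel) = 0"
      using borel_locint_test_fun[OF W \<phi>] borel_locint_test_fun[OF representsD(6)[OF r s] \<phi>]
      by (simp add: left_diff_distrib)
  qed
  then have "AE x in lborel. w x = A s x" using w'(2) by eventually_elim simp
  then have "Lp_norm p \<mu> w = Lp_norm p \<mu> (A s)"
    using wl mu_measurable_iff by (intro integrable_Lp_representative(2) representsD(3)[OF r s]) auto
  then show ?thesis by (simp add: w_def)
qed

lemma represents_sobolev_norm:
  assumes "represents A a"
  shows "sobolev_norm k \<Lambda> \<mu> a = (\<Sum>s | mi_order s \<le> k. Lp_norm (\<Lambda> (mi_order s)) \<mu> (A s) powr \<Lambda> 0) powr (1 / \<Lambda> 0)"
  unfolding sobolev_norm_def using represents_weak_deriv_norm[OF assms] by simp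

lemma powr_add_le:
  fixes x y p :: real
  assumes "0 \<le> x" "0 \<le> y" "1 \<le> p"
  shows "(x + y) powr p \<le> 2 powr p * (x powr p + y powr p)"
  using sum_powr_le[of "UNIV :: bool set" "\<lambda>c. if c then x else y" p] assms by (simp add: UNIV_bool add.commute)

lemma integrable_powr_add:
  fixes f g :: "real^'n \<Rightarrow> real" and p :: real
  assumes f: "f \<in> borel_measurable \<mu>" "g \<in> borel_measurable \<mu>" and p: "1 \<le> p"
    and i: "integrable \<mu> (\<lambda>x. \<bar>f x\<bar> powr p)" "integrable \<mu> (\<lambda>x. \<bar>g x\<bar> powr p)"
  shows "integrable \<mu> (\<lambda>x. (\<bar>f x\<bar> + \<bar>g x\<bar>) powr p)"
proof (rule Bochner_Integration.integrable_bound)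
  show "integrable \<mu> (\<lambda>x. 2 powr p * (\<bar>f x\<bar> powr p + \<bar>g x\<bar> powr p))" using i by simp
  show "(\<lambda>x. (\<bar>f x\<bar> + \<bar>g x\<bar>) powr p) \<in> borel_measurable \<mu>" using f by simp
  show "AE x in \<mu>. norm ((\<bar>f x\<bar> + \<bar>g x\<bar>) powr p) \<le> norm (2 powr p * (\<bar>f x\<bar> powr p + \<bar>g x\<bar> powr p))"
    using powr_add_le[OF _ _ p] by (intro AE_I2) simp
qed

lemma integrable_powr_dominated:
  fixes f g h :: "real^'n \<Rightarrow> real" and p :: real
  assumes h: "h \<in> borel_measurable \<mu>" and f: "f \<in> borel_measurable \<mu>" "g \<in> borel_measurable \<mu>" and p: "1 \<le> p"
    and i: "integrable \<mu> (\<lambda>x. \<bar>f x\<bar> powr p)" "integrable \<mu> (\<lambda>x. \<bar>g x\<bar> powr p)"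
    and le: "\<And>x. \<bar>h x\<bar> \<le> \<bar>f x\<bar> + \<bar>g x\<bar>"
  shows "integrable \<mu> (\<lambda>x. \<bar>h x\<bar> powr p)"
proof (rule Bochner_Integration.integrable_bound)
  show "integrable \<mu> (\<lambda>x. (\<bar>f x\<bar> + \<bar>g x\<bar>) powr p)" by (rule integrable_powr_add[OF f p i])
  show "(\<lambda>x. \<bar>h x\<bar> powr p) \<in> borel_measurable \<mu>" using h by measurable
  show "AE x in \<mu>. norm (\<bar>h x\<bar> powr p) \<le> norm ((\<bar>f x\<bar> + \<bar>g x\<bar>) powr p)"
    using le p by (intro AE_I2) (auto intro!: powr_mono2)
qed

lemma represents_diff:
  assumes a: "represents A a" and b: "represents B b"
  shows "represents (\<lambda>s x. B s x - A s x) (\<lambda>x. b x - a x)"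
  unfolding represents_def
proof (intro conjI allI impI)
  show "(\<lambda>x. b x - a x) \<in> borel_measurable \<mu>" using representsD(1)[OF a] representsD(1)[OF b] by simp
  show "AE x in lborel. b x - a x = B (\<lambda>_. 0) x - A (\<lambda>_. 0) x"
    using representsD(2)[OF a] representsD(2)[OF b] by eventually_elim simp
  fix s :: "'n \<Rightarrow> nat" and \<phi> :: "real^'n \<Rightarrow> real" assume s: "mi_order s \<le> k"
  show "(\<lambda>x. B s x - A s x) \<in> borel_measurable borel" using representsD(3)[OF a s] representsD(3)[OF b s] by simp
  then show "integrable \<mu> (\<lambda>x. \<bar>B s x - A s x\<bar> powr \<Lambda> (mi_order s))"
    by (rule integrable_powr_dominated[OF borel_imp_mu borel_imp_mu[OF representsD(3)[OF b s]] borel_imp_mu[OF representsD(3)[OF a s]]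
        Lambda_ge_1[OF s] representsD(4)[OF b s] representsD(4)[OF a s]]) simp
  assume \<phi>: "test_fun \<phi>"
  have o: "mi_order (\<lambda>_::'n. 0) \<le> k" by simp
  show "(\<integral>x. (B (\<lambda>_. 0) x - A (\<lambda>_. 0) x) * multi_partial s \<phi> x \<partial>lborel) = (- 1) ^ mi_order s * (\<integral>x. (B s x - A s x) * \<phi> x \<partial>lborel)"
    using borel_locint_test_fun[OF representsD(6)[OF a s] \<phi>] borel_locint_test_fun[OF representsD(6)[OF b s] \<phi>]
      borel_locint_test_fun[OF representsD(6)[OF a o] test_fun_multi_partial[OF \<phi>, of s]]
      borel_locint_test_fun[OF representsD(6)[OF b o] test_fun_multi_partial[OF \<phi>, of s]]
      representsD(5)[OF a s \<phi>] representsD(5)[OF b s \<phi>]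
    by (simp add: left_diff_distrib right_diff_distrib)
qed

end

section \<open>Superposition on the Sobolev space\<close>

lemma bounded_partials_linear_growth:
  fixes \<Phi> :: "real \<times> real \<Rightarrow> real"
  assumes \<Phi>: "\<And>z. (\<Phi> has_derivative (\<lambda>k. fst k * D1 z + snd k * D2 z)) (at z)"
    and B: "\<And>z. \<bar>D1 z\<bar> \<le> B" "\<And>z. \<bar>D2 z\<bar> \<le> B"
  shows "\<bar>\<Phi> (x, y)\<bar> \<le> \<bar>\<Phi> (0, 0)\<bar> + B * (\<bar>x\<bar> + \<bar>y\<bar>)"
proof -
  have "((\<lambda>\<tau>. \<Phi> (\<tau> *\<^sub>R (x, y))) has_real_derivative x * D1 (\<tau> *\<^sub>R (x, y)) + y * D2 (\<tau> *\<^sub>R (x, y))) (at \<tau>)" for \<tau>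
  proof -
    have "((\<lambda>\<tau>. \<tau> *\<^sub>R (x, y)) has_derivative (\<lambda>t. t *\<^sub>R (x, y))) (at \<tau>)"
      by (auto intro!: derivative_eq_intros)
    then have "((\<lambda>\<tau>. \<Phi> (\<tau> *\<^sub>R (x, y))) has_derivative
       (\<lambda>t. fst (t *\<^sub>R (x, y)) * D1 (\<tau> *\<^sub>R (x, y)) + snd (t *\<^sub>R (x, y)) * D2 (\<tau> *\<^sub>R (x, y)))) (at \<tau>)"
      by (rule has_derivative_compose[OF _ \<Phi>])
    then show ?thesis
      unfolding has_field_derivative_def
      by (rule has_derivative_eq_rhs) (simp add: fun_eq_iff algebra_simps)
  qed
  \<comment> \<open>The mean value theorem on the segment from the origin. The resulting linear
    growth is what places \<Phi>(a, b) in L with exponent \<open>\<Lambda> 0\<close>.\<close>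
  from MVT2[of 0 1 "\<lambda>\<tau>. \<Phi> (\<tau> *\<^sub>R (x, y))", OF _ this]
  obtain \<tau> where \<tau>: "\<Phi> (x, y) - \<Phi> (0, 0) = x * D1 (\<tau> *\<^sub>R (x, y)) + y * D2 (\<tau> *\<^sub>R (x, y))"
    by (auto simp: zero_prod_def)
  have "\<bar>x * D1 z\<bar> \<le> B * \<bar>x\<bar>" "\<bar>y * D2 z\<bar> \<le> B * \<bar>y\<bar>" for z
    using B[of z] by (simp_all add: abs_mult mult.commute[of B] mult_left_mono)
  note this[of "\<tau> *\<^sub>R (x, y)"]
  moreover have "B * (\<bar>x\<bar> + \<bar>y\<bar>) = B * \<bar>x\<bar> + B * \<bar>y\<bar>" by (simp add: ring_distribs)
  ultimately show ?thesis using \<tau> by linarith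
qed

context sobolev_measure
begin

text \<open>The operators \<open>T s\<close> are obtained before the functions are given. One
  formula thus describes the derivatives for all arguments, and those along a sequence can be
  compared with those of its limit.\<close>

lemma superposition_represents:
  assumes S: "smooth_class S" and D: "D1 \<in> S" "D2 \<in> S"
    and \<Phi>: "\<And>z. (\<Phi> has_derivative (\<lambda>k. fst k * D1 z + snd k * D2 z)) (at z)"
  obtains T where "\<And>s. 1 \<le> mi_order s \<Longrightarrow> mi_order s \<le> k \<Longrightarrow> fdb_op S (mi_order s) (T s)"
    "\<And>A a B b. represents A a \<Longrightarrow> represents B b \<Longrightarrow>
      represents (\<lambda>s. if s = (\<lambda>_. 0) then (\<lambda>x. \<Phi> (A (\<lambda>_. 0) x, B (\<lambda>_. 0) x)) else T s (\<lambda>c. if c then B else A)) (\<lambda>x. \<Phi> (a x, b x))"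
proof -
  let ?o = "\<lambda>_ :: 'n. 0 :: nat"
  define R where "R s T \<longleftrightarrow> fdb_op S (mi_order s) T \<and>
    (\<forall>A \<phi>. good_family A \<longrightarrow> borel_locint (\<lambda>x. \<Phi> (A False ?o x, A True ?o x)) \<longrightarrow> test_fun \<phi> \<longrightarrow>
      (\<integral>x. \<Phi> (A False ?o x, A True ?o x) * multi_partial s \<phi> x \<partial>lborel)
      = (- 1) ^ mi_order s * (\<integral>x. T A x * \<phi> x \<partial>lborel))" for s T
  have "\<exists>T. R s T" if s: "1 \<le> mi_order s" "mi_order s \<le> k" for s
    unfolding R_def by (rule superposition_weak_deriv[OF S D \<Phi> s]) blast
  then obtain T where T: "\<And>s. 1 \<le> mi_order s \<Longrightarrow> mi_order s \<le> k \<Longrightarrow> R s (T s)" by metis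
  then have T: "\<And>s. 1 \<le> mi_order s \<Longrightarrow> mi_order s \<le> k \<Longrightarrow> fdb_op S (mi_order s) (T s)"
    "\<And>s A \<phi>. 1 \<le> mi_order s \<Longrightarrow> mi_order s \<le> k \<Longrightarrow> good_family A \<Longrightarrow> borel_locint (\<lambda>x. \<Phi> (A False ?o x, A True ?o x)) \<Longrightarrow> test_fun \<phi> \<Longrightarrow>
      (\<integral>x. \<Phi> (A False ?o x, A True ?o x) * multi_partial s \<phi> x \<partial>lborel)
      = (- 1) ^ mi_order s * (\<integral>x. T s A x * \<phi> x \<partial>lborel)"
    unfolding R_def by blast+
  obtain B1 B2 where "\<And>z. \<bar>D1 z\<bar> \<le> B1" "\<And>z. \<bar>D2 z\<bar> \<le> B2"
    using S D unfolding smooth_class_def by blast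
  then have K: "\<And>z. \<bar>D1 z\<bar> \<le> max B1 B2" "\<And>z. \<bar>D2 z\<bar> \<le> max B1 B2"
    by (simp_all add: le_max_iff_disj)
  define K where "K = max B1 B2"
  have growth: "\<bar>\<Phi> (x, y)\<bar> \<le> \<bar>\<Phi> (0, 0)\<bar> + K * (\<bar>x\<bar> + \<bar>y\<bar>)" for x y
    unfolding K_def by (rule bounded_partials_linear_growth[OF \<Phi> K])
  have "0 \<le> K" using K(1)[of "(0, 0)"] unfolding K_def by linarith
  have [measurable]: "\<Phi> \<in> borel_measurable borel"
    using has_derivative_continuous[OF \<Phi>]
    by (intro borel_measurable_continuous_onI continuous_at_imp_continuous_on ballI) blast
  have main: "represents (\<lambda>s. if s = ?o then (\<lambda>x. \<Phi> (A ?o x, B ?o x)) else T s (\<lambda>c. if c then B else A)) (\<lambda>x. \<Phi> (a x, b x))"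
    if a: "represents A a" and b: "represents B b" for A a B b
  proof -
    define P where "P = (\<lambda>c. if c then B else A)"
    have P: "good_family P" unfolding P_def by (rule good_family_represents[OF a b])
    have o: "mi_order ?o \<le> k" by simp
    have A0 [measurable]: "A ?o \<in> borel_measurable borel" "B ?o \<in> borel_measurable borel"
      using representsD(3)[OF a o] representsD(3)[OF b o] by auto
    have \<Phi>0 [measurable]: "(\<lambda>x. \<Phi> (A ?o x, B ?o x)) \<in> borel_measurable borel" by measurable
    have \<Phi>i: "integrable \<mu> (\<lambda>x. \<bar>\<Phi> (A ?o x, B ?o x)\<bar> powr \<Lambda> 0)"
    proof -
      have L0: "1 \<le> \<Lambda> 0" by (rule Lambda_ge_1) simp
      have i0: "integrable \<mu> (\<lambda>x. \<bar>A ?o x\<bar> powr \<Lambda> 0)" "integrable \<mu> (\<lambda>x. \<bar>B ?o x\<bar> powr \<Lambda> 0)"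
        using representsD(4)[OF a o] representsD(4)[OF b o] by auto
      have "integrable \<mu> (\<lambda>x. \<bar>K * (\<bar>A ?o x\<bar> + \<bar>B ?o x\<bar>)\<bar> powr \<Lambda> 0)"
        using integrable_powr_add[OF borel_imp_mu[OF A0(1)] borel_imp_mu[OF A0(2)] L0 i0] \<open>0 \<le> K\<close>
        by (simp add: abs_mult powr_mult)
      then show ?thesis
      proof (rule integrable_powr_dominated[rotated 5])
        show "\<bar>\<Phi> (A ?o x, B ?o x)\<bar> \<le> \<bar>\<bar>\<Phi> (0, 0)\<bar>\<bar> + \<bar>K * (\<bar>A ?o x\<bar> + \<bar>B ?o x\<bar>)\<bar>" for x
          using growth[of "A ?o x" "B ?o x"] \<open>0 \<le> K\<close> by (simp add: abs_mult)
        show "(\<lambda>x. K * (\<bar>A ?o x\<bar> + \<bar>B ?o x\<bar>)) \<in> borel_measurable \<mu>"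
          by (rule borel_imp_mu) measurable
        show "(\<lambda>x. \<Phi> (A ?o x, B ?o x)) \<in> borel_measurable \<mu>" by (rule borel_imp_mu[OF \<Phi>0])
      qed (use L0 in auto)
    qed
    have loc: "borel_locint (\<lambda>x. \<Phi> (P False ?o x, P True ?o x))"
      using locint_of_Lp[OF \<Phi>0 Lambda_ge_1[of 0] \<Phi>i] by (simp add: P_def)
    show ?thesis
      unfolding represents_def P_def[symmetric]
    proof (intro conjI allI impI)
      have "a \<in> borel_measurable lebesgue" "b \<in> borel_measurable lebesgue"
        using representsD(1)[OF a] representsD(1)[OF b] mu_measurable_iff by auto
      then have "(\<lambda>x. \<Phi> (a x, b x)) \<in> borel_measurable lebesgue" by measurable
      then show "(\<lambda>x. \<Phi> (a x, b x)) \<in> borel_measurable \<mu>" using mu_measurable_iff by blast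
      show "AE x in lborel. \<Phi> (a x, b x) = (if ?o = ?o then \<lambda>x. \<Phi> (A ?o x, B ?o x) else T ?o P) x"
        using representsD(2)[OF a] representsD(2)[OF b] by eventually_elim simp
      fix s :: "'n \<Rightarrow> nat" and \<phi> :: "real^'n \<Rightarrow> real" assume s: "mi_order s \<le> k"
      have s1: "1 \<le> mi_order s" if "s \<noteq> ?o" using that mi_order_eq_0_iff[of s] by linarith
      show "(if s = ?o then \<lambda>x. \<Phi> (A ?o x, B ?o x) else T s P) \<in> borel_measurable borel"
        using \<Phi>0 fdb_op_borel[OF S _ T(1)[OF s1 s] s, of P] P by (auto simp: good_family_def)
      show "integrable \<mu> (\<lambda>x. \<bar>(if s = ?o then \<lambda>x. \<Phi> (A ?o x, B ?o x) else T s P) x\<bar> powr \<Lambda> (mi_order s))"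
        using \<Phi>i fdb_op_Lp[OF S T(1)[OF s1 s] s1 s P] by (cases "s = ?o") auto
      assume \<phi>: "test_fun \<phi>"
      show "(\<integral>x. (if ?o = ?o then \<lambda>x. \<Phi> (A ?o x, B ?o x) else T ?o P) x * multi_partial s \<phi> x \<partial>lborel)
        = (- 1) ^ mi_order s * (\<integral>x. (if s = ?o then \<lambda>x. \<Phi> (A ?o x, B ?o x) else T s P) x * \<phi> x \<partial>lborel)"
      proof (cases "s = ?o")
        case True
        then show ?thesis by (simp add: multi_partial_zero)
      next
        case False
        then show ?thesis using T(2)[OF s1[OF False] s P loc \<phi>] by (simp add: P_def)
      qed
    qed
  qed
  show ?thesis using that[of T] T(1) main by blast
qed

end


section \<open>Continuity of the superposition operator\<close>

lemma geometric_L1_dominated: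
  fixes f :: "nat \<Rightarrow> 'a \<Rightarrow> real"
  assumes f: "\<And>n. integrable M (f n)" "\<And>n x. 0 \<le> f n x" "\<And>n. (\<integral>x. f n x \<partial>M) \<le> (1 / 2) ^ n"
  obtains D where "integrable M D" "\<And>x. 0 \<le> D x" "AE x in M. (\<forall>n. f n x \<le> D x) \<and> (\<lambda>n. f n x) \<longlonglongrightarrow> 0"
proof -
  have [measurable]: "f n \<in> borel_measurable M" for n using f(1) by simp
  \<comment> \<open>The majorant is the sum of the series. Its integral is finite by the geometric
    bound, so the series converges almost everywhere; there each term is at most the sum, and the
    terms tend to 0.\<close>
  have geo: "summable (\<lambda>n. (1 / 2 :: real) ^ n)" by (intro summable_geometric) simp
  have sI: "summable (\<lambda>n. \<integral>x. f n x \<partial>M)"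
    by (rule summable_comparison_test'[OF geo]) (use f in \<open>auto simp: abs_of_nonneg integral_nonneg_AE\<close>)
  have "(\<integral>\<^sup>+x. (\<Sum>n. ennreal (f n x)) \<partial>M) = (\<Sum>n. \<integral>\<^sup>+x. ennreal (f n x) \<partial>M)"
    by (rule nn_integral_suminf) simp
  also have "\<dots> = (\<Sum>n. ennreal (\<integral>x. f n x \<partial>M))"
    using f by (simp add: nn_integral_eq_integral)
  also have "\<dots> = ennreal (\<Sum>n. \<integral>x. f n x \<partial>M)"
    by (rule suminf_ennreal2) (use f sI in \<open>auto intro: integral_nonneg_AE\<close>)
  finally have "(\<integral>\<^sup>+x. (\<Sum>n. ennreal (f n x)) \<partial>M) \<noteq> \<infinity>" by simp
  then have "AE x in M. (\<Sum>n. ennreal (f n x)) \<noteq> \<infinity>"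
    by (rule nn_integral_PInf_AE[rotated]) simp
  then have sm: "AE x in M. summable (\<lambda>n. f n x)"
    by eventually_elim (use f(2) in \<open>auto intro: summable_suminf_not_top\<close>)
  have "integrable M (\<lambda>x. \<Sum>n. f n x)"
    by (rule integrable_suminf) (use f sm sI in auto)
  \<comment> \<open>The absolute value keeps the majorant nonnegative also at points of divergence,
    where \<open>suminf\<close> carries no information.\<close>
  then have "integrable M (\<lambda>x. \<bar>\<Sum>n. f n x\<bar>)" by simp
  moreover have "AE x in M. (\<forall>n. f n x \<le> \<bar>\<Sum>n. f n x\<bar>) \<and> (\<lambda>n. f n x) \<longlonglongrightarrow> 0"
    using sm
  proof eventually_elim
    case (elim x)
    have "f n x \<le> (\<Sum>n. f n x)" for n
      using sum_le_suminf[OF elim, of "{n}"] f(2) by simp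
    then show ?case using summable_LIMSEQ_zero[OF elim] by (auto intro: order_trans[OF _ abs_ge_self])
  qed
  ultimately show ?thesis using that by simp
qed

lemma Lp_norm_nonneg: "0 \<le> Lp_norm p M f"
  by (simp add: Lp_norm_def)

context sobolev_measure
begin

text \<open>One summand of the norm is at most the whole, and since \<open>\<delta> \<le> 1\<close>
  and the exponents are at least 1, raising \<delta> to an exponent only lowers it. One bound
  therefore serves all orders.\<close>

lemma sobolev_norm_small_imp_integral_small:
  assumes r: "represents A a" and s: "mi_order s \<le> k" and \<delta>: "0 < \<delta>" "\<delta> \<le> 1"
    and n: "sobolev_norm k \<Lambda> \<mu> a < \<delta>"
  shows "(\<integral>x. \<bar>A s x\<bar> powr \<Lambda> (mi_order s) \<partial>\<mu>) \<le> \<delta>"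
proof -
  let ?p = "\<Lambda> (mi_order s)" and ?N = "\<lambda>s. Lp_norm (\<Lambda> (mi_order s)) \<mu> (A s)"
  have p: "1 \<le> ?p" "1 \<le> \<Lambda> 0" using Lambda_ge_1 s by auto
  have I0: "0 \<le> (\<integral>x. \<bar>A s x\<bar> powr ?p \<partial>\<mu>)" by (intro integral_nonneg_AE) simp
  have "?N s powr \<Lambda> 0 \<le> (\<Sum>s | mi_order s \<le> k. ?N s powr \<Lambda> 0)"
    using s by (intro member_le_sum[of s _ "\<lambda>s. ?N s powr \<Lambda> 0"]) (auto simp: finite_mi_order_le)
  then have "(?N s powr \<Lambda> 0) powr (1 / \<Lambda> 0) \<le> sobolev_norm k \<Lambda> \<mu> a"
    unfolding represents_sobolev_norm[OF r] using p by (intro powr_mono2) auto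
  then have "?N s < \<delta>" using n p Lp_norm_nonneg[of ?p \<mu> "A s"] by (simp add: powr_powr)
  then have "?N s powr ?p \<le> \<delta> powr ?p"
    using p Lp_norm_nonneg[of ?p \<mu> "A s"] by (intro powr_mono2) auto
  also have "\<dots> \<le> \<delta> powr 1" using p \<delta> by (intro powr_mono') auto
  finally show ?thesis using p \<delta> I0 by (simp add: Lp_norm_def powr_powr)
qed

lemma sobolev_norm_tendsto_0:
  assumes r: "\<And>n. represents (A n) (a n)"
    and l: "\<And>s. mi_order s \<le> k \<Longrightarrow> (\<lambda>n. \<integral>x. \<bar>A n s x\<bar> powr \<Lambda> (mi_order s) \<partial>\<mu>) \<longlonglongrightarrow> 0"
  shows "(\<lambda>n. sobolev_norm k \<Lambda> \<mu> (a n)) \<longlonglongrightarrow> 0"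
proof -
  have L0: "0 < \<Lambda> 0" using Lambda_ge_1[of 0] by simp
  have pw: "(\<lambda>n. f n powr q) \<longlonglongrightarrow> 0" if "f \<longlonglongrightarrow> 0" "\<And>n. 0 \<le> f n" "0 < q" for f :: "nat \<Rightarrow> real" and q
    using tendsto_powr'[OF that(1) tendsto_const[of q]] that by auto
  have "(\<lambda>n. \<Sum>s | mi_order s \<le> k. Lp_norm (\<Lambda> (mi_order s)) \<mu> (A n s) powr \<Lambda> 0) \<longlonglongrightarrow> (\<Sum>s :: 'n \<Rightarrow> nat | mi_order s \<le> k. 0)"
  proof (rule tendsto_sum)
    fix s :: "'n \<Rightarrow> nat" assume "s \<in> {s. mi_order s \<le> k}"
    then have s: "mi_order s \<le> k" by simp
    have "(\<lambda>n. Lp_norm (\<Lambda> (mi_order s)) \<mu> (A n s)) \<longlonglongrightarrow> 0"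
      unfolding Lp_norm_def using l[OF s] Lambda_ge_1[OF s]
      by (intro pw) (auto intro: integral_nonneg_AE)
    then show "(\<lambda>n. Lp_norm (\<Lambda> (mi_order s)) \<mu> (A n s) powr \<Lambda> 0) \<longlonglongrightarrow> 0"
      by (rule pw[OF _ Lp_norm_nonneg L0])
  qed
  then show ?thesis
    unfolding represents_sobolev_norm[OF r] using L0 by (intro pw) (auto intro: sum_nonneg)
qed

text \<open>A sequence converging fast enough converges almost everywhere and is dominated, together with all
  derivatives; dominated convergence then applies to every term of the formula of Faa di Bruno.\<close>

lemma fast_convergence_dominated:
  assumes A: "represents A a" and B: "\<And>n. represents (B n) (b n)"
    and fast: "\<And>n. sobolev_norm k \<Lambda> \<mu> (\<lambda>x. b n x - a x) < (1 / 2) ^ n"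
  obtains G where "\<And>s. mi_order s \<le> k \<Longrightarrow> G s \<in> borel_measurable \<mu>"
    "\<And>s. mi_order s \<le> k \<Longrightarrow> integrable \<mu> (\<lambda>x. \<bar>G s x\<bar> powr \<Lambda> (mi_order s))"
    "AE x in \<mu>. \<forall>s\<in>{s. mi_order s \<le> k}. (\<forall>n. \<bar>B n s x\<bar> \<le> \<bar>G s x\<bar>) \<and> \<bar>A s x\<bar> \<le> \<bar>G s x\<bar> \<and> (\<lambda>n. B n s x) \<longlonglongrightarrow> A s x"
proof -
  define f where "f s n x = \<bar>B n s x - A s x\<bar> powr \<Lambda> (mi_order s)" for s n x
  define Q where "Q s D \<longleftrightarrow> integrable \<mu> D \<and> (\<forall>x. 0 \<le> D x) \<and> (AE x in \<mu>. (\<forall>n. f s n x \<le> D x) \<and> (\<lambda>n. f s n x) \<longlonglongrightarrow> 0)" for s D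
  have "\<exists>D. Q s D" if s: "mi_order s \<le> k" for s
  proof -
    have d: "represents (\<lambda>s x. B n s x - A s x) (\<lambda>x. b n x - a x)" for n
      by (rule represents_diff[OF A B])
    have I: "integrable \<mu> (f s n)" "(\<integral>x. f s n x \<partial>\<mu>) \<le> (1 / 2) ^ n" for n
      using representsD(4)[OF d s] sobolev_norm_small_imp_integral_small[OF d s _ _ fast, of n]
      by (simp_all add: f_def[abs_def] power_le_one)
    have nn: "0 \<le> f s n x" for n x by (simp add: f_def)
    show ?thesis
      by (rule geometric_L1_dominated[OF I(1) nn I(2)]) (auto simp: Q_def)
  qed
  then obtain D where D: "\<And>s. mi_order s \<le> k \<Longrightarrow> Q s (D s)" by metis
  \<comment> \<open>\<open>D s\<close> dominates the powers of the differences
    \<open>B n s - A s\<close>, so its root dominates the differences; adding the absolute value of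
    \<open>A s\<close> covers all \<open>B n s\<close> and \<open>A s\<close>.\<close>
  define G where "G s x = \<bar>A s x\<bar> + D s x powr (1 / \<Lambda> (mi_order s))" for s x
  show ?thesis
  proof (rule that[of G])
    fix s :: "'n \<Rightarrow> nat" assume s: "mi_order s \<le> k"
    have p: "1 \<le> \<Lambda> (mi_order s)" by (rule Lambda_ge_1[OF s])
    have Ds: "integrable \<mu> (D s)" "0 \<le> D s x" for x using D[OF s] by (auto simp: Q_def)
    have Am [measurable]: "A s \<in> borel_measurable \<mu>" by (rule borel_imp_mu[OF representsD(3)[OF A s]])
    have Dm [measurable]: "D s \<in> borel_measurable \<mu>" using Ds by simp
    show "G s \<in> borel_measurable \<mu>" unfolding G_def by measurable
    have "integrable \<mu> (\<lambda>x. (\<bar>A s x\<bar> + \<bar>D s x powr (1 / \<Lambda> (mi_order s))\<bar>) powr \<Lambda> (mi_order s))"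
      using Ds p by (intro integrable_powr_add p representsD(4)[OF A s]) (auto simp: powr_powr)
    then show "integrable \<mu> (\<lambda>x. \<bar>G s x\<bar> powr \<Lambda> (mi_order s))" by (simp add: G_def)
  next
    have "AE x in \<mu>. \<forall>s\<in>{s. mi_order s \<le> k}. (\<forall>n. f s n x \<le> D s x) \<and> (\<lambda>n. f s n x) \<longlonglongrightarrow> 0"
      using D by (intro AE_finite_allI finite_mi_order_le) (auto simp: Q_def)
    then show "AE x in \<mu>. \<forall>s\<in>{s. mi_order s \<le> k}. (\<forall>n. \<bar>B n s x\<bar> \<le> \<bar>G s x\<bar>) \<and> \<bar>A s x\<bar> \<le> \<bar>G s x\<bar> \<and> (\<lambda>n. B n s x) \<longlonglongrightarrow> A s x"
    proof eventually_elim
      case (elim x)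
      show ?case
      proof
        fix s :: "'n \<Rightarrow> nat" assume "s \<in> {s. mi_order s \<le> k}"
        then have s: "mi_order s \<le> k" by simp
        let ?p = "\<Lambda> (mi_order s)"
        have p: "1 \<le> ?p" by (rule Lambda_ge_1[OF s])
        have fe: "f s n x \<le> D s x" "(\<lambda>n. f s n x) \<longlonglongrightarrow> 0" for n using elim s by auto
        have root: "\<bar>B n s x - A s x\<bar> = f s n x powr (1 / ?p)" for n
          using p by (simp add: f_def powr_powr)
        have le: "\<bar>B n s x - A s x\<bar> \<le> D s x powr (1 / ?p)" for n
          unfolding root using fe(1) p by (intro powr_mono2) (auto simp: f_def)
        have "\<bar>B n s x\<bar> \<le> \<bar>G s x\<bar>" for n using le[of n] by (simp add: G_def)
        moreover have "\<bar>A s x\<bar> \<le> \<bar>G s x\<bar>" by (simp add: G_def)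
        moreover have "(\<lambda>n. B n s x) \<longlonglongrightarrow> A s x"
        proof -
          have "(\<lambda>n. f s n x powr (1 / ?p)) \<longlonglongrightarrow> 0"
            using tendsto_powr'[OF fe(2) tendsto_const[of "1 / ?p"]] p by (auto simp: f_def)
          then have "(\<lambda>n. B n s x - A s x) \<longlonglongrightarrow> 0" unfolding root[symmetric] by (simp add: tendsto_rabs_zero_iff)
          then show ?thesis by (simp add: LIM_zero_iff)
        qed
        ultimately show "(\<forall>n. \<bar>B n s x\<bar> \<le> \<bar>G s x\<bar>) \<and> \<bar>A s x\<bar> \<le> \<bar>G s x\<bar> \<and> (\<lambda>n. B n s x) \<longlonglongrightarrow> A s x" by simp
      qed
    qed
  qed
qed

text \<open>The bound by the gauge has one constant for all families, and the gauge is monotone in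
  the derivatives. Domination of the derivatives by \<open>G\<close> therefore carries over to the
  nonlinear \<open>T\<close>, although \<open>G\<close> itself need not consist of
  derivatives.\<close>

lemma fdb_op_integral_tendsto:
  assumes S: "smooth_class S" and T: "fdb_op S j T" and j: "1 \<le> j" "j \<le> k"
    and P: "\<And>n. good_family (P n)" and P0: "good_family P0"
    and G: "\<And>c s. mi_order s \<le> k \<Longrightarrow> G c s \<in> borel_measurable \<mu>"
      "\<And>c s. mi_order s \<le> k \<Longrightarrow> integrable \<mu> (\<lambda>x. \<bar>G c s x\<bar> powr \<Lambda> (mi_order s))"
    and ae: "AE x in \<mu>. \<forall>s\<in>{s. mi_order s \<le> k}. \<forall>c. (\<forall>n. \<bar>P n c s x\<bar> \<le> \<bar>G c s x\<bar>) \<and> \<bar>P0 c s x\<bar> \<le> \<bar>G c s x\<bar> \<and> (\<lambda>n. P n c s x) \<longlonglongrightarrow> P0 c s x"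
  shows "(\<lambda>n. \<integral>x. \<bar>T (P n) x - T P0 x\<bar> powr \<Lambda> j \<partial>\<mu>) \<longlonglongrightarrow> 0"
proof -
  have p: "1 \<le> \<Lambda> j" by (rule Lambda_ge_1[OF j(2)])
  have [measurable]: "T A \<in> borel_measurable \<mu>" if "good_family A" for A
    using that by (intro borel_imp_mu fdb_op_borel[OF S _ T j(2)]) (auto simp: good_family_def)
  have m: "(\<lambda>x. \<bar>T (P n) x - T P0 x\<bar> powr \<Lambda> j) \<in> borel_measurable \<mu>" for n
    using P P0 by measurable
  obtain K where K: "0 \<le> K" "\<And>A x. \<bar>T A x\<bar> powr \<Lambda> j \<le> K * fdb_gauge k A x powr \<Lambda> 1"
    using fdb_op_powr_bound[OF S T j] by blast
  \<comment> \<open>The outer factor is the constant of \<open>powr_add_le\<close>; the inner 2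
    counts \<open>T (P n)\<close> and \<open>T P0\<close>, each bounded through the gauge of
    \<open>G\<close>.\<close>
  let ?w = "\<lambda>x. 2 powr \<Lambda> j * (2 * (K * fdb_gauge k G x powr \<Lambda> 1))"
  have "(\<lambda>n. \<integral>x. \<bar>T (P n) x - T P0 x\<bar> powr \<Lambda> j \<partial>\<mu>) \<longlonglongrightarrow> (\<integral>x. 0 \<partial>\<mu>)"
  proof (rule integral_dominated_convergence[OF _ m])
    show "integrable \<mu> ?w" by (intro integrable_mult_right integrable_gauge G)
    show "AE x in \<mu>. (\<lambda>n. \<bar>T (P n) x - T P0 x\<bar> powr \<Lambda> j) \<longlonglongrightarrow> 0"
      using ae
    proof eventually_elim
      case (elim x)
      have "(\<lambda>n. T (P n) x) \<longlonglongrightarrow> T P0 x"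
        by (rule fdb_op_tendsto[OF S _ T j(2)]) (use elim in auto)
      then have "(\<lambda>n. \<bar>T (P n) x - T P0 x\<bar>) \<longlonglongrightarrow> 0"
        by (intro tendsto_rabs_zero) (simp add: LIM_zero)
      then show ?case using tendsto_powr'[OF _ tendsto_const[of "\<Lambda> j"]] p by force
    qed
    show "AE x in \<mu>. norm (\<bar>T (P n) x - T P0 x\<bar> powr \<Lambda> j) \<le> ?w x" for n
      using ae
    proof eventually_elim
      case (elim x)
      have g: "\<bar>T A x\<bar> powr \<Lambda> j \<le> K * fdb_gauge k G x powr \<Lambda> 1"
        if A: "\<And>c s. mi_order s \<le> k \<Longrightarrow> \<bar>A c s x\<bar> \<le> \<bar>G c s x\<bar>" for A
      proof -
        have "fdb_gauge k A x powr \<Lambda> 1 \<le> fdb_gauge k G x powr \<Lambda> 1"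
          using A Lambda_ge_1[of 1] k by (intro powr_mono2 gauge_mono gauge_nonneg) auto
        then show ?thesis using K(2)[of A x] mult_left_mono[OF _ K(1)] by (meson order_trans)
      qed
      have "\<bar>T (P n) x - T P0 x\<bar> powr \<Lambda> j \<le> (\<bar>T (P n) x\<bar> + \<bar>T P0 x\<bar>) powr \<Lambda> j"
        using p by (intro powr_mono2) auto
      also have "\<dots> \<le> 2 powr \<Lambda> j * (\<bar>T (P n) x\<bar> powr \<Lambda> j + \<bar>T P0 x\<bar> powr \<Lambda> j)"
        using p by (intro powr_add_le) auto
      also have "\<dots> \<le> ?w x"
        using g[of "P n"] g[of P0] elim by (intro mult_left_mono) auto
      finally show ?case by simp
    qed
  qed simp
  then show ?thesis by simp
qed

text \<open>If continuity failed at \<open>a\<close>, the radii \<open>(1/2)^n\<close> would give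
  counterexamples \<open>b n\<close> that already converge fast, with no subsequence to be selected.
  The norms of the differences of the images then tend to 0, against their lower bound
  \<epsilon>.\<close>

lemma Nemytskii_psi_continuous: "sobolev_continuous k \<Lambda> \<mu> Nemytskii_psi"
  unfolding sobolev_continuous_def
proof (intro ballI allI impI, rule ccontr)
  fix a :: "real^'n \<Rightarrow> real" and \<epsilon> :: real
  assume a: "a \<in> sobolev_space k \<Lambda> \<mu>" and \<epsilon>: "0 < \<epsilon>"
    and neg: "\<not> (\<exists>\<delta>>0. \<forall>b\<in>sobolev_space k \<Lambda> \<mu>. sobolev_norm k \<Lambda> \<mu> (\<lambda>x. b x - a x) < \<delta> \<longrightarrow>
        sobolev_norm k \<Lambda> \<mu> (\<lambda>x. Nemytskii_psi b x - Nemytskii_psi a x) < \<epsilon>)"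
  have "\<exists>b. b \<in> sobolev_space k \<Lambda> \<mu> \<and> sobolev_norm k \<Lambda> \<mu> (\<lambda>x. b x - a x) < (1 / 2) ^ n \<and>
      \<not> sobolev_norm k \<Lambda> \<mu> (\<lambda>x. Nemytskii_psi b x - Nemytskii_psi a x) < \<epsilon>" for n
  proof -
    have "(0::real) < (1 / 2) ^ n" by simp
    then show ?thesis using neg by blast
  qed
  then obtain b where b: "\<And>n. b n \<in> sobolev_space k \<Lambda> \<mu>"
    "\<And>n. sobolev_norm k \<Lambda> \<mu> (\<lambda>x. b n x - a x) < (1 / 2) ^ n"
    "\<And>n. \<not> sobolev_norm k \<Lambda> \<mu> (\<lambda>x. Nemytskii_psi (b n) x - Nemytskii_psi a x) < \<epsilon>" by metis
  obtain A where A: "represents A a" using sobolev_imp_represents[OF a] by blast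
  have "\<exists>B. represents B (b n)" for n using sobolev_imp_represents[OF b(1)] by blast
  then obtain B where B: "\<And>n. represents (B n) (b n)" by metis
  \<comment> \<open>The weights 1 and 0 are one admissible choice: the partials of
    \<open>psi (fst z)\<close> lie in \<open>mix_class u v\<close> for all weights.\<close>
  obtain D1 D2 where D: "D1 \<in> mix_class 1 0" "D2 \<in> mix_class 1 0"
    "\<And>z. ((\<lambda>z. psi (fst z)) has_derivative (\<lambda>k. fst k * D1 z + snd k * D2 z)) (at z)"
    using psi_fst_partials by blast
  have S: "smooth_class (mix_class 1 0)" by (rule smooth_class_mix_class) auto
  let ?o = "\<lambda>_ :: 'n. 0 :: nat"
  \<comment> \<open>The superposition has two slots; \<open>psi (fst z)\<close> reads the first, and
    the second is filled with a copy of the same family.\<close>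
  let ?P = "\<lambda>A c. if c then A else A :: ('n \<Rightarrow> nat) \<Rightarrow> real^'n \<Rightarrow> real"
  obtain T where T: "\<And>s. 1 \<le> mi_order s \<Longrightarrow> mi_order s \<le> k \<Longrightarrow> fdb_op (mix_class 1 0) (mi_order s) (T s)"
    "\<And>A a B b. represents A a \<Longrightarrow> represents B b \<Longrightarrow>
      represents (\<lambda>s. if s = ?o then (\<lambda>x. psi (fst (A ?o x, B ?o x))) else T s (\<lambda>c. if c then B else A)) (\<lambda>x. psi (fst (a x, b x)))"
    using superposition_represents[OF S D] by blast
  define R where "R A = (\<lambda>s. if s = ?o then (\<lambda>x. psi (A ?o x)) else T s (?P A))" for A
  have R: "represents (R A) (Nemytskii_psi a)" if "represents A a" for A a
    using T(2)[OF that that] unfolding R_def Nemytskii_psi_def fst_conv .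
  obtain G where G: "\<And>s. mi_order s \<le> k \<Longrightarrow> G s \<in> borel_measurable \<mu>"
    "\<And>s. mi_order s \<le> k \<Longrightarrow> integrable \<mu> (\<lambda>x. \<bar>G s x\<bar> powr \<Lambda> (mi_order s))"
    "AE x in \<mu>. \<forall>s\<in>{s. mi_order s \<le> k}. (\<forall>n. \<bar>B n s x\<bar> \<le> \<bar>G s x\<bar>) \<and> \<bar>A s x\<bar> \<le> \<bar>G s x\<bar> \<and> (\<lambda>n. B n s x) \<longlonglongrightarrow> A s x"
    using fast_convergence_dominated[OF A B b(2)] by blast
  have lim: "(\<lambda>n. \<integral>x. \<bar>R (B n) s x - R A s x\<bar> powr \<Lambda> (mi_order s) \<partial>\<mu>) \<longlonglongrightarrow> 0" if s: "mi_order s \<le> k" for s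
  proof (cases "s = ?o")
    \<comment> \<open>At order 0 \<open>psi\<close> is unbounded and no \<open>fdb_op\<close> term;
      the Lipschitz bound compares the integral directly with that of
      \<open>B n s - A s\<close>.\<close>
    case True
    have d: "represents (\<lambda>s x. B n s x - A s x) (\<lambda>x. b n x - a x)" for n
      by (rule represents_diff[OF A B])
    have rd: "represents (\<lambda>s x. R (B n) s x - R A s x) (\<lambda>x. Nemytskii_psi (b n) x - Nemytskii_psi a x)" for n
      by (rule represents_diff[OF R[OF A] R[OF B]])
    have "(\<integral>x. \<bar>R (B n) s x - R A s x\<bar> powr \<Lambda> (mi_order s) \<partial>\<mu>) \<le> (1 / 2) ^ n" for n
    proof -
      have "(\<integral>x. \<bar>R (B n) s x - R A s x\<bar> powr \<Lambda> (mi_order s) \<partial>\<mu>) \<le> (\<integral>x. \<bar>B n s x - A s x\<bar> powr \<Lambda> (mi_order s) \<partial>\<mu>)"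
        using psi_lipschitz Lambda_ge_1[OF s]
        by (intro integral_mono representsD(4)[OF rd s] representsD(4)[OF d s] powr_mono2) (auto simp: R_def True)
      also have "\<dots> \<le> (1 / 2) ^ n"
        by (rule sobolev_norm_small_imp_integral_small[OF d s _ _ b(2)]) (auto simp: power_le_one)
      finally show ?thesis .
    qed
    note le = this
    have half: "(\<lambda>n. (1 / 2 :: real) ^ n) \<longlonglongrightarrow> 0" by (rule LIMSEQ_realpow_zero) auto
    show ?thesis
    proof (rule tendsto_sandwich[OF _ _ tendsto_const half])
      show "\<forall>\<^sub>F n in sequentially. 0 \<le> (\<integral>x. \<bar>R (B n) s x - R A s x\<bar> powr \<Lambda> (mi_order s) \<partial>\<mu>)"
        by (intro always_eventually allI integral_nonneg_AE) simp
      show "\<forall>\<^sub>F n in sequentially. (\<integral>x. \<bar>R (B n) s x - R A s x\<bar> powr \<Lambda> (mi_order s) \<partial>\<mu>) \<le> (1 / 2) ^ n"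
        by (intro always_eventually allI le)
    qed
  next
    case False
    then have s1: "1 \<le> mi_order s" using mi_order_eq_0_iff[of s] by linarith
    have "(\<lambda>n. \<integral>x. \<bar>T s (?P (B n)) x - T s (?P A) x\<bar> powr \<Lambda> (mi_order s) \<partial>\<mu>) \<longlonglongrightarrow> 0"
    proof (rule fdb_op_integral_tendsto[OF S T(1)[OF s1 s] s1 s, where G = "\<lambda>c. G"])
      show "good_family (?P (B n))" for n by (rule good_family_represents[OF B B])
      show "good_family (?P A)" by (rule good_family_represents[OF A A])
      show "AE x in \<mu>. \<forall>s\<in>{s. mi_order s \<le> k}. \<forall>c. (\<forall>n. \<bar>?P (B n) c s x\<bar> \<le> \<bar>G s x\<bar>) \<and> \<bar>?P A c s x\<bar> \<le> \<bar>G s x\<bar> \<and> (\<lambda>n. ?P (B n) c s x) \<longlonglongrightarrow> ?P A c s x"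
        using G(3) by eventually_elim simp
    qed (use G in auto)
    then show ?thesis using False by (simp add: R_def)
  qed
  have "(\<lambda>n. sobolev_norm k \<Lambda> \<mu> (\<lambda>x. Nemytskii_psi (b n) x - Nemytskii_psi a x)) \<longlonglongrightarrow> 0"
    by (rule sobolev_norm_tendsto_0[OF represents_diff[OF R[OF A] R[OF B]] lim])
  then have "\<forall>\<^sub>F n in sequentially. sobolev_norm k \<Lambda> \<mu> (\<lambda>x. Nemytskii_psi (b n) x - Nemytskii_psi a x) < \<epsilon>"
    using \<epsilon> by (rule order_tendstoD(2))
  then show False using b(3) by (auto simp: eventually_sequentially)
qed

lemma superposition_sobolev:
  assumes S: "smooth_class S" and D: "D1 \<in> S" "D2 \<in> S"
    and \<Phi>: "\<And>z. (\<Phi> has_derivative (\<lambda>k. fst k * D1 z + snd k * D2 z)) (at z)"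
    and a: "a \<in> sobolev_space k \<Lambda> \<mu>" and b: "b \<in> sobolev_space k \<Lambda> \<mu>"
  shows "(\<lambda>x. \<Phi> (a x, b x)) \<in> sobolev_space k \<Lambda> \<mu>"
proof -
  obtain A where A: "represents A a" using sobolev_imp_represents[OF a] by blast
  obtain B where B: "represents B b" using sobolev_imp_represents[OF b] by blast
  show ?thesis
  proof (rule superposition_represents[OF S D \<Phi>])
    fix T
    assume "\<And>A a B b. represents A a \<Longrightarrow> represents B b \<Longrightarrow>
      represents (\<lambda>s. if s = (\<lambda>_. 0) then (\<lambda>x. \<Phi> (A (\<lambda>_. 0) x, B (\<lambda>_. 0) x)) else T s (\<lambda>c. if c then B else A)) (\<lambda>x. \<Phi> (a x, b x))"
    from represents_imp_sobolev[OF this[OF A B]] show ?thesis .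
  qed
qed

lemma Nemytskii_psi_sobolev:
  assumes a: "a \<in> sobolev_space k \<Lambda> \<mu>"
  shows "Nemytskii_psi a \<in> sobolev_space k \<Lambda> \<mu>"
proof -
  have S: "smooth_class (mix_class 1 0)" by (rule smooth_class_mix_class) auto
  obtain D1 D2 where D: "D1 \<in> mix_class 1 0" "D2 \<in> mix_class 1 0"
    "\<And>z. ((\<lambda>z. psi (fst z)) has_derivative (\<lambda>k. fst k * D1 z + snd k * D2 z)) (at z)"
    using psi_fst_partials by blast
  show ?thesis using superposition_sobolev[OF S D a a] by (simp add: Nemytskii_psi_def)
qed

lemma Nemytskii_psi_image_convex: "convex_fun_set (Nemytskii_psi ` sobolev_space k \<Lambda> \<mu>)"
  unfolding convex_fun_set_def
proof (intro ballI allI impI)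
  fix f g and u v :: real
  assume "f \<in> Nemytskii_psi ` sobolev_space k \<Lambda> \<mu>" "g \<in> Nemytskii_psi ` sobolev_space k \<Lambda> \<mu>"
    and uv: "0 \<le> u" "0 \<le> v" "u + v = 1"
  then obtain a b where a: "a \<in> sobolev_space k \<Lambda> \<mu>" "f = Nemytskii_psi a"
    and b: "b \<in> sobolev_space k \<Lambda> \<mu>" "g = Nemytskii_psi b" by blast
  obtain D1 D2 where D: "D1 \<in> mix_class u v" "D2 \<in> mix_class u v"
    "\<And>z. ((\<lambda>z. log_d (mix u v z)) has_derivative (\<lambda>k. fst k * D1 z + snd k * D2 z)) (at z)"
    using log_d_mix_partials[OF uv] by blast
  have "(\<lambda>x. log_d (mix u v (a x, b x))) \<in> sobolev_space k \<Lambda> \<mu>"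
    by (rule superposition_sobolev[OF smooth_class_mix_class[OF uv] D a(1) b(1)])
  moreover have "(\<lambda>x. u * f x + v * g x) = Nemytskii_psi (\<lambda>x. log_d (mix u v (a x, b x)))"
    unfolding Nemytskii_psi_def psi_log_d[OF mix_pos[OF uv]] by (simp add: mix_def a(2) b(2) Nemytskii_psi_def)
  ultimately show "(\<lambda>x. u * f x + v * g x) \<in> Nemytskii_psi ` sobolev_space k \<Lambda> \<mu>" by blast
qed

end

theorem proposition2:
  fixes t C :: real and \<theta> :: "real \<Rightarrow> real"
    and k :: nat and \<Lambda> :: "nat \<Rightarrow> real"
    and \<mu> :: "(real^'n::finite) measure" and G :: "(real^'n \<Rightarrow> real) set"
  assumes theta: "admissible_theta t \<theta>"
    and C: "(\<integral>z. exp (C - \<theta> \<bar>z\<bar>) \<partial>lebesgue) = 1"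
    and mu: "\<mu> = ref_measure \<theta> C"
    and k: "k \<ge> 1"
    and Lambda_0: "\<Lambda> 0 \<ge> \<Lambda> 1"
    and Lambda_1: "\<Lambda> 1 \<ge> real k"
    and Lambda_j: "\<forall>j. 2 \<le> j \<and> j \<le> k \<longrightarrow> \<Lambda> j = \<Lambda> 1 / real j"
    and G: "G = sobolev_space k \<Lambda> \<mu>"
  shows "(\<forall>a \<in> G. Nemytskii_psi a \<in> G)
    \<and> sobolev_continuous k \<Lambda> \<mu> Nemytskii_psi
    \<and> convex_fun_set (Nemytskii_psi ` G)"
proof -
  interpret sobolev_measure \<mu> k \<Lambda>
    by (rule sobolev_measure_ref_measure[OF theta C mu k Lambda_0 Lambda_1 Lambda_j])
  show ?thesis
    unfolding G using Nemytskii_psi_sobolev Nemytskii_psi_continuous Nemytskii_psi_image_convex by blast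
qed

end
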